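(* Fix $\alpha\in(0,1)$, the dimension $d$, and $\epsilon\in(0,1)$ (arbitrarily small but fixed). Let $Q_X\ne Q_Y$ be fixed distributions on $\mathbb{R}^d$ (not changing with $N$) with finite second moments. For each $N=m+n$ suppose $\mathcal X_m$ is i.i.d. from $P_{X,N}=(1-\epsilon)Q_X+\epsilon G_N$ and, independently, $\mathcal Y_n$ is i.i.d. from $P_{Y,N}=(1-\epsilon)Q_Y+\epsilon G_N$, where the distribution $G_N$ on $\mathbb{R}^d$ may change arbitrarily with $N$. Let $\phi_{\mathrm{CvM}}=\mathbf 1(U_{\mathrm{CvM}}>c_{\alpha,\mathrm{CvM}})$ and $\phi_{\mathrm{Energy}}=\mathbf 1(U_{\mathrm{Energy}}>c_{\alpha,\mathrm{Eng}})$, where $c_{\alpha,\mathrm{CvM}}$ and $c_{\alpha,\mathrm{Eng}}$ are the $\alpha$ level permutation critical values of $U_{\mathrm{CvM}}$ and $U_{\mathrm{Energy}}$. Assume $m/N\to\vartheta_X\in(0,1)$ and $n/N\to\vartheta_Y=1-\vartheta_X$ as $N\to\infty$. Then for any such $(Q_X,Q_Y)$ there exists a certain $G_N$ such that the energy test becomes asymptotically powerless, whereas the CvM test is asymptotically powerful uniformly over all possible $G_N$; that is, $$\lim_{m,n\to\infty}\ \inf_{G_N}\mathbb{E}_1[\phi_{\mathrm{Energy}}]\le\alpha\qquad\text{and}\qquad\lim_{m,n\to\infty}\ \inf_{G_N}\mathbb{E}_1[\phi_{\mathrm{CvM}}]=1 .$$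
   Context: $\mathbb{E}_1$ is expectation under the contaminated model described in the claim. Standing assumption: for $X\sim P_{X,N}$ and $Y\sim P_{Y,N}$, $\beta^\top X$ and $\beta^\top Y$ have continuous distribution functions for almost all $\beta\in\mathbb{S}^{d-1}$ (uniform measure on the unit sphere). $m,n\ge2$. Statistics: $\mathsf{Ang}(u,v)=\arccos\{u^\top v/(\|u\|\|v\|)\}$, $$h_{\mathrm{CvM}}(x_1,x_2;y_1,y_2)=\tfrac13-\tfrac1{2\pi}\mathsf{Ang}(x_1-y_1,x_2-y_1)-\tfrac1{2\pi}\mathsf{Ang}(y_1-x_1,y_2-x_1),$$ $$U_{\mathrm{CvM}}=\frac1{m(m-1)n(n-1)}\sum_{i_1\ne i_2}\sum_{j_1\neq j_2}h_{\mathrm{CvM}}(X_{i_1},X_{i_2};Y_{j_1},Y_{j_2}),$$ $$U_{\mathrm{Energy}}=\frac2{mn}\sum_{i=1}^m\sum_{j=1}^n\|X_i-Y_j\|-\frac1{m(m-1)}\sum_{i_1\ne i_2}\|X_{i_1}-X_{i_2}\|-\frac1{n(n-1)}\sum_{j_1\ne j_2}\|Y_{j_1}-Y_{j_2}\|.$$ Permutation critical value at level $\alpha$ of a statistic $T$: with pooled sample $(Z_1,\dots,Z_N)=(X_1,\dots,X_m,Y_1,\dots,Y_n)$, it is $\inf\{t:1-\alpha\le\frac1{N!}\sum_{\varpi}\mathbf 1(T(Z_\varpi)\le t)\}$, the sum over all permutations $\varpi$ of $\{1,\dots,N\}$, where $T(Z_\varpi)$ is $T$ computed with first sample $Z_{\varpi(1)},\dots,Z_{\varpi(m)}$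 and second sample $Z_{\varpi(m+1)},\dots,Z_{\varpi(N)}$. *)

theory Defs
  imports "HOL-Probability.Probability" "HOL-Combinatorics.Permutations"
begin

definition Ang :: "'a::euclidean_space \<Rightarrow> 'a \<Rightarrow> real" where
  "Ang u v = arccos ((u \<bullet> v) / (norm u * norm v))"

definition h_CvM :: "'a::euclidean_space \<Rightarrow> 'a \<Rightarrow> 'a \<Rightarrow> 'a \<Rightarrow> real" where
  "h_CvM x1 x2 y1 y2 =
     1 / 3 - 1 / (2 * pi) * Ang (x1 - y1) (x2 - y1) - 1 / (2 * pi) * Ang (y1 - x1) (y2 - x1)"

text \<open>Samples are functions on \<^typ>\<open>nat\<close>, of which a statistic with sample sizes \<open>m\<close>, \<open>n\<close> reads
  only the values at indices below \<open>m\<close> and \<open>n\<close> respectively.\<close>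

definition U_CvM :: "nat \<Rightarrow> nat \<Rightarrow> (nat \<Rightarrow> 'a::euclidean_space) \<Rightarrow> (nat \<Rightarrow> 'a) \<Rightarrow> real" where
  "U_CvM m n x y =
     1 / (real m * (real m - 1) * real n * (real n - 1)) *
     (\<Sum>i1<m. \<Sum>i2\<in>{..<m} - {i1}. \<Sum>j1<n. \<Sum>j2\<in>{..<n} - {j1}. h_CvM (x i1) (x i2) (y j1) (y j2))"

definition U_Energy :: "nat \<Rightarrow> nat \<Rightarrow> (nat \<Rightarrow> 'a::euclidean_space) \<Rightarrow> (nat \<Rightarrow> 'a) \<Rightarrow> real" where
  "U_Energy m n x y =
     2 / (real m * real n) * (\<Sum>i<m. \<Sum>j<n. norm (x i - y j))
     - 1 / (real m * (real m - 1)) * (\<Sum>i1<m. \<Sum>i2\<in>{..<m} - {i1}. norm (x i1 - x i2))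
     - 1 / (real n * (real n - 1)) * (\<Sum>j1<n. \<Sum>j2\<in>{..<n} - {j1}. norm (y j1 - y j2))"

text \<open>In a pooled sample \<open>z\<close>, the entries \<open>z 0, \<dots>, z (m - 1)\<close> form the first sample and
  \<open>z m, \<dots>, z (m + n - 1)\<close> the second.\<close>

definition pooled ::
  "(nat \<Rightarrow> nat \<Rightarrow> (nat \<Rightarrow> 'a) \<Rightarrow> (nat \<Rightarrow> 'a) \<Rightarrow> real) \<Rightarrow> nat \<Rightarrow> nat \<Rightarrow> (nat \<Rightarrow> 'a) \<Rightarrow> real" where
  "pooled T m n z = T m n z (\<lambda>j. z (m + j))"

definition perm_critical_value ::
  "(nat \<Rightarrow> nat \<Rightarrow> (nat \<Rightarrow> 'a) \<Rightarrow> (nat \<Rightarrow> 'a) \<Rightarrow> real) \<Rightarrow> real \<Rightarrow> nat \<Rightarrow> nat \<Rightarrow> (nat \<Rightarrow> 'a) \<Rightarrow> real" where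
  "perm_critical_value T \<alpha> m n z =
     Inf {t. 1 - \<alpha> \<le> 1 / fact (m + n) *
              (\<Sum>\<pi> | \<pi> permutes {..<m + n}. of_bool (pooled T m n (z \<circ> \<pi>) \<le> t))}"

definition perm_test ::
  "(nat \<Rightarrow> nat \<Rightarrow> (nat \<Rightarrow> 'a) \<Rightarrow> (nat \<Rightarrow> 'a) \<Rightarrow> real) \<Rightarrow> real \<Rightarrow> nat \<Rightarrow> nat \<Rightarrow> (nat \<Rightarrow> 'a) \<Rightarrow> real" where
  "perm_test T \<alpha> m n z = of_bool (pooled T m n z > perm_critical_value T \<alpha> m n z)"

definition distribution_on :: "'a::euclidean_space measure \<Rightarrow> bool" where
  "distribution_on P \<longleftrightarrow> prob_space P \<and> sets P = sets borel"

text \<open>The uniform distribution on the unit sphere, as the law of the direction of a uniformly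
  distributed point of the unit ball; \<^term>\<open>sgn x\<close> is \<open>x\<close> divided by its norm.  In dimension one
  it gives mass one half to each of the two unit vectors.\<close>

definition uniform_sphere :: "'a::euclidean_space measure" where
  "uniform_sphere = distr (uniform_measure lborel (ball 0 1)) borel sgn"

definition continuous_projections :: "'a::euclidean_space measure \<Rightarrow> bool" where
  "continuous_projections P \<longleftrightarrow>
     (AE \<beta> in uniform_sphere. continuous_on UNIV (cdf (distr P borel (\<lambda>x. \<beta> \<bullet> x))))"

definition contaminate ::
  "real \<Rightarrow> 'a::euclidean_space measure \<Rightarrow> 'a measure \<Rightarrow> 'a measure" where
  "contaminate \<epsilon> Q G =
     measure_of UNIV (sets borel) (\<lambda>A. ennreal (1 - \<epsilon>) * emeasure Q A + ennreal \<epsilon> * emeasure G A)"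

lemma sets_contaminate [simp]: "sets (contaminate \<epsilon> Q G) = sets borel"
  unfolding contaminate_def using sets.sigma_sets_eq[of borel] by simp

lemma space_contaminate [simp]: "space (contaminate \<epsilon> Q G) = UNIV"
  unfolding contaminate_def by (rule space_measure_of) auto

lemma emeasure_contaminate:
  assumes "sets Q = sets borel" "sets G = sets borel" "A \<in> sets borel"
  shows "emeasure (contaminate \<epsilon> Q G) A
    = ennreal (1 - \<epsilon>) * emeasure Q A + ennreal \<epsilon> * emeasure G A"
proof (rule emeasure_measure_of[OF contaminate_def])
  show "countably_additive (sets (contaminate \<epsilon> Q G))
     (\<lambda>A. ennreal (1 - \<epsilon>) * emeasure Q A + ennreal \<epsilon> * emeasure G A)"
    using assms
    by (auto simp: countably_additive_def suminf_add[symmetric] suminf_emeasure)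
qed (use assms in \<open>auto simp: positive_def\<close>)

lemma distribution_on_contaminate:
  assumes "distribution_on Q" "distribution_on G" "0 \<le> \<epsilon>" "\<epsilon> \<le> 1"
  shows "distribution_on (contaminate \<epsilon> Q G)"
proof -
  interpret Q: prob_space Q using assms by (simp add: distribution_on_def)
  interpret G: prob_space G using assms by (simp add: distribution_on_def)
  have "space Q = UNIV" "space G = UNIV"
    using assms by (auto simp: distribution_on_def dest: sets_eq_imp_space_eq)
  then have "emeasure (contaminate \<epsilon> Q G) UNIV = 1"
    using assms Q.emeasure_space_1 G.emeasure_space_1
    by (simp add: emeasure_contaminate distribution_on_def ennreal_plus[symmetric] del: ennreal_plus)
  then show ?thesis by (auto simp: distribution_on_def intro!: prob_spaceI)
qed

text \<open>The contaminations \<open>G\<close> for which both contaminated distributions satisfy the standing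
  assumption that almost all their one-dimensional projections have a continuous distribution
  function.\<close>

definition contaminations ::
  "real \<Rightarrow> 'a::euclidean_space measure \<Rightarrow> 'a measure \<Rightarrow> 'a measure set" where
  "contaminations \<epsilon> Q\<^sub>X Q\<^sub>Y =
     {G. distribution_on G \<and> continuous_projections (contaminate \<epsilon> Q\<^sub>X G)
                           \<and> continuous_projections (contaminate \<epsilon> Q\<^sub>Y G)}"

text \<open>The law of the pooled sample of two independent samples that are i.i.d. from \<open>P\<^sub>X\<close> and
  \<open>P\<^sub>Y\<close>.\<close>

definition pooled_law ::
  "'a::euclidean_space measure \<Rightarrow> 'a measure \<Rightarrow> nat \<Rightarrow> nat \<Rightarrow> (nat \<Rightarrow> 'a) measure" where
  "pooled_law P\<^sub>X P\<^sub>Y m n = (\<Pi>\<^sub>M i\<in>{..<m + n}. if i < m then P\<^sub>X else P\<^sub>Y)"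

definition test_power ::
  "(nat \<Rightarrow> nat \<Rightarrow> (nat \<Rightarrow> 'a) \<Rightarrow> (nat \<Rightarrow> 'a) \<Rightarrow> real) \<Rightarrow> real \<Rightarrow> real \<Rightarrow>
   'a::euclidean_space measure \<Rightarrow> 'a measure \<Rightarrow> nat \<Rightarrow> nat \<Rightarrow> 'a measure \<Rightarrow> real" where
  "test_power T \<alpha> \<epsilon> Q\<^sub>X Q\<^sub>Y m n G =
     integral\<^sup>L (pooled_law (contaminate \<epsilon> Q\<^sub>X G) (contaminate \<epsilon> Q\<^sub>Y G) m n) (perm_test T \<alpha> m n)"

end

theory Submission
  imports Defs
begin

text \<open>
  Cramer--von Mises test: the angle between two vectors is \<open>pi\<close> times the probability that a
  uniformly random hyperplane separates them, so the statistic is, up to \<open>O(1/m + 1/n)\<close>, the average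
  over directions of the univariate Cramer--von Mises distance of the projected samples.  Relabelling
  the pooled sample makes this nonnegative distance \<open>O(1/N)\<close> on average, whatever the sample is, so
  the critical value vanishes uniformly by Markov's inequality.  The population distance is at least
  \<open>(1 - \<epsilon>)\<^sup>3\<close> times that of the uncontaminated distributions, which is positive since almost all
  projections determine a distribution.

  Energy test: let the contamination sit in a unit ball at a huge distance.  The statistic of every
  relabelling is then governed by the number of contaminated points in the first sample, of which it
  is a quadratic function.  The contamination pattern is exchangeable, so the test rejects with
  probability at most \<open>\<alpha>\<close> plus the largest atom of the permutation distribution, and hypergeometric
  atoms tend to zero.
\<close>


section \<open>Permutation tests\<close>

text \<open>The contamination is arbitrary and may vary with the sample sizes, so no limit theorem
  for the data applies; the estimates are second-moment and counting bounds whose constants do not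
  depend on \<open>G\<close>. The obstacle is ties: relabellings with the same leading term differ
  only in a remainder governed by the clean points, whose two distributions do differ. All these
  ties are counted in favour of rejection, and this is how an atom enters the bound. Such atoms are
  compared with those of symmetric binomial variables by random swaps of paired entries, which
  avoids asymptotics of factorials.\<close>

lemma perm_test_eq:
  assumes "0 < \<alpha>" "\<alpha> < 1"
  shows "perm_test T \<alpha> m n z =
    of_bool ((1 - \<alpha>) * fact (m + n) \<le>
      real (card {\<pi>. \<pi> permutes {..<m + n} \<and> pooled T m n (z \<circ> \<pi>) < pooled T m n z}))"
proof -
  define PP where "PP = {\<pi>. \<pi> permutes {..<m + n}}"
  define f where "f \<pi> = pooled T m n (z \<circ> \<pi>)" for \<pi>
  define t0 where "t0 = pooled T m n z"
  define A where "A = {t. 1 - \<alpha> \<le> 1 / fact (m + n) * (\<Sum>\<pi>\<in>PP. of_bool (f \<pi> \<le> t))}"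
  have fin: "finite PP" unfolding PP_def by (rule finite_permutations) simp
  have card: "card PP = fact (m + n)" unfolding PP_def by (rule card_permutations) auto
  then have ne: "PP \<noteq> {}" by (metis card.empty fact_nonzero)
  have A_iff: "t \<in> A \<longleftrightarrow> (1 - \<alpha>) * fact (m + n) \<le> real (card {\<pi>\<in>PP. f \<pi> \<le> t})" for t
  proof -
    have "(\<Sum>\<pi>\<in>PP. of_bool (f \<pi> \<le> t)) = real (card {\<pi>\<in>PP. f \<pi> \<le> t})"
      using fin by (simp add: Int_def)
    then show ?thesis by (simp add: A_def field_simps)
  qed
  \<comment> \<open>The infimum is a genuine one only for a nonempty set that is bounded below:
    \<open>0 < \<alpha>\<close> puts the largest permuted value into \<open>A\<close>, and
    \<open>\<alpha> < 1\<close> keeps everything below the smallest one out.\<close>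
  have "Max (f ` PP) \<in> A"
  proof -
    have "{\<pi>\<in>PP. f \<pi> \<le> Max (f ` PP)} = PP" using fin by auto
    then show ?thesis using assms card by (simp add: A_iff)
  qed
  then have A_ne: "A \<noteq> {}" by auto
  have bdd: "bdd_below A"
  proof (rule bdd_belowI)
    fix t assume "t \<in> A"
    then have "0 < real (card {\<pi>\<in>PP. f \<pi> \<le> t})"
      unfolding A_iff using assms by (smt (verit) fact_gt_zero mult_pos_pos)
    then obtain \<pi> where "\<pi> \<in> PP" "f \<pi> \<le> t" by (auto simp: card_gt_0_iff)
    then show "Min (f ` PP) \<le> t" using fin by (meson Min_le finite_imageI imageI order_trans)
  qed
  \<comment> \<open>The permutation distribution function is a step function, so the critical value
    lies below \<open>t0\<close> exactly if the values strictly below \<open>t0\<close> already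
    carry mass \<open>1 - \<alpha>\<close>; the largest of them is the witness. Relabellings tied
    with the observed value do not help to reject.\<close>
  have "Inf A < t0 \<longleftrightarrow> (1 - \<alpha>) * fact (m + n) \<le> real (card {\<pi>\<in>PP. f \<pi> < t0})"
  proof
    assume "Inf A < t0"
    then obtain t where t: "t \<in> A" "t < t0" using A_ne cInf_lessD by blast
    have "card {\<pi>\<in>PP. f \<pi> \<le> t} \<le> card {\<pi>\<in>PP. f \<pi> < t0}"
      by (rule card_mono) (use t fin in auto)
    then show "(1 - \<alpha>) * fact (m + n) \<le> real (card {\<pi>\<in>PP. f \<pi> < t0})"
      using t(1) unfolding A_iff by linarith
  next
    assume *: "(1 - \<alpha>) * fact (m + n) \<le> real (card {\<pi>\<in>PP. f \<pi> < t0})"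
    let ?B = "{\<pi>\<in>PP. f \<pi> < t0}"
    have "0 < real (card ?B)" using * assms by (smt (verit) fact_gt_zero mult_pos_pos)
    then have B: "?B \<noteq> {}" "finite ?B" by (auto simp: card_gt_0_iff)
    let ?t = "Max (f ` ?B)"
    have "{\<pi>\<in>PP. f \<pi> \<le> ?t} = ?B"
    proof -
      have "?t \<in> f ` ?B" using B by (intro Max_in) auto
      then have "?t < t0" by auto
      then show ?thesis using B(2) by (auto intro!: Max_ge)
    qed
    then have "?t \<in> A" using * by (simp add: A_iff)
    then have "Inf A \<le> ?t" using bdd by (rule cInf_lower)
    also have "?t \<in> f ` ?B" using B by (intro Max_in) auto
    then have "?t < t0" by auto
    finally show "Inf A < t0" .
  qed
  then show ?thesis
    by (simp add: perm_test_def perm_critical_value_def A_def PP_def f_def t0_def)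
qed

text \<open>Right composition with a permutation that sends \<open>p'\<close> to \<open>p\<close>
  and \<open>q'\<close> to \<open>q\<close> only reindexes a sum over all permutations.\<close>

lemma sum_permutes_pair_eq:
  assumes "p \<in> S" "q \<in> S" "p \<noteq> q" "p' \<in> S" "q' \<in> S" "p' \<noteq> q'"
  shows "(\<Sum>\<pi> | \<pi> permutes S. f (\<pi> p) (\<pi> q)) = (\<Sum>\<pi> | \<pi> permutes S. f (\<pi> p') (\<pi> q'))"
proof -
  \<comment> \<open>After the first transposition \<open>q'\<close> sits at \<open>r\<close>, which
    is not \<open>p\<close> because \<open>q'\<close> is not \<open>p'\<close>; hence moving
    \<open>r\<close> to \<open>q\<close> afterwards leaves \<open>p\<close> in place.\<close>
  define r where "r = Transposition.transpose p p' q'"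
  define \<sigma> where "\<sigma> = Transposition.transpose r q \<circ> Transposition.transpose p p'"
  have r: "r \<in> S" "r \<noteq> p" using assms by (auto simp: r_def Transposition.transpose_def)
  have \<sigma>: "\<sigma> permutes S"
    unfolding \<sigma>_def using assms r by (intro permutes_compose permutes_swap_id) auto
  have "\<sigma> p' = p" "\<sigma> q' = q"
    using r assms by (auto simp: \<sigma>_def r_def Transposition.transpose_def)
  then show ?thesis
    using sum_permutations_compose_right[OF \<sigma>, of "\<lambda>\<pi>. f (\<pi> p') (\<pi> q')"] by simp
qed

lemma sum_permutes_single_eq:
  assumes "p \<in> S" "q \<in> S"
  shows "(\<Sum>\<pi> | \<pi> permutes S. f (\<pi> p)) = (\<Sum>\<pi> | \<pi> permutes S. f (\<pi> q))"
  using sum_permutations_compose_right[OF permutes_swap_id[OF assms], of "\<lambda>\<pi>. f (\<pi> q)"] by simp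

text \<open>This is the variance of a linear statistic under sampling without replacement. Up to
  normalisation, the mixed moment of two entries has one value \<open>k1\<close> on the diagonal and
  one value \<open>k2\<close> off it. As the weights sum to zero, the full double sum with the
  constant \<open>k2\<close> drops out, and only \<open>k1 - k2\<close> times the sum of squared
  weights survives.\<close>

lemma permutation_second_moment_le:
  fixes a w :: "'a \<Rightarrow> real"
  assumes S: "finite S" and a: "\<And>k. k \<in> S \<Longrightarrow> 0 \<le> a k \<and> a k \<le> 1" and w: "sum w S = 0"
  shows "(\<Sum>\<pi> | \<pi> permutes S. (\<Sum>p\<in>S. w p * a (\<pi> p))\<^sup>2) \<le> fact (card S) * (\<Sum>p\<in>S. (w p)\<^sup>2)"
proof -
  define PP where "PP = {\<pi>. \<pi> permutes S}"
  define K where "K p q = (\<Sum>\<pi>\<in>PP. a (\<pi> p) * a (\<pi> q))" for p q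
  have card: "card PP = fact (card S)" unfolding PP_def using S by (intro card_permutations) auto
  have bnd: "0 \<le> K p q \<and> K p q \<le> fact (card S)" if "p \<in> S" "q \<in> S" for p q
  proof -
    have *: "0 \<le> a (\<pi> p) * a (\<pi> q) \<and> a (\<pi> p) * a (\<pi> q) \<le> 1" if "\<pi> \<in> PP" for \<pi>
      using a[of "\<pi> p"] a[of "\<pi> q"] permutes_in_image[of \<pi> S] that \<open>p \<in> S\<close> \<open>q \<in> S\<close>
      by (auto simp: PP_def mult_le_one)
    then show ?thesis
      unfolding K_def using sum_bounded_above[of PP "\<lambda>\<pi>. a (\<pi> p) * a (\<pi> q)" 1] card
      by (auto intro!: sum_nonneg)
  qed
  show ?thesis
  \<comment> \<open>An off-diagonal moment exists only if there are two positions; with at most one,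
    the zero sum forces the weight to vanish.\<close>
  proof (cases "\<exists>p0\<in>S. \<exists>q0\<in>S. p0 \<noteq> q0")
    case True
    then obtain p0 q0 where pq: "p0 \<in> S" "q0 \<in> S" "p0 \<noteq> q0" by auto
    define k1 where "k1 = K p0 p0"
    define k2 where "k2 = K p0 q0"
    have k2: "K p q = k2" if "p \<in> S" "q \<in> S" "p \<noteq> q" for p q
      unfolding K_def k2_def PP_def using pq that by (intro sum_permutes_pair_eq) auto
    have k1: "K p p = k1" if "p \<in> S" for p
      unfolding K_def k1_def PP_def using pq that by (intro sum_permutes_single_eq) auto
    have k12: "k1 - k2 \<le> fact (card S)"
      using bnd[of p0 p0] bnd[of p0 q0] pq by (simp add: k1_def k2_def)
  have "(\<Sum>\<pi>\<in>PP. (\<Sum>p\<in>S. w p * a (\<pi> p))\<^sup>2)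
      = (\<Sum>\<pi>\<in>PP. \<Sum>p\<in>S. \<Sum>q\<in>S. w p * w q * (a (\<pi> p) * a (\<pi> q)))"
    by (simp add: power2_eq_square sum_product mult_ac)
  also have "\<dots> = (\<Sum>p\<in>S. \<Sum>\<pi>\<in>PP. \<Sum>q\<in>S. w p * w q * (a (\<pi> p) * a (\<pi> q)))"
    by (rule sum.swap)
  also have "\<dots> = (\<Sum>p\<in>S. \<Sum>q\<in>S. \<Sum>\<pi>\<in>PP. w p * w q * (a (\<pi> p) * a (\<pi> q)))"
    by (intro sum.cong refl) (rule sum.swap)
  also have "\<dots> = (\<Sum>p\<in>S. \<Sum>q\<in>S. w p * w q * K p q)"
    by (simp add: K_def sum_distrib_left)
  also have "\<dots> = (\<Sum>p\<in>S. \<Sum>q\<in>S. w p * w q * k2 + (if p = q then w p * w q * (k1 - k2) else 0))"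
    by (intro sum.cong refl) (auto simp: k1 k2 algebra_simps)
  also have "\<dots> = (\<Sum>p\<in>S. w p) * (\<Sum>q\<in>S. w q) * k2 + (\<Sum>p\<in>S. (w p)\<^sup>2) * (k1 - k2)"
  proof -
    have "(\<Sum>p\<in>S. \<Sum>q\<in>S. w p * w q * k2) = (\<Sum>p\<in>S. w p) * (\<Sum>q\<in>S. w q) * k2"
      unfolding sum_product by (simp add: sum_distrib_right)
    moreover have "(\<Sum>p\<in>S. w p * w p * (k1 - k2)) = (\<Sum>p\<in>S. (w p)\<^sup>2) * (k1 - k2)"
      by (simp only: power2_eq_square sum_distrib_right)
    ultimately show ?thesis using S by (simp add: sum.distrib)
  qed
  also have "\<dots> = (\<Sum>p\<in>S. (w p)\<^sup>2) * (k1 - k2)" using w by simp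
  also have "\<dots> \<le> (\<Sum>p\<in>S. (w p)\<^sup>2) * fact (card S)"
    using k12 by (intro mult_left_mono sum_nonneg) auto
  finally show ?thesis by (simp add: PP_def mult.commute)
  next
    case False
    have "w p = 0" if "p \<in> S" for p
    proof -
      have "S = {p}" using False that by auto
      then show ?thesis using w by simp
    qed
    then show ?thesis by simp
  qed
qed

section \<open>Directions uniformly distributed on the sphere\<close>

text \<open>Averaging the translates of a symmetric set over both measures shows that a
  translation-invariant measure is determined by its value on the unit ball.\<close>

lemma translation_invariant_eq_lborel:
  fixes \<mu> :: "'a::euclidean_space measure"
  assumes sets: "sets \<mu> = sets borel" and "sigma_finite_measure \<mu>"
    and inv: "\<And>a. distr \<mu> borel (\<lambda>x. a + x) = \<mu>"
    and ball: "emeasure \<mu> (ball 0 1) = emeasure lborel (ball (0::'a) 1)"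
  shows "\<mu> = lborel"
proof (rule measure_eqI)
  interpret M: sigma_finite_measure \<mu> by fact
  interpret P: pair_sigma_finite \<mu> lborel ..
  note [measurable_cong] = sets
  have sp: "space \<mu> = UNIV" using sets_eq_imp_space_eq[OF sets] by simp
  define B where "B = ball (0::'a) 1"
  have [measurable]: "B \<in> sets borel" by (simp add: B_def)
  fix A assume "A \<in> sets \<mu>"
  then have [measurable]: "A \<in> sets borel" using sets by simp
  have inv_mu: "(\<integral>\<^sup>+y. f y \<partial>\<mu>) = (\<integral>\<^sup>+y. f (a + y) \<partial>\<mu>)" if [measurable]: "f \<in> borel_measurable borel" for f a
    by (subst inv[of a, symmetric], subst nn_integral_distr) auto
  have inv_lb: "(\<integral>\<^sup>+y. f y \<partial>lborel) = (\<integral>\<^sup>+y. f (a + y) \<partial>lborel)"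
    if [measurable]: "f \<in> borel_measurable borel" for f and a :: 'a
    using nn_integral_distr[of "(+) a" lborel borel f] by (simp add: lborel_distr_plus)
  have mem: "x - y \<in> B \<longleftrightarrow> - x + y \<in> B" for x y :: 'a
    by (simp add: B_def dist_norm norm_minus_commute)
  \<comment> \<open>The mass of the product of \<open>B\<close> and \<open>A\<close> is transformed
    by two shears, one for the invariance of each measure; the symmetry of the ball recorded in
    \<open>mem\<close> then exchanges the roles of the two measures.\<close>
  have "emeasure lborel B * emeasure \<mu> A
      = (\<integral>\<^sup>+x. (\<integral>\<^sup>+y. indicator B x * indicator A y \<partial>\<mu>) \<partial>lborel)"
    using \<open>A \<in> sets \<mu>\<close> by (subst nn_integral_cmult) (simp_all add: nn_integral_multc)
  also have "\<dots> = (\<integral>\<^sup>+x. (\<integral>\<^sup>+y. indicator B x * indicator A (x + y) \<partial>\<mu>) \<partial>lborel)"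
    by (intro nn_integral_cong inv_mu) simp
  also have "\<dots> = (\<integral>\<^sup>+y. (\<integral>\<^sup>+x. indicator B x * indicator A (x + y) \<partial>lborel) \<partial>\<mu>)"
    by (subst P.Fubini') (simp_all add: split_beta')
  also have "\<dots> = (\<integral>\<^sup>+y. (\<integral>\<^sup>+x. indicator B (x - y) * indicator A x \<partial>lborel) \<partial>\<mu>)"
  proof (rule nn_integral_cong)
    fix y
    show "(\<integral>\<^sup>+x. indicator B x * indicator A (x + y) \<partial>lborel) =
        (\<integral>\<^sup>+x. indicator B (x - y) * indicator A x \<partial>lborel :: ennreal)"
      by (subst inv_lb[of _ "- y"]) (simp_all add: algebra_simps)
  qed
  also have "\<dots> = (\<integral>\<^sup>+x. (\<integral>\<^sup>+y. indicator B (x - y) * indicator A x \<partial>\<mu>) \<partial>lborel)"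
    by (subst P.Fubini') (simp_all add: split_beta')
  also have "\<dots> = (\<integral>\<^sup>+x. (\<integral>\<^sup>+y. indicator B y * indicator A x \<partial>\<mu>) \<partial>lborel)"
  proof (rule nn_integral_cong)
    fix x :: 'a
    have "(\<integral>\<^sup>+y. indicator B (x - y) * indicator A x \<partial>\<mu> :: ennreal) =
        (\<integral>\<^sup>+y. (\<lambda>y. indicator B y * indicator A x) (- x + y) \<partial>\<mu>)"
      by (intro nn_integral_cong) (simp only: indicator_def mem)
    also have "\<dots> = (\<integral>\<^sup>+y. indicator B y * indicator A x \<partial>\<mu>)"
      by (rule inv_mu[symmetric]) simp
    finally show "(\<integral>\<^sup>+y. indicator B (x - y) * indicator A x \<partial>\<mu> :: ennreal) =
        (\<integral>\<^sup>+y. indicator B y * indicator A x \<partial>\<mu>)" .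
  qed
  also have "\<dots> = emeasure lborel B * emeasure lborel A"
    using ball by (subst nn_integral_multc) (simp_all add: nn_integral_cmult B_def[symmetric] sets sp)
  finally have eq: "emeasure lborel B * emeasure \<mu> A = emeasure lborel B * emeasure lborel A" .
  have "emeasure lborel B = ennreal (measure lborel B)"
    unfolding B_def using emeasure_lborel_ball_finite[of "0::'a" 1] by (simp add: emeasure_eq_ennreal_measure)
  moreover have "measure lborel B > 0" unfolding B_def by (rule content_ball_pos) simp
  ultimately have "emeasure lborel B \<noteq> 0" "emeasure lborel B \<noteq> \<infinity>" by simp_all
  then show "emeasure \<mu> A = emeasure lborel A"
    using eq by (simp add: ennreal_mult_cancel_left)
qed (use sets in simp)

text \<open>A linear isometry is surjective, so translating the image measure by \<open>f b\<close>
  amounts to translating Lebesgue measure by \<open>b\<close>. Since the unit ball is preserved,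
  uniqueness of translation-invariant measures applies, without any determinant.\<close>

lemma distr_lborel_isometry:
  fixes f :: "'a::euclidean_space \<Rightarrow> 'a"
  assumes "linear f" "\<And>x. norm (f x) = norm x"
  shows "distr lborel borel f = lborel"
proof (rule translation_invariant_eq_lborel)
  have [measurable]: "f \<in> borel_measurable borel"
    using assms(1) by (intro borel_measurable_continuous_onI linear_continuous_on linear_conv_bounded_linear[THEN iffD1])
  have "inj f" using assms by (metis linear_injective_0 norm_eq_zero)
  then have surj: "surj f" using assms(1) linear_injective_imp_surjective by blast
  have vim: "f -` ball 0 r = ball 0 r" for r using assms(2) by auto
  show "sets (distr lborel borel f) = sets borel" by simp
  show "emeasure (distr lborel borel f) (ball 0 1) = emeasure lborel (ball (0::'a) 1)"
    by (simp add: emeasure_distr vim)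
  show "distr (distr lborel borel f) borel ((+) a) = distr lborel borel f" for a
  proof -
    obtain b where b: "a = f b" using surj by auto
    have "distr (distr lborel borel f) borel ((+) a) = distr lborel borel (f \<circ> (+) b)"
      by (simp add: distr_distr o_def b linear_add[OF assms(1)])
    also have "\<dots> = distr (distr lborel borel ((+) b)) borel f"
      by (simp add: distr_distr)
    finally show ?thesis by (simp add: lborel_distr_plus)
  qed
  show "sigma_finite_measure (distr lborel borel f)"
  proof
    have "emeasure (distr lborel borel f) (ball 0 (real n)) \<noteq> \<infinity>" for n
      using emeasure_lborel_ball_finite[of "0::'a" "real n"] by (simp add: emeasure_distr vim)
    moreover have "(\<Union>n. ball 0 (real n)) = (UNIV::'a set)"
      by (auto simp: reals_Archimedean2)
    ultimately show "\<exists>A. countable A \<and> A \<subseteq> sets (distr lborel borel f) \<and>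
        \<Union> A = space (distr lborel borel f) \<and> (\<forall>a\<in>A. emeasure (distr lborel borel f) a \<noteq> \<infinity>)"
      by (intro exI[of _ "range (\<lambda>n. ball 0 (real n))"]) auto
  qed
qed

lemma
  shows prob_space_uniform_sphere: "prob_space (uniform_sphere :: 'a::euclidean_space measure)"
    and sets_uniform_sphere [simp, measurable_cong]: "sets (uniform_sphere :: 'a measure) = sets borel"
    and space_uniform_sphere [simp]: "space (uniform_sphere :: 'a measure) = UNIV"
proof -
  have "emeasure lborel (ball (0::'a) 1) = ennreal (measure lborel (ball (0::'a) 1))"
    using emeasure_lborel_ball_finite[of "0::'a" 1] by (simp add: emeasure_eq_ennreal_measure)
  moreover have "measure lborel (ball (0::'a) 1) > 0" by (rule content_ball_pos) simp
  ultimately have "prob_space (uniform_measure lborel (ball (0::'a) 1))"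
    by (intro prob_space_uniform_measure) simp_all
  then show "prob_space (uniform_sphere :: 'a::euclidean_space measure)"
    unfolding uniform_sphere_def by (rule prob_space.prob_space_distr) simp
qed (simp_all add: uniform_sphere_def)

lemma distr_uniform_sphere_isometry:
  fixes f :: "'a::euclidean_space \<Rightarrow> 'a"
  assumes f: "linear f" "\<And>x. norm (f x) = norm x"
  shows "distr uniform_sphere borel f = uniform_sphere"
proof -
  have [measurable]: "f \<in> borel_measurable borel"
    using f(1) by (intro borel_measurable_continuous_onI linear_continuous_on linear_conv_bounded_linear[THEN iffD1])
  let ?U = "uniform_measure lborel (ball (0::'a) 1)"
  have *: "f \<in> measurable borel borel" "f \<in> measurable ?U borel" "sgn \<in> measurable ?U borel"
    "sgn \<in> measurable borel (borel :: 'a measure)" by measurable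
  have "distr ?U borel f = ?U"
  proof (rule measure_eqI)
    fix A assume "A \<in> sets (distr ?U borel f)"
    then have A [measurable]: "A \<in> sets borel" by simp
    have B: "f -` ball 0 1 = ball 0 1" using f(2) by auto
    have "emeasure lborel (ball 0 1 \<inter> A) = emeasure (distr lborel borel f) (ball 0 1 \<inter> A)"
      by (simp add: distr_lborel_isometry[OF f])
    also have "\<dots> = emeasure lborel (ball 0 1 \<inter> f -` A)"
      by (subst emeasure_distr) (simp_all add: B)
    finally show "emeasure (distr ?U borel f) A = emeasure ?U A"
      using measurable_sets_borel[of f borel A] by (simp add: emeasure_distr)
  qed simp
  moreover have "f (sgn x) = sgn (f x)" for x
    using f by (simp add: sgn_div_norm linear_scale)
  then have "f \<circ> sgn = sgn \<circ> f" by auto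
  ultimately show ?thesis
    unfolding uniform_sphere_def
    by (metis (no_types, lifting) distr_distr[of f borel borel sgn ?U] distr_distr[of sgn borel borel f ?U] *)
qed

lemma measure_uniform_sphere_isometry:
  fixes f :: "'a::euclidean_space \<Rightarrow> 'a"
  assumes f: "linear f" "\<And>x. norm (f x) = norm x" and [measurable]: "Measurable.pred borel P"
  shows "measure uniform_sphere {b. P (f b)} = measure uniform_sphere {b. P b}"
proof -
  have [measurable]: "f \<in> borel_measurable borel"
    using f(1) by (intro borel_measurable_continuous_onI linear_continuous_on linear_conv_bounded_linear[THEN iffD1])
  have "measure uniform_sphere {b. P b} = measure (distr uniform_sphere borel f) {b. P b}"
    using distr_uniform_sphere_isometry[OF f] by simp
  also have "\<dots> = measure uniform_sphere {b. P (f b)}"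
    by (subst measure_distr) (simp_all add: vimage_def)
  finally show ?thesis by simp
qed

lemma AE_uniform_sphere_inner_nonzero:
  fixes u :: "'a::euclidean_space"
  assumes "u \<noteq> 0"
  shows "AE b in uniform_sphere. b \<bullet> u \<noteq> 0"
proof -
  have "negligible {x. u \<bullet> x = 0}" using assms by (intro negligible_hyperplane) simp
  then have "emeasure lborel {x. u \<bullet> x = 0} = 0"
    by (simp add: negligible_iff_null_sets null_sets_def)
  then have "AE x in lborel. x \<bullet> u \<noteq> 0"
    by (intro AE_I[of _ _ "{x. u \<bullet> x = 0}"]) (auto simp: inner_commute)
  then have "AE x in uniform_measure lborel (ball (0::'a) 1). sgn x \<bullet> u \<noteq> 0"
    by (intro AE_uniform_measureI) (auto simp: sgn_div_norm)
  then show ?thesis unfolding uniform_sphere_def by (subst AE_distr_iff) simp_all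
qed

section \<open>The angle between two vectors as a separation probability\<close>

definition sep :: "'a::euclidean_space \<Rightarrow> 'a \<Rightarrow> real" where
  "sep u v = measure uniform_sphere {b. (0 < b \<bullet> u) \<noteq> (0 < b \<bullet> v)}"

lemma sep_nonneg: "0 \<le> sep u v"
  by (simp add: sep_def)

lemma sep_isometry:
  fixes f :: "'a::euclidean_space \<Rightarrow> 'a"
  assumes f: "linear f" "\<And>x. norm (f x) = norm x"
  shows "sep (f u) (f v) = sep u v"
proof -
  have "f x \<bullet> f y = x \<bullet> y" for x y
    using f by (metis norm_eq orthogonal_transformation orthogonal_transformation_def)
  then have "sep u v = measure uniform_sphere {b. (0 < f b \<bullet> f u) \<noteq> (0 < f b \<bullet> f v)}"
    unfolding sep_def by simp
  also have "\<dots> = sep (f u) (f v)"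
    unfolding sep_def by (rule measure_uniform_sphere_isometry[OF f, of "\<lambda>b. (0 < b \<bullet> f u) \<noteq> (0 < b \<bullet> f v)"]) simp
  finally show ?thesis by simp
qed

text \<open>If \<open>b\<close> lies on the arc from \<open>a\<close> to \<open>c\<close>, a random
  hyperplane separating \<open>a\<close> from \<open>c\<close> almost surely separates
  \<open>b\<close> from exactly one of them. Antipodal \<open>a\<close> and \<open>c\<close> form a
  separate case: every \<open>b\<close> lies on a half circle between them, but it need not be a
  nonnegative combination of the two.\<close>

lemma sep_additive:
  fixes a b c :: "'a::euclidean_space"
  assumes nz: "a \<noteq> 0" "b \<noteq> 0" "c \<noteq> 0"
    and between: "(\<exists>k>0. c = - k *\<^sub>R a) \<or> (\<exists>k l. 0 \<le> k \<and> 0 \<le> l \<and> b = k *\<^sub>R a + l *\<^sub>R c)"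
  shows "sep a c = sep a b + sep b c"
proof -
  interpret S: prob_space "uniform_sphere :: 'a measure" by (rule prob_space_uniform_sphere)
  let ?m = "measure (uniform_sphere :: 'a measure)"
  let ?X = "{x::'a. (0 < x \<bullet> a) \<noteq> (0 < x \<bullet> b)}" and ?Y = "{x::'a. (0 < x \<bullet> b) \<noteq> (0 < x \<bullet> c)}"
  have ae: "AE x in uniform_sphere. \<not> ((0 < x \<bullet> a) \<noteq> (0 < x \<bullet> b) \<and> (0 < x \<bullet> b) \<noteq> (0 < x \<bullet> c))"
    using AE_uniform_sphere_inner_nonzero[OF nz(1)] AE_uniform_sphere_inner_nonzero[OF nz(2)]
      AE_uniform_sphere_inner_nonzero[OF nz(3)]
  proof eventually_elim
    case (elim x)
    from between show ?case
    proof
      assume "\<exists>k>0. c = - k *\<^sub>R a"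
      then obtain k where k: "k > 0" "c = - k *\<^sub>R a" by blast
      then have "0 < x \<bullet> c \<longleftrightarrow> x \<bullet> a < 0"
        by (simp add: mult_less_0_iff)
      then show ?thesis using elim by linarith
    next
      assume "\<exists>k l. 0 \<le> k \<and> 0 \<le> l \<and> b = k *\<^sub>R a + l *\<^sub>R c"
      then obtain k l where kl: "0 \<le> k" "0 \<le> l" "b = k *\<^sub>R a + l *\<^sub>R c" by blast
      then have b: "x \<bullet> b = k * (x \<bullet> a) + l * (x \<bullet> c)" by (simp add: inner_add_right)
      have "0 \<le> x \<bullet> b" if "0 < x \<bullet> a" "0 < x \<bullet> c" using kl that unfolding b by simp
      moreover have "x \<bullet> b \<le> 0" if "x \<bullet> a \<le> 0" "x \<bullet> c \<le> 0"
        using kl that unfolding b by (simp add: add_nonpos_nonpos mult_nonneg_nonpos)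
      ultimately show ?thesis using elim by linarith
    qed
  qed
  have "sep a c = ?m (?X \<union> ?Y)"
    unfolding sep_def by (rule S.finite_measure_eq_AE) (use ae in \<open>auto elim!: eventually_mono\<close>)
  also have "\<dots> = ?m ?X + ?m ?Y"
    by (rule measure_Un_AE) (use ae in \<open>auto simp: S.fmeasurable_eq_sets elim!: eventually_mono\<close>)
  finally show ?thesis by (simp add: sep_def)
qed

lemma sep_scaleR: "k > 0 \<Longrightarrow> sep (k *\<^sub>R u) v = sep u v" "k > 0 \<Longrightarrow> sep u (k *\<^sub>R v) = sep u v"
  by (simp_all add: sep_def zero_less_mult_iff)

text \<open>Cauchy's functional equation on an interval: nonnegativity makes an additive function
  monotone, and monotonicity replaces continuity when \<open>t\<close> is squeezed between
  neighbouring multiples of \<open>c / n\<close>.\<close>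

lemma additive_on_interval_linear:
  fixes f :: "real \<Rightarrow> real"
  assumes "c > 0"
    and add: "\<And>s t. 0 \<le> s \<Longrightarrow> 0 \<le> t \<Longrightarrow> s + t \<le> c \<Longrightarrow> f (s + t) = f s + f t"
    and nonneg: "\<And>t. 0 \<le> t \<Longrightarrow> t \<le> c \<Longrightarrow> 0 \<le> f t"
    and t: "0 \<le> t" "t \<le> c"
  shows "f t = t / c * f c"
proof -
  have mono: "f s \<le> f t" if "0 \<le> s" "s \<le> t" "t \<le> c" for s t
    using add[of s "t - s"] nonneg[of "t - s"] that by simp
  have f0: "f 0 = 0" using add[of 0 0] \<open>c > 0\<close> by simp
  have mult: "f (real j * s) = real j * f s" if "0 \<le> s" "real j * s \<le> c" for j s
    using that
  proof (induction j)
    case (Suc j)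
    have "real j * s \<le> c" using Suc.prems by (simp add: algebra_simps)
    then show ?case
      using Suc add[of s "real j * s"] by (simp add: algebra_simps)
  qed (simp add: f0)
  have approx: "\<bar>f t - t / c * f c\<bar> \<le> f c / real n" if "n > 0" for n :: nat
  proof -
    define h where "h = c / real n"
    have h: "h > 0" "real n * h = c" using \<open>c > 0\<close> \<open>n > 0\<close> by (auto simp: h_def)
    have fh: "f h = f c / real n" using mult[of h n] h \<open>n > 0\<close> by (simp add: field_simps)
    \<comment> \<open>\<open>j\<close> counts the whole grid cells below \<open>t\<close>; both
      \<open>f t\<close> and the linear value then lie between \<open>j\<close> and
      \<open>j + 1\<close> times \<open>f h\<close>, an interval of length
      \<open>f c / n\<close>.\<close>
    define j where "j = nat \<lfloor>t / h\<rfloor>"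
    have "0 \<le> t / h" using t h by simp
    then have j: "real j \<le> t / h" "t / h < real j + 1" unfolding j_def by linarith+
    have j1: "real j * h \<le> t" using j(1) h(1) by (simp add: field_simps)
    have j2: "t < (real j + 1) * h" using j(2) h(1) by (simp add: field_simps)
    have lo: "real j * f h \<le> f t" using mult[of h j] mono[of "real j * h" t] j1 t h by auto
    have fc: "0 \<le> f c" using nonneg \<open>c > 0\<close> by simp
    have hi: "f t \<le> (real j + 1) * f h"
    proof -
      have "f t - f (real j * h) = f (t - real j * h)" using add[of "real j * h" "t - real j * h"] j1 t h by simp
      also have "\<dots> \<le> f h" using mono[of "t - real j * h" h] j1 j2 t h
        mult_right_mono[of 1 "real n" h] \<open>n > 0\<close> by (simp add: algebra_simps)
      finally show ?thesis using mult[of h j] j1 t h by (simp add: algebra_simps)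
    qed
    have e: "t / c * f c = t / h * f h" using fh h(2) \<open>n > 0\<close> h(1) by (auto simp: field_simps)
    have fh0: "0 \<le> f h" using fh fc by simp
    have "real j * f h \<le> t / h * f h" "t / h * f h \<le> (real j + 1) * f h"
      using j fh0 by (intro mult_right_mono; simp)+
    then have "\<bar>f t - t / h * f h\<bar> \<le> f h" using lo hi by (simp add: distrib_right abs_le_iff)
    then show ?thesis by (simp only: e fh)
  qed
  have "\<bar>f t - t / c * f c\<bar> \<le> 0"
  proof (rule LIMSEQ_le_const)
    show "(\<lambda>n. f c / real n) \<longlonglongrightarrow> 0" by (rule lim_const_over_n)
    show "\<exists>N. \<forall>n\<ge>N. \<bar>f t - t / c * f c\<bar> \<le> f c / real n" using approx by (intro exI[of _ 1]) auto
  qed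
  then show ?thesis by simp
qed

text \<open>Along the great circle through the two directions the separation probability depends
  only on the arc length, by rotation invariance, and it is additive; hence it is linear in the arc
  length. Antipodal points, which are separated almost surely, fix the slope
  \<open>1 / pi\<close>.\<close>

lemma sep_eq_angle:
  fixes u v :: "'a::euclidean_space"
  assumes "u \<noteq> 0" "v \<noteq> 0"
  shows "sep u v = Ang u v / pi"
proof -
  interpret S: prob_space "uniform_sphere :: 'a measure" by (rule prob_space_uniform_sphere)
  define e where "e = sgn u"
  define v' where "v' = sgn v"
  define x where "x = e \<bullet> v'"
  define \<theta> where "\<theta> = arccos x"
  have n1: "norm e = 1" "norm v' = 1" using assms by (auto simp: e_def v'_def norm_sgn)
  then have e_nz: "e \<noteq> 0" by auto
  from n1 have ee: "e \<bullet> e = 1" "v' \<bullet> v' = 1" by (simp_all add: dot_square_norm)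
  have ang: "Ang u v = \<theta>"
    by (simp add: Ang_def \<theta>_def x_def e_def v'_def sgn_div_norm field_simps)
  have sep: "sep u v = sep e v'"
    using assms by (simp add: e_def v'_def sgn_div_norm sep_scaleR)
  have x: "\<bar>x\<bar> \<le> 1" using Cauchy_Schwarz_ineq2[of e v'] n1 by (simp add: x_def)
  have opp: "sep w (- w) = 1" if "w \<noteq> 0" for w :: 'a
  proof -
    have "AE b in uniform_sphere. b \<in> {b. (0 < b \<bullet> w) \<noteq> (0 < b \<bullet> - w)}"
      using AE_uniform_sphere_inner_nonzero[OF that] by (auto elim!: eventually_mono)
    then show ?thesis unfolding sep_def by (subst S.prob_eq_1) auto
  qed
  define p where "p = v' - x *\<^sub>R e"
  have ep: "e \<bullet> p = 0" by (simp add: p_def x_def inner_diff_right ee)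
  have pp: "p \<bullet> p = 1 - x\<^sup>2"
    by (simp add: p_def inner_diff_right inner_diff_left ee power2_eq_square inner_commute x_def)
  have np: "norm p = sqrt (1 - x\<^sup>2)" using pp by (simp add: norm_eq_sqrt_inner)
  show ?thesis
  \<comment> \<open>Parallel vectors span no plane to rotate in; there the angle is 0 or
    \<open>pi\<close> and both sides are computed directly.\<close>
  proof (cases "p = 0")
    case True
    then have v': "v' = x *\<^sub>R e" and "x\<^sup>2 = 1" using pp by (auto simp: p_def)
    then consider "x = 1" | "x = -1" by (auto simp: power2_eq_1_iff)
    then show ?thesis
    proof cases
      case 1
      then show ?thesis using sep ang v' by (simp add: \<theta>_def) (simp add: sep_def)
    next
      case 2
      then show ?thesis using sep ang v' opp[of e] e_nz by (simp add: \<theta>_def)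
    qed
  next
    case False
    define g where "g = sgn p"
    have gg: "g \<bullet> g = 1" "e \<bullet> g = 0" "g \<bullet> e = 0"
      using False ep by (auto simp: g_def dot_square_norm norm_sgn sgn_div_norm inner_commute)
    define c where "c t = cos t *\<^sub>R e + sin t *\<^sub>R g" for t :: real
    have cc: "c t \<bullet> c t = 1" for t
      by (simp add: c_def inner_add_left inner_add_right ee gg power2_eq_square[symmetric])
    have c_nz: "c t \<noteq> 0" for t using cc[of t] by auto
    have v'c: "v' = c \<theta>"
    proof -
      have "sin \<theta> = norm p" using x by (simp add: \<theta>_def sin_arccos_abs np)
      then have "sin \<theta> *\<^sub>R g = p" by (simp add: g_def sgn_div_norm False)
      moreover have "cos \<theta> = x" using x by (simp add: \<theta>_def cos_arccos_abs)
      ultimately show ?thesis by (simp add: c_def p_def)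
    qed
    have rot: "sep (c s) (c (s + t)) = sep (c 0) (c t)" for s t
    proof -
      \<comment> \<open>\<open>f\<close> rotates the plane of \<open>e\<close> and \<open>g\<close>
        by the angle \<open>s\<close> and fixes its orthogonal complement.\<close>
      define f where "f y = y + (y \<bullet> e) *\<^sub>R (c s - e) + (y \<bullet> g) *\<^sub>R (cos s *\<^sub>R g - sin s *\<^sub>R e - g)" for y
      have lin: "linear f"
        by (rule linearI) (simp_all add: f_def inner_add_left algebra_simps)
      have cs: "cos s * (cos s * z) = z - sin s * (sin s * z)" for z
      proof -
        have "cos s * (cos s * z) + sin s * (sin s * z) = (cos s * cos s + sin s * sin s) * z" by (simp only: algebra_simps)
        then show ?thesis using sin_cos_squared_add3[of s] by simp
      qed
      have "f y \<bullet> f y = y \<bullet> y + (y \<bullet> e)\<^sup>2 * ((cos s)\<^sup>2 + (sin s)\<^sup>2 - 1) + (y \<bullet> g)\<^sup>2 * ((cos s)\<^sup>2 + (sin s)\<^sup>2 - 1)" for y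
        by (simp add: f_def c_def inner_add_left inner_add_right inner_diff_left inner_diff_right ee gg
            inner_commute[of e y] inner_commute[of g y] power2_eq_square cs algebra_simps)
      then have nrm: "norm (f y) = norm y" for y by (simp add: norm_eq_sqrt_inner)
      have f: "f (c t) = c (s + t)" for t
        by (simp add: f_def c_def inner_add_left inner_diff_right ee gg cos_add sin_add algebra_simps)
      show ?thesis using sep_isometry[OF lin nrm, of "c 0" "c t"] by (simp add: f)
    qed
    have cpi: "c pi = - e" "c 0 = e" by (simp_all add: c_def)
    have add: "sep (c 0) (c (s + t)) = sep (c 0) (c s) + sep (c 0) (c t)"
      if st: "0 \<le> s" "0 \<le> t" "s + t \<le> pi" for s t
    proof -
      have "sep (c 0) (c (s + t)) = sep (c 0) (c s) + sep (c s) (c (s + t))"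
      proof (rule sep_additive[OF c_nz c_nz c_nz])
        show "(\<exists>k>0. c (s + t) = - k *\<^sub>R c 0) \<or> (\<exists>k l. 0 \<le> k \<and> 0 \<le> l \<and> c s = k *\<^sub>R c 0 + l *\<^sub>R c (s + t))"
        proof (cases "s + t = pi")
          case True
          then show ?thesis using cpi by (intro disjI1 exI[of _ 1]) simp
        next
          case False
          show ?thesis
          proof (cases "s + t = 0")
            case True
            then have "s = 0" using st by simp
            then show ?thesis by (intro disjI2 exI[of _ 1] exI[of _ 0]) simp
          next
            case False
            have pos: "0 < sin (s + t)" using False \<open>s + t \<noteq> pi\<close> st by (intro sin_gt_zero) auto
            \<comment> \<open>Dividing this identity by \<open>sin (s + t)\<close> writes the
              intermediate point of the arc as a combination of its end points; the coefficients are
              nonnegative because the arc is shorter than \<open>pi\<close>.\<close>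
            have "sin (s + t) *\<^sub>R c s = sin t *\<^sub>R c 0 + sin s *\<^sub>R c (s + t)"
            proof -
              have "sin (s + t) * cos s = sin t + sin s * cos (s + t)"
                using sin_diff[of "s + t" s] by (simp add: algebra_simps)
              then show ?thesis by (simp add: c_def scaleR_add_right scaleR_add_left algebra_simps flip: scaleR_add_left)
            qed
            then have "c s = (1 / sin (s + t)) *\<^sub>R (sin t *\<^sub>R c 0 + sin s *\<^sub>R c (s + t))"
              using pos by (metis divideR_right inverse_eq_divide less_irrefl)
            then have "c s = (sin t / sin (s + t)) *\<^sub>R c 0 + (sin s / sin (s + t)) *\<^sub>R c (s + t)"
              by (simp add: scaleR_add_right)
            then show ?thesis using pos st sin_ge_zero[of s] sin_ge_zero[of t]
              by (intro disjI2 exI[of _ "sin t / sin (s + t)"] exI[of _ "sin s / sin (s + t)"]) auto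
          qed
        qed
      qed
      then show ?thesis by (simp add: rot)
    qed
    have "sep (c 0) (c \<theta>) = \<theta> / pi * sep (c 0) (c pi)"
    proof (rule additive_on_interval_linear[where f = "\<lambda>t. sep (c 0) (c t)"])
      show "0 \<le> \<theta>" "\<theta> \<le> pi" using x by (auto simp: \<theta>_def abs_le_iff intro!: arccos_lbound arccos_ubound)
    qed (use add in \<open>auto simp: sep_nonneg\<close>)
    then show ?thesis using sep ang v'c cpi opp[of e] e_nz by simp
  qed
qed

text \<open>Reflection through the origin carries this wedge to the opposite one up to a null set.
  The two wedges and the separating directions exhaust the sphere, so each wedge gets half of what
  \<open>sep\<close> leaves over.\<close>

lemma measure_uniform_sphere_wedge:
  fixes u v :: "'a::euclidean_space"
  assumes nz: "u \<noteq> 0" "v \<noteq> 0"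
  shows "measure uniform_sphere {b. b \<bullet> u \<le> 0 \<and> b \<bullet> v \<le> 0} = 1 / 2 - Ang u v / (2 * pi)"
proof -
  interpret S: prob_space "uniform_sphere :: 'a measure" by (rule prob_space_uniform_sphere)
  let ?m = "measure (uniform_sphere :: 'a measure)"
  let ?L = "{b::'a. b \<bullet> u \<le> 0 \<and> b \<bullet> v \<le> 0}" and ?G = "{b::'a. 0 < b \<bullet> u \<and> 0 < b \<bullet> v}"
    and ?D = "{b::'a. (0 < b \<bullet> u) \<noteq> (0 < b \<bullet> v)}"
  have "?m ?L = ?m {b. - b \<bullet> u \<le> 0 \<and> - b \<bullet> v \<le> 0}"
    by (rule measure_uniform_sphere_isometry[symmetric, of uminus "\<lambda>b. b \<bullet> u \<le> 0 \<and> b \<bullet> v \<le> 0"])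
      (auto intro: linearI)
  also have "\<dots> = ?m ?G"
  proof (rule S.finite_measure_eq_AE)
    show "AE x in uniform_sphere. (x \<in> {b. - b \<bullet> u \<le> 0 \<and> - b \<bullet> v \<le> 0}) = (x \<in> ?G)"
      using AE_uniform_sphere_inner_nonzero[OF nz(1)] AE_uniform_sphere_inner_nonzero[OF nz(2)]
      by eventually_elim auto
  qed simp_all
  finally have "?m ?L = ?m ?G" .
  moreover have "1 = ?m ?L + (?m ?G + ?m ?D)"
  proof -
    have "?L \<union> (?G \<union> ?D) = UNIV" by (auto simp: not_less)
    then have "1 = ?m (?L \<union> (?G \<union> ?D))" using S.prob_space by simp
    also have "\<dots> = ?m ?L + ?m (?G \<union> ?D)" by (rule S.finite_measure_Union) auto
    also have "?m (?G \<union> ?D) = ?m ?G + ?m ?D" by (rule S.finite_measure_Union) auto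
    finally show ?thesis .
  qed
  moreover have "?m ?D = Ang u v / pi" using sep_eq_angle[OF nz] unfolding sep_def .
  ultimately have "?m ?L = (1 - Ang u v / pi) / 2" by simp
  then show ?thesis by (simp add: field_simps)
qed

section \<open>Distributions are determined by almost all of their projections\<close>

text \<open>If the difference \<open>D\<close> were positive at \<open>t\<close>, take the last
  point \<open>s\<close> before \<open>t\<close> at which it is at most half as large. On
  \<open>{s<..t}\<close> the two distribution functions differ everywhere, so neither measure
  charges this interval, and \<open>D\<close> cannot have changed between \<open>s\<close> and
  \<open>t\<close>.\<close>

lemma cdf_le_if_AE_eq:
  assumes M: "real_distribution M" and N: "real_distribution N"
    and cont: "continuous_on UNIV (cdf M)" "continuous_on UNIV (cdf N)"
    and ae: "AE x in M. cdf M x = cdf N x" "AE x in N. cdf M x = cdf N x"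
  shows "cdf M t \<le> cdf N t"
proof (rule ccontr)
  interpret M: real_distribution M by fact
  interpret N: real_distribution N by fact
  define D where "D x = cdf M x - cdf N x" for x
  assume "\<not> cdf M t \<le> cdf N t"
  then have t: "D t > 0" by (simp add: D_def)
  have D: "continuous_on UNIV D" unfolding D_def by (intro continuous_intros cont)
  \<comment> \<open>The level is \<open>D t / 2\<close> and not 0 because \<open>D\<close> tends to
    0 at minus infinity but need not reach 0 to the left of \<open>t\<close>.\<close>
  define A where "A = {x. x \<le> t \<and> D x \<le> D t / 2}"
  have "(D \<longlongrightarrow> 0 - 0) at_bot" unfolding D_def by (intro tendsto_diff M.cdf_lim_at_bot N.cdf_lim_at_bot)
  moreover have "0 - 0 < D t / 2" using t by simp
  ultimately have "\<forall>\<^sub>F x in at_bot. D x < D t / 2" by (rule order_tendstoD(2))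
  then obtain x0 where x0: "\<And>x. x \<le> x0 \<Longrightarrow> D x < D t / 2" unfolding eventually_at_bot_linorder by blast
  have "min x0 t \<in> A" using x0[of "min x0 t"] by (simp add: A_def)
  then have "A \<noteq> {}" by auto
  moreover have "bdd_above A" by (auto simp: A_def intro!: bdd_aboveI[of _ t])
  moreover have "closed A"
    unfolding A_def by (intro closed_Collect_conj closed_Collect_le D continuous_intros)
  ultimately have "Sup A \<in> A" by (intro closed_contains_Sup)
  define s where "s = Sup A"
  have s: "s \<le> t" "D s \<le> D t / 2" using \<open>Sup A \<in> A\<close> by (auto simp: A_def s_def)
  have st: "s < t" using s t by (metis field_sum_of_halves less_add_same_cancel1 not_le order_le_less half_gt_zero)
  have pos: "D x \<noteq> 0" if "x \<in> {s<..t}" for x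
  proof -
    have "x \<notin> A" using that cSup_upper[OF _ \<open>bdd_above A\<close>, of x] by (auto simp: s_def)
    then show ?thesis using that t by (auto simp: A_def)
  qed
  have "measure M {s<..t} = 0"
  proof -
    have "AE x in M. x \<notin> {s<..t}" using ae(1) by eventually_elim (use pos in \<open>auto simp: D_def\<close>)
    then show ?thesis by (subst M.prob_eq_0) simp_all
  qed
  moreover have "measure N {s<..t} = 0"
  proof -
    have "AE x in N. x \<notin> {s<..t}" using ae(2) by eventually_elim (use pos in \<open>auto simp: D_def\<close>)
    then show ?thesis by (subst N.prob_eq_0) simp_all
  qed
  ultimately have "D t = D s"
    using M.cdf_diff_eq[OF st] N.cdf_diff_eq[OF st] by (simp add: D_def)
  then show False using s t by simp
qed

lemma eq_if_AE_cdf_eq: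
  assumes M: "real_distribution M" and N: "real_distribution N"
    and cont: "continuous_on UNIV (cdf M)" "continuous_on UNIV (cdf N)"
    and ae: "AE x in M. cdf M x = cdf N x" "AE x in N. cdf M x = cdf N x"
  shows "M = N"
proof (rule cdf_unique[OF M N], rule ext, rule antisym)
  show "cdf M t \<le> cdf N t" for t by (rule cdf_le_if_AE_eq[OF assms])
  show "cdf N t \<le> cdf M t" for t
    by (rule cdf_le_if_AE_eq[OF N M cont(2,1)]) (use ae in \<open>auto elim!: eventually_mono\<close>)
qed

text \<open>Ramps of slope \<open>j\<close> starting at \<open>c\<close> converge pointwise to the
  indicator of the open half-line, with value 0 at \<open>c\<close> itself, and Weierstrass
  approximation replaces each ramp by a polynomial within \<open>1 / Suc j\<close>. Pointwise
  convergence under a common bound is what dominated convergence asks for.\<close>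

lemma polynomial_approximates_step:
  fixes c :: real
  shows "\<exists>q. (\<forall>j. real_polynomial_function (q j)) \<and> (\<forall>y\<in>{-1..1}. (\<lambda>j. q j y) \<longlonglongrightarrow> of_bool (c < y))
    \<and> (\<forall>j. \<forall>y\<in>{-1..1}. \<bar>q j y\<bar> \<le> 2)"
proof -
  define \<phi> where "\<phi> j y = min 1 (max 0 (real j * (y - c)))" for j y
  have "\<exists>g. real_polynomial_function g \<and> (\<forall>y\<in>{-1..1}. \<bar>\<phi> j y - g y\<bar> < 1 / real (Suc j))" for j
  proof -
    have "continuous_on {-1..1} (\<phi> j)" unfolding \<phi>_def by (intro continuous_intros)
    then obtain g where "real_polynomial_function g" "\<And>y. y \<in> {-1..1} \<Longrightarrow> \<bar>\<phi> j y - g y\<bar> < 1 / real (Suc j)"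
      using Stone_Weierstrass_real_polynomial_function[of "{-1..1}" "\<phi> j" "1 / real (Suc j)"] by auto
    then show ?thesis by blast
  qed
  then obtain q where q: "\<And>j. real_polynomial_function (q j)"
    "\<And>j y. y \<in> {-1..1} \<Longrightarrow> \<bar>\<phi> j y - q j y\<bar> < 1 / real (Suc j)" by metis
  have lim: "(\<lambda>j. q j y) \<longlonglongrightarrow> of_bool (c < y)" if y: "y \<in> {-1..1}" for y
  proof -
    have "\<forall>\<^sub>F j in sequentially. \<phi> j y = of_bool (c < y)"
    proof (cases "c < y")
      case True
      obtain n :: nat where n: "1 / (y - c) < real n" using reals_Archimedean2 by blast
      have "\<phi> j y = 1" if "j \<ge> n" for j
      proof -
        have "1 / (y - c) \<le> real j" using n that by linarith
        then have "1 \<le> real j * (y - c)" using True by (simp add: field_simps)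
        then show ?thesis by (simp add: \<phi>_def)
      qed
      then show ?thesis using True by (auto simp: eventually_sequentially)
    next
      case False
      then have "\<phi> j y = 0" for j
        using mult_nonneg_nonpos[of "real j" "y - c"] by (simp add: \<phi>_def max_absorb1)
      then show ?thesis using False by simp
    qed
    then have a: "(\<lambda>j. \<phi> j y) \<longlonglongrightarrow> of_bool (c < y)" by (rule tendsto_eventually)
    have "(\<lambda>j. \<phi> j y - q j y) \<longlonglongrightarrow> 0"
    proof (rule tendsto_rabs_zero_cancel, rule tendsto_sandwich[where f = "\<lambda>_. 0" and h = "\<lambda>j. 1 / real (Suc j)"])
      show "(\<lambda>j. 1 / real (Suc j)) \<longlonglongrightarrow> 0" by (rule LIMSEQ_Suc[OF lim_const_over_n])
    qed (use q(2)[OF y] in \<open>auto intro!: always_eventually less_imp_le\<close>)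
    from tendsto_diff[OF a this] show ?thesis by simp
  qed
  have "\<bar>q j y\<bar> \<le> 2" if "y \<in> {-1..1}" for j y
  proof -
    have "\<bar>\<phi> j y\<bar> \<le> 1" by (auto simp: \<phi>_def)
    moreover have "1 / real (Suc j) \<le> 1" by simp
    ultimately show ?thesis using q(2)[OF that, of j] by linarith
  qed
  with q(1) lim show ?thesis by blast
qed

lemma (in finite_measure) integrable_bounded:
  fixes f :: "'a \<Rightarrow> real"
  assumes "f \<in> borel_measurable M" "\<And>x. \<bar>f x\<bar> \<le> B"
  shows "integrable M f"
  using assms by (intro integrable_const_bound[of _ B]) auto

text \<open>Products of cosines are sums of cosines, so equality of the integrals of all
  \<open>cos (u \<bullet> x + c)\<close> extends to trigonometric polynomials, hence to indicator functions of boxes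
  repeated periodically, and a large period isolates a single box.\<close>

lemma distribution_eqI_cos:
  fixes \<mu> \<nu> :: "'a::euclidean_space measure"
  assumes \<mu>: "distribution_on \<mu>" and \<nu>: "distribution_on \<nu>"
    and cos: "\<And>u c. (\<integral>x. cos (u \<bullet> x + c) \<partial>\<mu>) = (\<integral>x. cos (u \<bullet> x + c) \<partial>\<nu>)"
  shows "\<mu> = \<nu>"
proof -
  interpret \<mu>: prob_space \<mu> using \<mu> by (simp add: distribution_on_def)
  interpret \<nu>: prob_space \<nu> using \<nu> by (simp add: distribution_on_def)
  have sets [simp, measurable_cong]: "sets \<mu> = sets borel" "sets \<nu> = sets borel"
    using \<mu> \<nu> by (simp_all add: distribution_on_def)
  have sp [simp]: "space \<mu> = UNIV" "space \<nu> = UNIV" using sets[THEN sets_eq_imp_space_eq] by auto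
  define P where "P us x = prod_list (map (\<lambda>(w, d). cos (w \<bullet> x + d)) us)" for us and x :: 'a
  have P_meas [measurable]: "P us \<in> borel_measurable borel" for us
    unfolding P_def by (induction us) (auto simp: split_beta')
  have P_le: "\<bar>P us x\<bar> \<le> 1" for us x
    by (induction us) (auto simp: P_def abs_mult mult_le_one)
  \<comment> \<open>The free cosine in front absorbs one factor of the product at a time through the
    product formula for cosines, which keeps the claim inductive.\<close>
  have Pint: "(\<integral>x. cos (u \<bullet> x + c) * P us x \<partial>\<mu>) = (\<integral>x. cos (u \<bullet> x + c) * P us x \<partial>\<nu>)" for u c us
  proof (induction us arbitrary: u c)
    case Nil
    then show ?case by (simp add: P_def cos)
  next
    case (Cons wd us)
    obtain w d where wd: "wd = (w, d)" by force
    have e: "cos (u \<bullet> x + c) * P (wd # us) x =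
        (cos ((u - w) \<bullet> x + (c - d)) * P us x) / 2 + (cos ((u + w) \<bullet> x + (c + d)) * P us x) / 2" for x
    proof -
      have "(u - w) \<bullet> x + (c - d) = (u \<bullet> x + c) - (w \<bullet> x + d)" "(u + w) \<bullet> x + (c + d) = (u \<bullet> x + c) + (w \<bullet> x + d)"
        by (simp_all add: inner_diff_left inner_add_left)
      moreover have "P (wd # us) x = cos (w \<bullet> x + d) * P us x" by (simp add: P_def wd)
      ultimately show ?thesis
        by (simp only: mult.assoc[symmetric] cos_times_cos) (simp add: field_simps)
    qed
    have "\<bar>cos (v \<bullet> x + c) * P us x\<bar> \<le> 1" for v c x
      unfolding abs_mult using P_le[of us x] by (intro mult_le_one) auto
    then have [simp]: "integrable \<mu> (\<lambda>x. cos (v \<bullet> x + c) * P us x)" "integrable \<nu> (\<lambda>x. cos (v \<bullet> x + c) * P us x)" for v c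
      by (auto intro!: \<mu>.integrable_bounded[where B = 1] \<nu>.integrable_bounded[where B = 1])
    show ?case unfolding e by (simp add: Cons.IH)
  qed
  \<comment> \<open>\<open>C\<close> demands equal integrals of \<open>f\<close> against every
    product \<open>P us\<close>, not only of \<open>f\<close> itself; this makes it stable under
    multiplication by a polynomial in a cosine.\<close>
  define C where "C f \<longleftrightarrow> f \<in> borel_measurable borel \<and> (\<exists>B. \<forall>x. \<bar>f x\<bar> \<le> B) \<and>
      (\<forall>us. (\<integral>x. f x * P us x \<partial>\<mu>) = (\<integral>x. f x * P us x \<partial>\<nu>))" for f :: "'a \<Rightarrow> real"
  have C1: "C (\<lambda>x. 1)" using Pint[of 0 0] by (auto simp: C_def)
  have Cpoly: "C (\<lambda>x. q (cos (w \<bullet> x + d)) * f x)" if q: "real_polynomial_function q" and f: "C f" for q w d f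
  proof -
    obtain a n where qa: "q = (\<lambda>y. \<Sum>i\<le>n. a i * y ^ i)" using q real_polynomial_function_iff_sum by blast
    have fm [measurable]: "f \<in> borel_measurable borel" using f by (simp add: C_def)
    obtain B where B: "\<And>x. \<bar>f x\<bar> \<le> B" using f by (auto simp: C_def)
    have rep: "P (replicate i (w, d) @ us) x = cos (w \<bullet> x + d) ^ i * P us x" for i us x
      by (induction i) (simp_all add: P_def)
    have int: "integrable \<mu> (\<lambda>x. f x * P us x)" "integrable \<nu> (\<lambda>x. f x * P us x)" for us
    proof -
      have "\<bar>f x * P us x\<bar> \<le> B" for x
        using mult_mono[OF B[of x] P_le[of us x]] B[of x] by (simp add: abs_mult)
      then show "integrable \<mu> (\<lambda>x. f x * P us x)" "integrable \<nu> (\<lambda>x. f x * P us x)"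
        by (auto intro!: \<mu>.integrable_bounded[where B = B] \<nu>.integrable_bounded[where B = B])
    qed
    have e: "q (cos (w \<bullet> x + d)) * f x * P us x = (\<Sum>i\<le>n. a i * (f x * P (replicate i (w, d) @ us) x))" for x us
      by (simp add: qa rep sum_distrib_left sum_distrib_right mult_ac)
    have "(\<integral>x. q (cos (w \<bullet> x + d)) * f x * P us x \<partial>\<mu>) = (\<integral>x. q (cos (w \<bullet> x + d)) * f x * P us x \<partial>\<nu>)" for us
      unfolding e using int f by (simp add: C_def)
    moreover have "\<bar>q (cos (w \<bullet> x + d)) * f x\<bar> \<le> (\<Sum>i\<le>n. \<bar>a i\<bar>) * B" for x
    proof -
      have "\<bar>q y\<bar> \<le> (\<Sum>i\<le>n. \<bar>a i\<bar>)" if "\<bar>y\<bar> \<le> 1" for y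
        unfolding qa using that
        by (intro order_trans[OF sum_abs] sum_mono) (auto simp: abs_mult power_abs power_le_one mult_left_le)
      then show ?thesis unfolding abs_mult using B[of x] by (intro mult_mono sum_nonneg) auto
    qed
    moreover have "(\<lambda>x. q (cos (w \<bullet> x + d)) * f x) \<in> borel_measurable borel" unfolding qa by measurable
    ultimately show ?thesis unfolding C_def by blast
  qed
  have Cprod: "C (\<lambda>x. \<Prod>i\<in>I. q i (cos (w i \<bullet> x + d i)))"
    if "finite I" "\<And>i. i \<in> I \<Longrightarrow> real_polynomial_function (q i)" for I :: "'a set" and q w d
    using that
  proof (induction I)
    case (insert i I)
    then show ?case using Cpoly[of "q i" "\<lambda>x. \<Prod>i\<in>I. q i (cos (w i \<bullet> x + d i))" "w i" "d i"] by simp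
  qed (simp add: C1)
  have Cint: "(\<integral>x. f x \<partial>\<mu>) = (\<integral>x. f x \<partial>\<nu>)" if "C f" for f
    using that[unfolded C_def] by (auto simp: P_def dest!: spec[of _ "[]"])
  have step: "(\<integral>x. (\<Prod>i\<in>Basis. of_bool (e i < cos (w i \<bullet> x + d i))) \<partial>\<mu>) =
      (\<integral>x. (\<Prod>i\<in>Basis. of_bool (e i < cos (w i \<bullet> x + d i))) \<partial>\<nu> :: real)" (is "?L = ?R") for e d :: "'a \<Rightarrow> real" and w
  proof -
    have "\<forall>i. \<exists>q. (\<forall>j. real_polynomial_function (q j)) \<and> (\<forall>y\<in>{-1..1}. (\<lambda>j. q j y) \<longlonglongrightarrow> of_bool (e i < y))
        \<and> (\<forall>j. \<forall>y\<in>{-1..1}. \<bar>q j y\<bar> \<le> 2)" using polynomial_approximates_step by blast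
    then obtain q where q: "\<And>i j. real_polynomial_function (q i j)"
      "\<And>i y. y \<in> {-1..1} \<Longrightarrow> (\<lambda>j. q i j y) \<longlonglongrightarrow> of_bool (e i < y)"
      "\<And>i j y. y \<in> {-1..1} \<Longrightarrow> \<bar>q i j y\<bar> \<le> 2" by metis
    define g where "g j x = (\<Prod>i\<in>Basis. q i j (cos (w i \<bullet> x + d i)))" for j x
    have "C (\<lambda>x. \<Prod>i\<in>Basis. (\<lambda>i. q i j) i (cos (w i \<bullet> x + d i)))" for j by (intro Cprod) (auto simp: q)
    then have Cg: "C (g j)" for j by (simp add: g_def[abs_def])
    then have [measurable]: "g j \<in> borel_measurable borel" for j by (simp add: C_def)
    have lim: "(\<lambda>j. g j x) \<longlonglongrightarrow> (\<Prod>i\<in>Basis. of_bool (e i < cos (w i \<bullet> x + d i)))" for x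
      unfolding g_def by (intro tendsto_prod q(2)) auto
    have bound: "\<bar>g j x\<bar> \<le> 2 ^ DIM('a)" for j x
    proof -
      have "\<bar>g j x\<bar> \<le> (\<Prod>i\<in>(Basis::'a set). 2)" unfolding g_def abs_prod
        by (rule prod_mono) (auto intro!: q(3))
      then show ?thesis by simp
    qed
    have "(\<lambda>j. \<integral>x. g j x \<partial>\<mu>) \<longlonglongrightarrow> ?L"
      by (rule integral_dominated_convergence[where w = "\<lambda>_. 2 ^ DIM('a)"]) (auto simp: lim bound)
    moreover have "(\<lambda>j. \<integral>x. g j x \<partial>\<nu>) \<longlonglongrightarrow> ?R"
      by (rule integral_dominated_convergence[where w = "\<lambda>_. 2 ^ DIM('a)"]) (auto simp: lim bound)
    ultimately show ?thesis unfolding Cint[OF Cg] by (rule LIMSEQ_unique)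
  qed
  have box: "emeasure \<mu> (box a b) = emeasure \<nu> (box a b)" for a b :: 'a
  proof (cases "box a b = {}")
    case False
    then have ab: "a \<bullet> i < b \<bullet> i" if "i \<in> Basis" for i using that by (auto simp: box_eq_empty not_le)
    define c where "c i = (a \<bullet> i + b \<bullet> i) / 2" for i
    define h where "h i = (b \<bullet> i - a \<bullet> i) / 2" for i
    \<comment> \<open>At frequency \<open>th j\<close> the inequality between cosines cuts out the
      periodic copies of the interval with centre \<open>c i\<close> and half-width
      \<open>h i\<close>. Once both arguments are below \<open>pi\<close>, where the cosine
      decreases, it says exactly that the coordinate lies in this interval; for a fixed point this
      holds eventually.\<close>
    define th where "th j = 1 / real (Suc j)" for j
    have th: "0 < th j" for j by (simp add: th_def)
    define g where "g j x = (\<Prod>i\<in>Basis. of_bool (cos (th j * h i) < cos ((th j *\<^sub>R i) \<bullet> x + - (th j * c i))) :: real)" for j x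
    have eq: "(\<integral>x. g j x \<partial>\<mu>) = (\<integral>x. g j x \<partial>\<nu>)" for j
      unfolding g_def by (rule step)
    have [measurable]: "g j \<in> borel_measurable borel" for j unfolding g_def by measurable
    have bound: "\<bar>g j x\<bar> \<le> 1" for j x
      unfolding g_def abs_prod by (intro prod_le_1) auto
    have "(\<lambda>j. of_bool (cos (th j * h i) < cos ((th j *\<^sub>R i) \<bullet> x + - (th j * c i))) :: real) \<longlonglongrightarrow>
        of_bool (a \<bullet> i < x \<bullet> i \<and> x \<bullet> i < b \<bullet> i)" if i: "i \<in> Basis" for i x
    proof (rule tendsto_eventually)
      have hi: "0 < h i" using ab[OF i] by (simp add: h_def)
      have th0: "th \<longlonglongrightarrow> 0" unfolding th_def by (rule LIMSEQ_Suc[OF lim_const_over_n])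
      have "(\<lambda>j. th j * h i) \<longlonglongrightarrow> 0" "(\<lambda>j. th j * \<bar>x \<bullet> i - c i\<bar>) \<longlonglongrightarrow> 0"
        using tendsto_mult_left_zero[OF th0] by auto
      then have "\<forall>\<^sub>F j in sequentially. th j * h i < pi" "\<forall>\<^sub>F j in sequentially. th j * \<bar>x \<bullet> i - c i\<bar> < pi"
        by (auto intro: order_tendstoD)
      then show "\<forall>\<^sub>F j in sequentially. of_bool (cos (th j * h i) < cos ((th j *\<^sub>R i) \<bullet> x + - (th j * c i))) =
          (of_bool (a \<bullet> i < x \<bullet> i \<and> x \<bullet> i < b \<bullet> i) :: real)"
      proof eventually_elim
        case (elim j)
        have "cos ((th j *\<^sub>R i) \<bullet> x + - (th j * c i)) = cos \<bar>th j * (x \<bullet> i - c i)\<bar>"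
          by (simp add: algebra_simps inner_commute)
        also have "\<dots> = cos (th j * \<bar>x \<bullet> i - c i\<bar>)" using th[of j] by (simp add: abs_mult)
        finally have "cos (th j * h i) < cos ((th j *\<^sub>R i) \<bullet> x + - (th j * c i)) \<longleftrightarrow>
            th j * \<bar>x \<bullet> i - c i\<bar> < th j * h i"
          using elim th[of j] hi by (simp add: cos_mono_less_eq)
        also have "\<dots> \<longleftrightarrow> a \<bullet> i < x \<bullet> i \<and> x \<bullet> i < b \<bullet> i"
          unfolding mult_less_cancel_left_pos[OF th] by (auto simp: c_def h_def abs_less_iff field_simps)
        finally show ?case by simp
      qed
    qed
    then have "(\<lambda>j. g j x) \<longlonglongrightarrow> (\<Prod>i\<in>Basis. of_bool (a \<bullet> i < x \<bullet> i \<and> x \<bullet> i < b \<bullet> i))" for x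
      unfolding g_def by (rule tendsto_prod)
    moreover have "(\<Prod>i\<in>Basis. of_bool (a \<bullet> i < x \<bullet> i \<and> x \<bullet> i < b \<bullet> i)) = (indicator (box a b) x :: real)" for x
      by (auto simp: indicator_def mem_box)
    ultimately have lim: "(\<lambda>j. g j x) \<longlonglongrightarrow> indicator (box a b) x" for x by simp
    have "(\<lambda>j. \<integral>x. g j x \<partial>\<mu>) \<longlonglongrightarrow> (\<integral>x. indicator (box a b) x \<partial>\<mu>)"
      by (rule integral_dominated_convergence[where w = "\<lambda>_. 1"]) (auto simp: lim bound)
    moreover have "(\<lambda>j. \<integral>x. g j x \<partial>\<nu>) \<longlonglongrightarrow> (\<integral>x. indicator (box a b) x \<partial>\<nu>)"
      by (rule integral_dominated_convergence[where w = "\<lambda>_. 1"]) (auto simp: lim bound)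
    ultimately have "(\<integral>x. indicator (box a b) x \<partial>\<mu>) = (\<integral>x. indicator (box a b) x \<partial>\<nu> :: real)"
      unfolding eq by (rule LIMSEQ_unique)
    then show ?thesis by (simp add: \<mu>.emeasure_eq_measure \<nu>.emeasure_eq_measure)
  qed simp
  show ?thesis
  proof (rule measure_eqI_generator_eq)
    let ?E = "range (\<lambda>(a, b). box a b::'a set)"
    show "Int_stable ?E" by (auto simp: Int_stable_def box_Int_box)
    show "?E \<subseteq> Pow UNIV" "sets \<mu> = sigma_sets UNIV ?E" "sets \<nu> = sigma_sets UNIV ?E"
      by (simp_all add: borel_eq_box)
    let ?A = "\<lambda>n::nat. box (- (real n *\<^sub>R One)) (real n *\<^sub>R One) :: 'a set"
    show "range ?A \<subseteq> ?E" "(\<Union>i. ?A i) = UNIV" unfolding UN_box_eq_UNIV by auto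
    show "emeasure \<mu> (?A i) \<noteq> \<infinity>" for i by simp
    show "emeasure \<mu> X = emeasure \<nu> X" if "X \<in> ?E" for X using that box by auto
  qed
qed

text \<open>The integral of a cosine wave depends on the projection onto the direction of its
  frequency vector only, so the two measures agree for almost every vector of the unit ball. The
  integral is continuous in that vector, and a disagreement would persist on a small ball of
  positive volume.\<close>

lemma distribution_eqI_projections:
  fixes \<mu> \<nu> :: "'a::euclidean_space measure"
  assumes \<mu>: "distribution_on \<mu>" and \<nu>: "distribution_on \<nu>"
    and proj: "AE b in uniform_sphere. distr \<mu> borel (\<lambda>x. b \<bullet> x) = distr \<nu> borel (\<lambda>x. b \<bullet> x)"
  shows "\<mu> = \<nu>"
proof (rule distribution_eqI_cos[OF \<mu> \<nu>])
  fix u :: 'a and c :: real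
  interpret \<mu>: prob_space \<mu> using \<mu> by (simp add: distribution_on_def)
  interpret \<nu>: prob_space \<nu> using \<nu> by (simp add: distribution_on_def)
  have sets [simp, measurable_cong]: "sets \<mu> = sets borel" "sets \<nu> = sets borel"
    using \<mu> \<nu> by (simp_all add: distribution_on_def)
  \<comment> \<open>Dividing by more than its norm puts \<open>u\<close> into the open unit ball,
    from which \<open>uniform_sphere\<close> takes its directions.\<close>
  define s where "s = norm u + 1"
  have s: "0 < s" by (simp add: s_def add_nonneg_pos)
  define F where "F M b = (\<integral>x. cos (s * (b \<bullet> x) + c) \<partial>M)" for M and b :: 'a
  have cont: "continuous_on UNIV (F M)" if "finite_measure M" "sets M = sets borel" for M
    unfolding continuous_on_sequentially
  proof (intro allI ballI impI, elim conjE)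
    fix X and b :: 'a assume X: "X \<longlonglongrightarrow> b"
    interpret finite_measure M by fact
    note [measurable_cong] = that(2)
    have "(\<lambda>n. F M (X n)) \<longlonglongrightarrow> F M b"
      unfolding F_def
    proof (rule integral_dominated_convergence[where w = "\<lambda>_. 1"])
      show "AE x in M. (\<lambda>n. cos (s * (X n \<bullet> x) + c)) \<longlonglongrightarrow> cos (s * (b \<bullet> x) + c)"
        by (intro always_eventually allI tendsto_intros X)
    qed auto
    then show "(F M \<circ> X) \<longlonglongrightarrow> F M b" by (simp add: o_def)
  qed
  have ball: "emeasure lborel (ball z r) \<noteq> 0" if "r > 0" for z :: 'a and r
  proof -
    have "measure lborel (ball z r) > 0" using that by (rule content_ball_pos)
    then show ?thesis using emeasure_lborel_ball_finite[of z r]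
      by (metis less_irrefl measure_def enn2real_0)
  qed
  have ae: "AE x in lborel. x \<in> ball 0 1 \<longrightarrow> F \<mu> x = F \<nu> x"
  proof -
    have "AE x in uniform_measure lborel (ball (0::'a) 1).
        distr \<mu> borel (\<lambda>y. sgn x \<bullet> y) = distr \<nu> borel (\<lambda>y. sgn x \<bullet> y)"
      by (rule AE_distrD[OF _ proj[unfolded uniform_sphere_def]]) simp
    then have "AE x in lborel. x \<in> ball (0::'a) 1 \<longrightarrow>
        distr \<mu> borel (\<lambda>y. sgn x \<bullet> y) = distr \<nu> borel (\<lambda>y. sgn x \<bullet> y)"
      using ball[of 1 0] emeasure_lborel_ball_finite[of "0::'a" 1] by (subst (asm) AE_uniform_measure) (auto simp: less_top)
    then show ?thesis
    proof eventually_elim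
      case (elim x)
      have *: "F M x = (\<integral>t. cos (s * norm x * t + c) \<partial>distr M borel (\<lambda>y. sgn x \<bullet> y))"
        if "sets M = sets borel" for M
      proof -
        note [measurable_cong] = that
        have "F M x = (\<integral>y. cos (s * norm x * (sgn x \<bullet> y) + c) \<partial>M)"
          unfolding F_def by (intro Bochner_Integration.integral_cong) (auto simp: sgn_div_norm field_simps)
        also have "\<dots> = (\<integral>t. cos (s * norm x * t + c) \<partial>distr M borel (\<lambda>y. sgn x \<bullet> y))"
          by (subst integral_distr) auto
        finally show ?thesis .
      qed
      show ?case using elim by (simp add: *)
    qed
  qed
  have eq: "F \<mu> b = F \<nu> b" if b: "b \<in> ball 0 1" for b
  proof (rule ccontr)
    assume ne: "F \<mu> b \<noteq> F \<nu> b"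
    have "open ({x. F \<mu> x \<noteq> F \<nu> x} \<inter> ball 0 1)"
      by (intro open_Int open_Collect_neq cont open_ball) (auto intro: \<mu>.finite_measure_axioms \<nu>.finite_measure_axioms)
    then obtain r where r: "r > 0" "ball b r \<subseteq> {x. F \<mu> x \<noteq> F \<nu> x} \<inter> ball 0 1"
      using b ne by (metis (mono_tags, lifting) IntI mem_Collect_eq open_contains_ball)
    have "AE x in lborel. x \<notin> ball b r" using ae by eventually_elim (use r in blast)
    then have "emeasure lborel (ball b r) = 0"
      by (subst (asm) AE_iff_measurable[of "ball b r"]) auto
    then show False using ball[OF r(1)] by simp
  qed
  have "(1 / s) *\<^sub>R u \<in> ball 0 1" using s by (auto simp: s_def divide_simps)
  from eq[OF this] show "(\<integral>x. cos (u \<bullet> x + c) \<partial>\<mu>) = (\<integral>x. cos (u \<bullet> x + c) \<partial>\<nu>)"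
    using s by (simp add: F_def)
qed

section \<open>The rank form of the Cramer--von Mises statistic\<close>

text \<open>For independent draws from one continuous distribution each indicator has mean
  \<open>1 / 3\<close>, being the event that a given one of three draws is the largest; the constant
  centres the kernel.\<close>

definition rank_kernel :: "real \<Rightarrow> real \<Rightarrow> real \<Rightarrow> real \<Rightarrow> real" where
  "rank_kernel x1 x2 y1 y2 = of_bool (x1 \<le> y1 \<and> x2 \<le> y1) + of_bool (y1 \<le> x1 \<and> y2 \<le> x1) - 2 / 3"

definition rank_statistic :: "nat \<Rightarrow> nat \<Rightarrow> (nat \<Rightarrow> real) \<Rightarrow> (nat \<Rightarrow> real) \<Rightarrow> real" where
  "rank_statistic m n x y =
     1 / (real m * (real m - 1) * real n * (real n - 1)) *
     (\<Sum>i1<m. \<Sum>i2\<in>{..<m} - {i1}. \<Sum>j1<n. \<Sum>j2\<in>{..<n} - {j1}. rank_kernel (x i1) (x i2) (y j1) (y j2))"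

text \<open>With signed weights on the pooled vector, relabelling becomes a permutation of the
  entries under fixed weights of sum zero, the form required by
  \<open>permutation_second_moment_le\<close>.\<close>

definition contrast_weight :: "nat \<Rightarrow> nat \<Rightarrow> nat \<Rightarrow> real" where
  "contrast_weight m n p = (if p < m then 1 / real m else - (1 / real n))"

definition balanced_weight :: "nat \<Rightarrow> nat \<Rightarrow> nat \<Rightarrow> real" where
  "balanced_weight m n p = (if p < m then 1 / (2 * real m) else 1 / (2 * real n))"

definition ecdf_contrast :: "nat \<Rightarrow> nat \<Rightarrow> (nat \<Rightarrow> real) \<Rightarrow> real \<Rightarrow> real" where
  "ecdf_contrast m n t s = (\<Sum>q<m + n. contrast_weight m n q * of_bool (t q \<le> s))"

text \<open>The integrating measure is the equal mixture of the two empirical measures, not the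
  pooled one with proportion \<open>m / (m + n)\<close>: this is the mixture that the symmetric
  kernel \<open>h_CvM\<close> produces.\<close>

definition CvM_distance :: "nat \<Rightarrow> nat \<Rightarrow> (nat \<Rightarrow> real) \<Rightarrow> real" where
  "CvM_distance m n t = (\<Sum>p<m + n. balanced_weight m n p * (ecdf_contrast m n t (t p))\<^sup>2)"

text \<open>Each angle is traded for the probability of a wedge, and
  \<open>1 / 2 + 1 / 2 - 2 / 3\<close> leaves the constant of the kernel. The vertex must differ
  from the other two points: for a zero vector \<open>Ang\<close> is \<open>pi / 2\<close> by
  division by zero, whereas the wedge loses one of its constraints.\<close>

lemma h_CvM_eq_integral_rank_kernel:
  fixes x1 x2 y1 y2 :: "'a::euclidean_space"
  assumes "x1 \<noteq> y1" "x2 \<noteq> y1" "y2 \<noteq> x1"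
  shows "h_CvM x1 x2 y1 y2 = (\<integral>b. rank_kernel (b \<bullet> x1) (b \<bullet> x2) (b \<bullet> y1) (b \<bullet> y2) \<partial>uniform_sphere)"
proof -
  interpret S: prob_space "uniform_sphere :: 'a measure" by (rule prob_space_uniform_sphere)
  have w: "(\<integral>b. of_bool (b \<bullet> x \<le> b \<bullet> y \<and> b \<bullet> x' \<le> b \<bullet> y) \<partial>uniform_sphere) =
      1 / 2 - Ang (x - y) (x' - y) / (2 * pi)" if "x \<noteq> y" "x' \<noteq> y" for x x' y :: 'a
  proof -
    have "(\<integral>b. of_bool (b \<bullet> x \<le> b \<bullet> y \<and> b \<bullet> x' \<le> b \<bullet> y) \<partial>uniform_sphere) =
        (\<integral>b. indicator {b. b \<bullet> (x - y) \<le> 0 \<and> b \<bullet> (x' - y) \<le> 0} b \<partial>uniform_sphere :: real)"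
      by (intro Bochner_Integration.integral_cong) (auto simp: indicator_def inner_diff_right)
    also have "\<dots> = measure uniform_sphere {b. b \<bullet> (x - y) \<le> 0 \<and> b \<bullet> (x' - y) \<le> 0}" by simp
    also have "\<dots> = 1 / 2 - Ang (x - y) (x' - y) / (2 * pi)"
      using that by (intro measure_uniform_sphere_wedge) auto
    finally show ?thesis .
  qed
  have [simp]: "integrable uniform_sphere (\<lambda>b. of_bool (b \<bullet> x \<le> b \<bullet> y \<and> b \<bullet> x' \<le> b \<bullet> y) :: real)" for x x' y :: 'a
    by (rule S.integrable_const_bound[of _ 1]) auto
  show ?thesis
    using assms by (simp add: rank_kernel_def w h_CvM_def S.prob_space[simplified] add_divide_distrib)
qed

lemma U_CvM_eq_integral_rank_statistic:
  fixes x y :: "nat \<Rightarrow> 'a::euclidean_space"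
  assumes "\<And>i j. i < m \<Longrightarrow> j < n \<Longrightarrow> x i \<noteq> y j"
  shows "U_CvM m n x y = (\<integral>b. rank_statistic m n (\<lambda>i. b \<bullet> x i) (\<lambda>j. b \<bullet> y j) \<partial>uniform_sphere)"
proof -
  interpret S: prob_space "uniform_sphere :: 'a measure" by (rule prob_space_uniform_sphere)
  have [simp]: "integrable uniform_sphere (\<lambda>b. rank_kernel (b \<bullet> x1) (b \<bullet> x2) (b \<bullet> y1) (b \<bullet> y2))" for x1 x2 y1 y2 :: 'a
    by (rule S.integrable_const_bound[of _ 2]) (auto simp: rank_kernel_def)
  have "U_CvM m n x y = 1 / (real m * (real m - 1) * real n * (real n - 1)) *
     (\<Sum>i1<m. \<Sum>i2\<in>{..<m} - {i1}. \<Sum>j1<n. \<Sum>j2\<in>{..<n} - {j1}.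
       \<integral>b. rank_kernel (b \<bullet> x i1) (b \<bullet> x i2) (b \<bullet> y j1) (b \<bullet> y j2) \<partial>uniform_sphere)"
    unfolding U_CvM_def using assms
    by (intro arg_cong2[where f = "(*)"] sum.cong refl h_CvM_eq_integral_rank_kernel) (auto, metis)
  then show ?thesis by (simp add: rank_statistic_def)
qed

text \<open>Among three distinct numbers exactly one is the maximum.\<close>

lemma max_of_two_and_one_identity:
  fixes x y :: "nat \<Rightarrow> real"
  assumes "inj_on x {..<m}" and xy: "\<And>i j. i < m \<Longrightarrow> j < n \<Longrightarrow> x i \<noteq> y j"
  shows "(\<Sum>j<n. (\<Sum>i<m. of_bool (x i \<le> y j))\<^sup>2) +
      2 * (\<Sum>i<m. (\<Sum>k<m. of_bool (x k \<le> x i)) * (\<Sum>j<n. of_bool (y j \<le> x i))) =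
    (real m)\<^sup>2 * real n + (\<Sum>i<m. \<Sum>j<n. of_bool (y j \<le> x i))"
proof -
  define f where "f i k j = (of_bool (x i \<le> y j) * of_bool (x k \<le> y j) :: real)" for i k j
  define g where "g i k j = (of_bool (x k \<le> x i) * of_bool (y j \<le> x i) :: real)" for i k j
  \<comment> \<open>The three terms say which of \<open>x i\<close>, \<open>x k\<close>,
    \<open>y j\<close> is largest. For \<open>i = k\<close> the last two coincide, so a maximal
    \<open>x i\<close> is counted twice; the correction term records this.\<close>
  have pt: "f i k j + g i k j + g k i j = 1 + (if i = k then of_bool (y j \<le> x i) else 0)"
    if "i < m" "k < m" "j < n" for i k j
  proof -
    have "x i \<noteq> x k" if "i \<noteq> k" using assms(1) \<open>i < m\<close> \<open>k < m\<close> that by (auto dest: inj_onD)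
    then show ?thesis using xy[of i j] xy[of k j] that by (cases "i = k") (auto simp: f_def g_def)
  qed
  have "(\<Sum>i<m. \<Sum>k<m. \<Sum>j<n. f i k j + g i k j + g k i j) =
      (\<Sum>i<m. \<Sum>k<m. \<Sum>j<n. 1 + (if i = k then of_bool (y j \<le> x i) else 0))"
    by (intro sum.cong refl pt) auto
  also have "\<dots> = (\<Sum>i<m. \<Sum>k<m. real n + (if i = k then \<Sum>j<n. of_bool (y j \<le> x i) else 0))"
    by (intro sum.cong refl) (auto simp: sum.distrib)
  also have "\<dots> = (real m)\<^sup>2 * real n + (\<Sum>i<m. \<Sum>j<n. of_bool (y j \<le> x i))"
    by (simp only: sum.distrib) (simp add: power2_eq_square)
  finally have *: "(\<Sum>i<m. \<Sum>k<m. \<Sum>j<n. f i k j) + (\<Sum>i<m. \<Sum>k<m. \<Sum>j<n. g i k j) + (\<Sum>i<m. \<Sum>k<m. \<Sum>j<n. g k i j) =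
      (real m)\<^sup>2 * real n + (\<Sum>i<m. \<Sum>j<n. of_bool (y j \<le> x i))"
    by (simp only: sum.distrib)
  have "(\<Sum>i<m. \<Sum>k<m. \<Sum>j<n. g k i j) = (\<Sum>i<m. \<Sum>k<m. \<Sum>j<n. g i k j)" by (rule sum.swap)
  moreover have "(\<Sum>i<m. \<Sum>k<m. \<Sum>j<n. g i k j) = (\<Sum>i<m. (\<Sum>k<m. of_bool (x k \<le> x i)) * (\<Sum>j<n. of_bool (y j \<le> x i)))"
    by (simp only: g_def sum_product)
  moreover have "(\<Sum>i<m. \<Sum>k<m. \<Sum>j<n. f i k j) = (\<Sum>i<m. \<Sum>j<n. \<Sum>k<m. f i k j)"
    by (rule sum.cong[OF refl], rule sum.swap)
  moreover have "\<dots> = (\<Sum>j<n. \<Sum>i<m. \<Sum>k<m. f i k j)" by (rule sum.swap)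
  moreover have "\<dots> = (\<Sum>j<n. (\<Sum>i<m. of_bool (x i \<le> y j))\<^sup>2)"
    by (simp only: f_def power2_eq_square sum_product)
  ultimately show ?thesis using * by simp
qed

text \<open>Counting, for every triple of indices, which one carries the maximum gives at least one,
  and more than one only if indices coincide. This determines the sum of squared ranks up to second
  order without sorting the sample.\<close>

lemma sum_rank_squares_bounds:
  fixes x :: "nat \<Rightarrow> real"
  assumes "inj_on x {..<m}"
  defines "s \<equiv> (\<Sum>i<m. (\<Sum>k<m. of_bool (x k \<le> x i))\<^sup>2)"
  shows "real m ^ 3 \<le> 3 * s" "3 * s \<le> real m ^ 3 + 3 * (real m)\<^sup>2"
proof -
  define f where "f i j k = (of_bool (x i \<le> x k) * of_bool (x j \<le> x k) :: real)" for i j k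
  define F where "F = (\<Sum>i<m. \<Sum>j<m. \<Sum>k<m. f i j k)"
  have s: "(\<Sum>k<m. \<Sum>i<m. \<Sum>j<m. f i j k) = s"
    by (simp only: s_def f_def power2_eq_square sum_product)
  have s1: "(\<Sum>i<m. \<Sum>j<m. \<Sum>k<m. f i j k) = s"
  proof -
    have "(\<Sum>i<m. \<Sum>j<m. \<Sum>k<m. f i j k) = (\<Sum>i<m. \<Sum>k<m. \<Sum>j<m. f i j k)"
      by (rule sum.cong[OF refl], rule sum.swap)
    also have "\<dots> = (\<Sum>k<m. \<Sum>i<m. \<Sum>j<m. f i j k)" by (rule sum.swap)
    finally show ?thesis using s by simp
  qed
  have s2: "(\<Sum>i<m. \<Sum>j<m. \<Sum>k<m. f i k j) = s"
    using s by (subst sum.swap)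
  have s3: "(\<Sum>i<m. \<Sum>j<m. \<Sum>k<m. f j k i) = s" by (rule s)
  have tot: "(\<Sum>i<m. \<Sum>j<m. \<Sum>k<m. f i j k + f i k j + f j k i) = 3 * s"
    by (simp only: sum.distrib s1 s2 s3)
  have "(\<Sum>i<m. \<Sum>j<m. \<Sum>k<m. 1) \<le> (\<Sum>i<m. \<Sum>j<m. \<Sum>k<m. f i j k + f i k j + f j k i)"
    by (intro sum_mono) (auto simp: f_def)
  then show "real m ^ 3 \<le> 3 * s" unfolding tot by (simp add: power3_eq_cube)
  have "(\<Sum>i<m. \<Sum>j<m. \<Sum>k<m. f i j k + f i k j + f j k i) \<le>
      (\<Sum>i<m. \<Sum>j<m. \<Sum>k<m. 1 + (if i = j then 1 else 0) + (if j = k then 1 else 0) + (if i = k then 1 else 0))"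
  proof (intro sum_mono)
    fix i j k assume "i \<in> {..<m}" "j \<in> {..<m}" "k \<in> {..<m}"
    then have eq: "x i = x j \<longleftrightarrow> i = j" "x j = x k \<longleftrightarrow> j = k" "x i = x k \<longleftrightarrow> i = k"
      using assms(1) by (auto dest: inj_onD)
    have "of_bool (a \<le> c) * of_bool (b \<le> c) + of_bool (a \<le> b) * of_bool (c \<le> b) + of_bool (b \<le> a) * of_bool (c \<le> a)
        \<le> 1 + (if a = b then 1 else 0) + (if b = c then 1 else 0) + (if a = c then 1 else (0::real))" for a b c :: real
      by (cases a b rule: linorder_cases; cases b c rule: linorder_cases; cases a c rule: linorder_cases) auto
    from this[of "x i" "x k" "x j"]
    show "f i j k + f i k j + f j k i \<le> 1 + (if i = j then 1 else 0) + (if j = k then 1 else 0) + (if i = k then 1 else 0)"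
      unfolding eq f_def .
  qed
  also have "\<dots> = real m ^ 3 + 3 * (real m)\<^sup>2"
  proof -
    have "(\<Sum>i<m. \<Sum>j<m. \<Sum>k<m. if i = j then 1 else (0::real)) = (\<Sum>i<m. \<Sum>j<m. if i = j then real m else 0)"
      by (intro sum.cong refl) auto
    then show ?thesis by (simp only: sum.distrib) (simp add: power2_eq_square power3_eq_cube)
  qed
  finally show "3 * s \<le> real m ^ 3 + 3 * (real m)\<^sup>2" unfolding tot .
qed

text \<open>The cost of passing from all pairs of indices to pairs of distinct ones. The difference
  is largest at \<open>A = m / 2\<close>, where it is of order \<open>1 / m\<close>.\<close>

lemma falling_square_approx:
  fixes A m :: real
  assumes "0 \<le> A" "A \<le> m" "2 \<le> m"
  shows "\<bar>A\<^sup>2 / m\<^sup>2 - (A\<^sup>2 - A) / (m * (m - 1))\<bar> \<le> 1 / m"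
proof -
  have "A\<^sup>2 / m\<^sup>2 - (A\<^sup>2 - A) / (m * (m - 1)) = A * (m - A) / (m\<^sup>2 * (m - 1))"
    using assms by (simp add: divide_simps power2_eq_square) (simp add: algebra_simps)
  moreover have "0 \<le> A * (m - A) / (m\<^sup>2 * (m - 1))" using assms by simp
  moreover have "A * (m - A) / (m\<^sup>2 * (m - 1)) \<le> 1 / m"
  proof -
    have "0 \<le> (A - m / 2)\<^sup>2" by simp
    then have "A * (m - A) \<le> m * m / 4" by (simp add: power2_eq_square algebra_simps)
    also have "\<dots> \<le> m * (m - 1)" using assms by (simp add: field_simps)
    finally show ?thesis using assms by (simp add: divide_simps power2_eq_square)
  qed
  ultimately show ?thesis by (simp only: abs_of_nonneg)
qed

lemma sum_pairs_distinct_eq: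
  fixes a :: "nat \<Rightarrow> real"
  assumes "\<And>i. a i * a i = a i"
  shows "(\<Sum>i<m. \<Sum>k\<in>{..<m} - {i}. a i * a k) = (\<Sum>i<m. a i)\<^sup>2 - (\<Sum>i<m. a i)"
proof -
  have "(\<Sum>i<m. \<Sum>k\<in>{..<m} - {i}. a i * a k) = (\<Sum>i<m. (\<Sum>k<m. a i * a k) - a i)"
    by (intro sum.cong refl) (simp add: sum_diff1 assms)
  then show ?thesis by (simp add: sum_subtractf power2_eq_square sum_product)
qed

lemma sum_pooled: "(\<Sum>p<m + n. f p) = (\<Sum>i<m. f i) + (\<Sum>j<n. f (m + j))" for f :: "nat \<Rightarrow> real"
proof -
  have "(\<Sum>p<m + n. f p) = (\<Sum>p<m. f p) + (\<Sum>p=m..<m + n. f p)"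
    by (simp add: lessThan_atLeast0 sum.atLeastLessThan_concat)
  also have "(\<Sum>p=m..<m + n. f p) = (\<Sum>j<n. f (m + j))"
    using sum.shift_bounds_nat_ivl[of f 0 m n] by (simp add: add.commute lessThan_atLeast0)
  finally show ?thesis .
qed

text \<open>For continuous \<open>F\<close> and \<open>G\<close> one has \<open>\<integral>(F -
  G)\<^sup>2 d(F + G)/2 = \<integral>F\<^sup>2 dG + \<integral>G\<^sup>2 dF - 2/3\<close>, because
  the pure terms are 1/3 and each mixed term \<open>2\<integral>FG dF\<close> equals
  \<open>1 - \<integral>F\<^sup>2 dG\<close> up to exchanging the roles. For samples, coincident
  indices perturb each of these replacements by a multiple of \<open>1 / m\<close> or
  \<open>1 / n\<close>.\<close>

lemma rank_statistic_approx:
  assumes "2 \<le> m" "2 \<le> n" and inj: "inj_on t {..<m + n}"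
  shows "\<bar>rank_statistic m n t (\<lambda>j. t (m + j)) - CvM_distance m n t\<bar> \<le> 2 * (1 / real m + 1 / real n)"
proof -
  define y where "y j = t (m + j)" for j
  define M N where "M = real m" and "N = real n"
  have MN: "2 \<le> M" "2 \<le> N" using assms by (auto simp: M_def N_def)
  have injx: "inj_on t {..<m}" using inj by (rule inj_on_subset) auto
  have injy: "inj_on y {..<n}"
  proof (rule inj_onI)
    fix j l assume "j \<in> {..<n}" "l \<in> {..<n}" "y j = y l"
    then show "j = l" using inj_onD[OF inj, of "m + j" "m + l"] by (simp add: y_def)
  qed
  have xy: "t i \<noteq> y j" if "i < m" "j < n" for i j
    using inj_onD[OF inj, of i "m + j"] that by (auto simp: y_def)
  have yx: "y j \<noteq> t i" if "j < n" "i < m" for i j using xy[OF that(2,1)] by simp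
  define A where "A i = (\<Sum>k<m. of_bool (t k \<le> t i) :: real)" for i
  define B where "B i = (\<Sum>j<n. of_bool (y j \<le> t i) :: real)" for i
  define A' where "A' j = (\<Sum>i<m. of_bool (t i \<le> y j) :: real)" for j
  define B' where "B' j = (\<Sum>l<n. of_bool (y l \<le> y j) :: real)" for j
  have A'_le: "0 \<le> A' j" "A' j \<le> M" for j
    unfolding A'_def M_def using sum_bounded_above[of "{..<m}" "\<lambda>i. of_bool (t i \<le> y j)" "1::real"] by (auto intro!: sum_nonneg)
  have B_le: "0 \<le> B i" "B i \<le> N" for i
    unfolding B_def N_def using sum_bounded_above[of "{..<n}" "\<lambda>j. of_bool (y j \<le> t i)" "1::real"] by (auto intro!: sum_nonneg)
  \<comment> \<open>The first two letters name the integrands, the last one the integrator: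
    \<open>FFG\<close> integrates the square of the first empirical distribution function against
    the second empirical measure.\<close>
  define FFF GGG FFG GGF FGF GFG where "FFF = (\<Sum>i<m. (A i)\<^sup>2) / M ^ 3" and "GGG = (\<Sum>j<n. (B' j)\<^sup>2) / N ^ 3"
    and "FFG = (\<Sum>j<n. (A' j)\<^sup>2) / (M\<^sup>2 * N)" and "GGF = (\<Sum>i<m. (B i)\<^sup>2) / (N\<^sup>2 * M)"
    and "FGF = (\<Sum>i<m. A i * B i) / (M\<^sup>2 * N)" and "GFG = (\<Sum>j<n. B' j * A' j) / (N\<^sup>2 * M)"
  define \<theta>1 \<theta>2 where "\<theta>1 = (\<Sum>i<m. B i) / (M\<^sup>2 * N)" and "\<theta>2 = (\<Sum>j<n. A' j) / (N\<^sup>2 * M)"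
  have id1: "FFG + 2 * FGF = 1 + \<theta>1"
    using max_of_two_and_one_identity[where x = t and y = y and m = m and n = n, OF injx xy] MN
    unfolding FFG_def FGF_def \<theta>1_def A'_def[symmetric] A_def[symmetric] B_def[symmetric] M_def[symmetric] N_def[symmetric]
    by (simp add: divide_simps)
  have id2: "GGF + 2 * GFG = 1 + \<theta>2"
    using max_of_two_and_one_identity[where x = y and y = t and m = n and n = m, OF injy yx] MN
    unfolding GGF_def GFG_def \<theta>2_def A'_def[symmetric] B'_def[symmetric] B_def[symmetric] M_def[symmetric] N_def[symmetric]
    by (simp add: divide_simps)
  have th1: "0 \<le> \<theta>1" "\<theta>1 \<le> 1 / M"
  proof -
    have "(\<Sum>i<m. B i) \<le> M * N" using sum_bounded_above[of "{..<m}" B N] B_le by (simp add: M_def)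
    then show "\<theta>1 \<le> 1 / M" using MN by (simp add: \<theta>1_def divide_simps power2_eq_square)
    show "0 \<le> \<theta>1" using MN B_le by (simp add: \<theta>1_def sum_nonneg)
  qed
  have th2: "0 \<le> \<theta>2" "\<theta>2 \<le> 1 / N"
  proof -
    have "(\<Sum>j<n. A' j) \<le> N * M" using sum_bounded_above[of "{..<n}" A' M] A'_le by (simp add: N_def)
    then show "\<theta>2 \<le> 1 / N" using MN by (simp add: \<theta>2_def divide_simps power2_eq_square)
    show "0 \<le> \<theta>2" using MN A'_le by (simp add: \<theta>2_def sum_nonneg)
  qed
  have F3: "1 / 3 \<le> FFF" "FFF \<le> 1 / 3 + 1 / M"
  proof -
    note * = sum_rank_squares_bounds[OF injx, folded A_def M_def]
    have "(1 / 3 + 1 / M) * M ^ 3 = M ^ 3 / 3 + M\<^sup>2"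
      using MN by (simp add: field_simps power2_eq_square power3_eq_cube)
    then show "1 / 3 \<le> FFF" "FFF \<le> 1 / 3 + 1 / M"
      using * MN unfolding FFF_def by (simp_all add: pos_le_divide_eq pos_divide_le_eq)
  qed
  have G3: "1 / 3 \<le> GGG" "GGG \<le> 1 / 3 + 1 / N"
  proof -
    note * = sum_rank_squares_bounds[OF injy, folded B'_def N_def]
    have "(1 / 3 + 1 / N) * N ^ 3 = N ^ 3 / 3 + N\<^sup>2"
      using MN by (simp add: field_simps power2_eq_square power3_eq_cube)
    then show "1 / 3 \<le> GGG" "GGG \<le> 1 / 3 + 1 / N"
      using * MN unfolding GGG_def by (simp_all add: pos_le_divide_eq pos_divide_le_eq)
  qed
  have V: "CvM_distance m n t = (FFF - 2 * FGF + GGF + FFG - 2 * GFG + GGG) / 2"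
  proof -
    have c1: "ecdf_contrast m n t (t i) = A i / M - B i / N" for i
      unfolding ecdf_contrast_def sum_pooled A_def B_def y_def M_def N_def sum_divide_distrib
      by (simp add: contrast_weight_def sum_negf del: sum_of_bool_eq)
    have c2: "ecdf_contrast m n t (y j) = A' j / M - B' j / N" for j
      unfolding ecdf_contrast_def sum_pooled A'_def B'_def y_def M_def N_def sum_divide_distrib
      by (simp add: contrast_weight_def sum_negf del: sum_of_bool_eq)
    have "CvM_distance m n t = (\<Sum>i<m. (A i / M - B i / N)\<^sup>2) / (2 * M) + (\<Sum>j<n. (A' j / M - B' j / N)\<^sup>2) / (2 * N)"
      unfolding CvM_distance_def sum_pooled
      unfolding y_def[symmetric] c2
      unfolding c1
      by (simp add: balanced_weight_def M_def N_def sum_divide_distrib)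
    also have "(\<Sum>i<m. (A i / M - B i / N)\<^sup>2) = (\<Sum>i<m. (A i)\<^sup>2) / M\<^sup>2 - 2 * (\<Sum>i<m. A i * B i) / (M * N) + (\<Sum>i<m. (B i)\<^sup>2) / N\<^sup>2"
      by (simp add: power2_diff sum.distrib sum_subtractf sum_divide_distrib sum_distrib_left power_divide mult.assoc)
    also have "(\<Sum>j<n. (A' j / M - B' j / N)\<^sup>2) = (\<Sum>j<n. (A' j)\<^sup>2) / M\<^sup>2 - 2 * (\<Sum>j<n. B' j * A' j) / (M * N) + (\<Sum>j<n. (B' j)\<^sup>2) / N\<^sup>2"
      by (simp add: power2_diff sum.distrib sum_subtractf sum_divide_distrib sum_distrib_left power_divide mult_ac)
    finally show ?thesis using MN
      by (simp add: FFF_def GGG_def FFG_def GGF_def FGF_def GFG_def add_divide_distrib diff_divide_distrib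
          power2_eq_square power3_eq_cube mult_ac)
  qed
  define FFG' GGF' where "FFG' = (\<Sum>j<n. (A' j)\<^sup>2 - A' j) / (M * (M - 1) * N)"
    and "GGF' = (\<Sum>i<m. (B i)\<^sup>2 - B i) / (N * (N - 1) * M)"
  have d1: "\<bar>FFG - FFG'\<bar> \<le> 1 / M"
  proof -
    define S where "S = (\<Sum>j<n. (A' j)\<^sup>2 / M\<^sup>2 - ((A' j)\<^sup>2 - A' j) / (M * (M - 1)))"
    have "FFG - FFG' = S / N"
      by (simp add: FFG_def FFG'_def S_def sum_subtractf sum_divide_distrib diff_divide_distrib)
    moreover have "\<bar>S\<bar> \<le> (\<Sum>j<n. 1 / M)"
      unfolding S_def by (intro order_trans[OF sum_abs] sum_mono falling_square_approx A'_le MN)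
    then have "\<bar>S\<bar> \<le> N * (1 / M)" by (simp add: N_def)
    then have "\<bar>S\<bar> / N \<le> 1 / M" using MN by (simp add: pos_divide_le_eq mult.commute)
    ultimately show ?thesis using MN by (simp add: abs_divide)
  qed
  have d2: "\<bar>GGF - GGF'\<bar> \<le> 1 / N"
  proof -
    define S where "S = (\<Sum>j<m. (B j)\<^sup>2 / N\<^sup>2 - ((B j)\<^sup>2 - B j) / (N * (N - 1)))"
    have "GGF - GGF' = S / M"
      by (simp add: GGF_def GGF'_def S_def sum_subtractf sum_divide_distrib diff_divide_distrib)
    moreover have "\<bar>S\<bar> \<le> (\<Sum>j<m. 1 / N)"
      unfolding S_def by (intro order_trans[OF sum_abs] sum_mono falling_square_approx B_le MN)
    then have "\<bar>S\<bar> \<le> M * (1 / N)" by (simp add: M_def)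
    then have "\<bar>S\<bar> / M \<le> 1 / N" using MN by (simp add: pos_divide_le_eq mult.commute)
    ultimately show ?thesis using MN by (simp add: abs_divide)
  qed
  have U: "rank_statistic m n t y = FFG' + GGF' - 2 / 3"
  proof -
    define p where "p i j = (of_bool (t i \<le> y j) :: real)" for i j
    define q where "q i j = (of_bool (y j \<le> t i) :: real)" for i j
    have "(\<Sum>i1<m. \<Sum>i2\<in>{..<m} - {i1}. \<Sum>j1<n. \<Sum>j2\<in>{..<n} - {j1}. rank_kernel (t i1) (t i2) (y j1) (y j2))
      = (\<Sum>i1<m. \<Sum>i2\<in>{..<m} - {i1}. \<Sum>j1<n. (N - 1) * (p i1 j1 * p i2 j1)
           + (\<Sum>j2\<in>{..<n} - {j1}. q i1 j1 * q i1 j2) - (N - 1) * (2 / 3))"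
      by (intro sum.cong refl)
        (simp add: rank_kernel_def p_def q_def sum.distrib sum_subtractf N_def of_nat_diff of_bool_conj)
    also have "\<dots> = (N - 1) * (\<Sum>i1<m. \<Sum>i2\<in>{..<m} - {i1}. \<Sum>j<n. p i1 j * p i2 j)
        + (\<Sum>i<m. \<Sum>i2\<in>{..<m} - {i}. \<Sum>j1<n. \<Sum>j2\<in>{..<n} - {j1}. q i j1 * q i j2)
        - (\<Sum>i1<m. \<Sum>i2\<in>{..<m} - {i1}. \<Sum>j<n. (N - 1) * (2 / 3))"
      by (simp only: sum.distrib sum_subtractf sum_distrib_left)
    also have "(\<Sum>i1<m. \<Sum>i2\<in>{..<m} - {i1}. \<Sum>j<n. (N - 1) * (2 / 3)) = M * (M - 1) * N * (N - 1) * (2 / 3)"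
      using assms(1) by (simp add: M_def N_def of_nat_diff)
    also have "(\<Sum>i<m. \<Sum>i2\<in>{..<m} - {i}. \<Sum>j1<n. \<Sum>j2\<in>{..<n} - {j1}. q i j1 * q i j2)
        = (M - 1) * (\<Sum>i<m. (B i)\<^sup>2 - B i)"
    proof -
      have "(\<Sum>j1<n. \<Sum>j2\<in>{..<n} - {j1}. q i j1 * q i j2) = (B i)\<^sup>2 - B i" for i
        unfolding B_def q_def by (rule sum_pairs_distinct_eq) simp
      then show ?thesis using assms(1) by (simp add: M_def of_nat_diff sum_distrib_left)
    qed
    also have "(\<Sum>i1<m. \<Sum>i2\<in>{..<m} - {i1}. \<Sum>j<n. p i1 j * p i2 j) = (\<Sum>j<n. (A' j)\<^sup>2 - A' j)"
    proof -
      have "(\<Sum>i1<m. \<Sum>i2\<in>{..<m} - {i1}. \<Sum>j<n. p i1 j * p i2 j) = (\<Sum>i1<m. \<Sum>j<n. \<Sum>i2\<in>{..<m} - {i1}. p i1 j * p i2 j)"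
        by (rule sum.cong[OF refl], rule sum.swap)
      also have "\<dots> = (\<Sum>j<n. \<Sum>i1<m. \<Sum>i2\<in>{..<m} - {i1}. p i1 j * p i2 j)" by (rule sum.swap)
      also have "\<dots> = (\<Sum>j<n. (A' j)\<^sup>2 - A' j)"
        unfolding A'_def p_def by (intro sum.cong refl sum_pairs_distinct_eq) simp
      finally show ?thesis .
    qed
    finally show ?thesis
      using MN unfolding rank_statistic_def M_def[symmetric] N_def[symmetric] FFG'_def GGF'_def
      by (simp add: divide_simps)
  qed
  \<comment> \<open>By \<open>id1\<close> and \<open>id2\<close> the distance is
    \<open>FFG + GGF - 2 / 3\<close> up to half of the errors in \<open>F3\<close>,
    \<open>G3\<close>, \<open>th1\<close> and \<open>th2\<close>, which partly cancel; distinct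
    indices add \<open>d1\<close> and \<open>d2\<close>. Altogether this is at most three halves of
    \<open>1 / M + 1 / N\<close>.\<close>
  have "\<bar>(FFG' + GGF' - 2 / 3) - (FFF - 2 * FGF + GGF + FFG - 2 * GFG + GGG) / 2\<bar> \<le> 2 * (a + b)"
    if "a = 1 / M" "b = 1 / N" for a b
    using id1 id2 th1 th2 F3 G3 d1 d2 unfolding that[symmetric] abs_le_iff by (auto simp: field_simps)
  from this[OF refl refl]
  show ?thesis unfolding U[symmetric] V[symmetric] M_def N_def y_def .
qed

section \<open>Consistency of the Cramer--von Mises statistic\<close>

definition proj_cdf :: "'a::euclidean_space measure \<Rightarrow> 'a \<Rightarrow> real \<Rightarrow> real" where
  "proj_cdf P b t = measure P {x. b \<bullet> x \<le> t}"

lemma measurable_proj_cdf [measurable]: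
  fixes P :: "'a::euclidean_space measure"
  assumes "distribution_on P" and [measurable]: "f \<in> borel_measurable M" "g \<in> borel_measurable M"
  shows "(\<lambda>x. proj_cdf P (f x) (g x)) \<in> borel_measurable M"
proof -
  interpret P: prob_space P using assms by (simp add: distribution_on_def)
  have [measurable_cong]: "sets P = sets borel" using assms by (simp add: distribution_on_def)
  then have [simp]: "space P = UNIV" by (auto dest: sets_eq_imp_space_eq)
  have "{y \<in> space ((borel \<Otimes>\<^sub>M borel) \<Otimes>\<^sub>M P). fst (fst y) \<bullet> snd y \<le> (snd (fst y) :: real)} \<in> sets ((borel \<Otimes>\<^sub>M borel) \<Otimes>\<^sub>M P)"
    by measurable
  from P.measurable_emeasure_Pair[OF this]
  have "(\<lambda>c. emeasure P {x. fst c \<bullet> x \<le> snd c}) \<in> borel_measurable (borel \<Otimes>\<^sub>M borel)"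
    by (simp add: space_pair_measure vimage_def)
  then have [measurable]: "(\<lambda>c. measure P {x. fst c \<bullet> x \<le> snd c}) \<in> borel_measurable (borel \<Otimes>\<^sub>M borel)"
    unfolding measure_def by measurable
  have "(\<lambda>x. (\<lambda>c. measure P {x. fst c \<bullet> x \<le> snd c}) (f x, g x)) \<in> borel_measurable M"
    by measurable
  then show ?thesis by (simp add: proj_cdf_def)
qed

lemma proj_cdf_bounds: "distribution_on P \<Longrightarrow> 0 \<le> proj_cdf P b t" "distribution_on P \<Longrightarrow> proj_cdf P b t \<le> 1"
  by (simp_all add: proj_cdf_def distribution_on_def prob_space.prob_le_1)

lemma cdf_distr_eq_proj_cdf:
  assumes "distribution_on P"
  shows "cdf (distr P borel (\<lambda>x. b \<bullet> x)) t = proj_cdf P b t"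
proof -
  have [measurable_cong]: "sets P = sets borel" using assms by (simp add: distribution_on_def)
  then have [simp]: "space P = UNIV" by (auto dest: sets_eq_imp_space_eq)
  show ?thesis unfolding cdf_def proj_cdf_def by (subst measure_distr) (simp_all add: vimage_def)
qed

lemma real_distribution_distr_inner:
  assumes "distribution_on P"
  shows "real_distribution (distr P borel (\<lambda>x. b \<bullet> x))"
proof -
  have [measurable_cong]: "sets P = sets borel" using assms by (simp add: distribution_on_def)
  interpret prob_space P using assms by (simp add: distribution_on_def)
  show ?thesis by (rule real_distribution_distr) simp
qed

text \<open>Averaging over directions at a fixed point first makes the population distance an
  expectation of one bounded function of a single observation, to which a law of large numbers over
  the pooled sample applies.\<close>

definition proj_discrepancy :: "'a::euclidean_space measure \<Rightarrow> 'a measure \<Rightarrow> 'a \<Rightarrow> real" where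
  "proj_discrepancy P Q x = (\<integral>b. (proj_cdf P b (b \<bullet> x) - proj_cdf Q b (b \<bullet> x))\<^sup>2 \<partial>uniform_sphere)"

lemma proj_cdf_diff_square_le:
  assumes "distribution_on P" "distribution_on Q"
  shows "(proj_cdf P b t - proj_cdf Q b t)\<^sup>2 \<le> 1"
  using proj_cdf_bounds[OF assms(1), of b t] proj_cdf_bounds[OF assms(2), of b t]
  by (simp add: abs_square_le_1 abs_le_iff)

lemma proj_discrepancy_bounds:
  fixes P Q :: "'a::euclidean_space measure"
  assumes "distribution_on P" "distribution_on Q"
  shows "0 \<le> proj_discrepancy P Q x" "proj_discrepancy P Q x \<le> 1"
proof -
  interpret S: prob_space "uniform_sphere :: 'a measure" by (rule prob_space_uniform_sphere)
  show "0 \<le> proj_discrepancy P Q x" unfolding proj_discrepancy_def by simp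
  have "integrable uniform_sphere (\<lambda>b. (proj_cdf P b (b \<bullet> x) - proj_cdf Q b (b \<bullet> x))\<^sup>2)"
    by (rule S.integrable_bounded[where B = 1]) (use assms proj_cdf_diff_square_le[OF assms] in simp_all)
  then have "proj_discrepancy P Q x \<le> (\<integral>b. 1 \<partial>(uniform_sphere :: 'a measure))"
    unfolding proj_discrepancy_def
    by (intro integral_mono) (use proj_cdf_diff_square_le[OF assms] in simp_all)
  then show "proj_discrepancy P Q x \<le> 1" using S.prob_space by simp
qed

lemma measurable_proj_discrepancy [measurable]:
  fixes P Q :: "'a::euclidean_space measure"
  assumes [simp]: "distribution_on P" "distribution_on Q"
  shows "proj_discrepancy P Q \<in> borel_measurable borel"
proof -
  interpret S: prob_space "uniform_sphere :: 'a measure" by (rule prob_space_uniform_sphere)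
  show ?thesis unfolding proj_discrepancy_def[abs_def]
    by (rule S.borel_measurable_lebesgue_integral) (simp add: split_beta')
qed

text \<open>If both integrals vanish, Fubini's theorem yields, for almost every direction, that the
  projected distribution functions agree almost everywhere under both projections. Continuity
  upgrades this to equal projections, which determine the distribution.\<close>

lemma proj_discrepancy_pos:
  fixes P Q :: "'a::euclidean_space measure"
  assumes P: "distribution_on P" and Q: "distribution_on Q" and "P \<noteq> Q"
    and cont: "continuous_projections P" "continuous_projections Q"
  shows "0 < (\<integral>x. proj_discrepancy P Q x \<partial>P) + (\<integral>x. proj_discrepancy P Q x \<partial>Q)"
proof (rule ccontr)
  interpret S: prob_space "uniform_sphere :: 'a measure" by (rule prob_space_uniform_sphere)
  have nn: "0 \<le> (\<integral>x. proj_discrepancy P Q x \<partial>M)" for M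
    by (rule integral_nonneg_AE) (simp add: proj_discrepancy_bounds P Q)
  assume "\<not> 0 < (\<integral>x. proj_discrepancy P Q x \<partial>P) + (\<integral>x. proj_discrepancy P Q x \<partial>Q)"
  then have 0: "(\<integral>x. proj_discrepancy P Q x \<partial>P) = 0" "(\<integral>x. proj_discrepancy P Q x \<partial>Q) = 0"
    using nn[of P] nn[of Q] by linarith+
  let ?d = "\<lambda>b x. (proj_cdf P b (b \<bullet> x) - proj_cdf Q b (b \<bullet> x))\<^sup>2"
  have ae: "AE b in uniform_sphere. AE t in distr M borel (\<lambda>x. b \<bullet> x). proj_cdf P b t = proj_cdf Q b t"
    if M: "distribution_on M" and "(\<integral>x. proj_discrepancy P Q x \<partial>M) = 0" for M
  proof -
    interpret M: prob_space M using M by (simp add: distribution_on_def)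
    interpret MS: pair_prob_space M "uniform_sphere :: 'a measure" ..
    have [measurable_cong]: "sets M = sets borel" using M by (simp add: distribution_on_def)
    have int: "integrable (M \<Otimes>\<^sub>M uniform_sphere) (\<lambda>(x, b). ?d b x)"
      by (rule MS.integrable_bounded[where B = 1])
        (use P Q proj_cdf_diff_square_le[OF P Q] in \<open>simp_all add: split_beta'\<close>)
    have "(\<integral>b. (\<integral>x. ?d b x \<partial>M) \<partial>uniform_sphere) = (\<integral>x. proj_discrepancy P Q x \<partial>M)"
      unfolding proj_discrepancy_def by (rule MS.Fubini_integral[OF int])
    then have "(\<integral>b. (\<integral>x. ?d b x \<partial>M) \<partial>uniform_sphere) = 0" using that(2) by simp
    moreover have "integrable uniform_sphere (\<lambda>b. \<integral>x. ?d b x \<partial>M)" by (rule MS.integrable_snd[OF int])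
    ultimately have "AE b in uniform_sphere. (\<integral>x. ?d b x \<partial>M) = 0"
      by (subst (asm) integral_nonneg_eq_0_iff_AE) auto
    then show ?thesis
    proof eventually_elim
      case (elim b)
      have "integrable M (?d b)"
        by (rule M.integrable_bounded[where B = 1]) (use P Q proj_cdf_diff_square_le[OF P Q] in simp_all)
      then have "AE x in M. ?d b x = 0"
        using elim by (subst (asm) integral_nonneg_eq_0_iff_AE) auto
      then have "AE x in M. proj_cdf P b (b \<bullet> x) = proj_cdf Q b (b \<bullet> x)" by eventually_elim simp
      then show ?case using P Q by (subst AE_distr_iff) simp_all
    qed
  qed
  have "AE b in uniform_sphere. distr P borel (\<lambda>x. b \<bullet> x) = distr Q borel (\<lambda>x. b \<bullet> x)"
    using cont[unfolded continuous_projections_def] ae[OF P 0(1)] ae[OF Q 0(2)]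
  proof eventually_elim
    case (elim b)
    then show ?case
      by (intro eq_if_AE_cdf_eq real_distribution_distr_inner P Q) (simp_all add: cdf_distr_eq_proj_cdf P Q)
  qed
  then show False using distribution_eqI_projections[OF P Q] \<open>P \<noteq> Q\<close> by simp
qed

text \<open>The mixture dominates \<open>1 - \<epsilon>\<close> times \<open>Q\<close> as a measure,
  whatever \<open>G\<close> is.\<close>

lemma integral_contaminate_ge:
  assumes Q: "distribution_on Q" and G: "distribution_on G" and "0 \<le> \<epsilon>" "\<epsilon> \<le> 1"
    and [measurable]: "f \<in> borel_measurable borel" and f: "\<And>x. 0 \<le> f x" "\<And>x. f x \<le> 1"
  shows "(1 - \<epsilon>) * (\<integral>x. f x \<partial>Q) \<le> (\<integral>x. f x \<partial>contaminate \<epsilon> Q G)"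
proof -
  have C: "distribution_on (contaminate \<epsilon> Q G)" using assms by (intro distribution_on_contaminate)
  have [measurable_cong]: "sets Q = sets borel" "sets G = sets borel" "sets (contaminate \<epsilon> Q G) = sets borel"
    using Q G by (simp_all add: distribution_on_def)
  interpret Q: prob_space Q using Q by (simp add: distribution_on_def)
  interpret C: prob_space "contaminate \<epsilon> Q G" using C by (simp add: distribution_on_def)
  have "ennreal ((1 - \<epsilon>) * (\<integral>x. f x \<partial>Q)) = ennreal (1 - \<epsilon>) * (\<integral>\<^sup>+x. f x \<partial>Q)"
    using assms by (subst nn_integral_eq_integral)
      (auto simp: ennreal_mult abs_le_iff intro!: Q.integrable_bounded[where B = 1] order_trans[OF _ f(1)])
  also have "\<dots> = (\<integral>\<^sup>+x. f x \<partial>scale_measure (ennreal (1 - \<epsilon>)) Q)"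
    by (subst nn_integral_scale_measure) simp_all
  also have "\<dots> \<le> (\<integral>\<^sup>+x. f x \<partial>contaminate \<epsilon> Q G)"
    by (intro nn_integral_mono_measure)
      (use \<open>sets Q = sets borel\<close> \<open>sets G = sets borel\<close> in \<open>auto simp: le_measure emeasure_contaminate\<close>)
  also have "\<dots> = ennreal (\<integral>x. f x \<partial>contaminate \<epsilon> Q G)"
    using assms by (intro nn_integral_eq_integral)
      (auto simp: abs_le_iff intro!: C.integrable_bounded[where B = 1] order_trans[OF _ f(1)])
  finally show ?thesis
    by (subst (asm) ennreal_le_iff) (use f in \<open>auto intro!: integral_nonneg_AE\<close>)
qed

lemma proj_cdf_contaminate:
  assumes Q: "distribution_on Q" and G: "distribution_on G" and "0 \<le> \<epsilon>" "\<epsilon> \<le> 1"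
  shows "proj_cdf (contaminate \<epsilon> Q G) b t = (1 - \<epsilon>) * proj_cdf Q b t + \<epsilon> * proj_cdf G b t"
proof -
  interpret Q: prob_space Q using Q by (simp add: distribution_on_def)
  interpret G: prob_space G using G by (simp add: distribution_on_def)
  interpret C: prob_space "contaminate \<epsilon> Q G"
    using distribution_on_contaminate[OF assms] by (simp add: distribution_on_def)
  have s: "sets Q = sets borel" "sets G = sets borel" using Q G by (simp_all add: distribution_on_def)
  have "{x. b \<bullet> x \<le> t} \<in> sets borel" by measurable
  from emeasure_contaminate[OF s this, of \<epsilon>] assms(3,4)
  show ?thesis unfolding proj_cdf_def C.emeasure_eq_measure Q.emeasure_eq_measure G.emeasure_eq_measure
    by (simp add: ennreal_mult[symmetric] ennreal_plus[symmetric] del: ennreal_plus)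
qed

text \<open>Conditioning on all coordinates but one. The variance bounds use it to remove cross
  terms, and \<open>AE_distinct\<close> uses it to see that ties are null events.\<close>

lemma (in product_sigma_finite) integral_PiM_eq_0_if_coordinate:
  fixes f :: "_ \<Rightarrow> real"
  assumes "finite I" "k \<in> I" "integrable (Pi\<^sub>M I M) f"
    and "\<And>x. (\<integral>y. f (x(k := y)) \<partial>M k) = 0"
  shows "(\<integral>x. f x \<partial>Pi\<^sub>M I M) = 0"
proof -
  have I: "insert k (I - {k}) = I" using assms by auto
  have "(\<integral>x. f x \<partial>Pi\<^sub>M (insert k (I - {k})) M) = (\<integral>x. (\<integral>y. f (x(k := y)) \<partial>M k) \<partial>Pi\<^sub>M (I - {k}) M)"
    by (rule product_integral_insert) (use assms I in auto)
  then show ?thesis unfolding I by (simp add: assms)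
qed

lemma integral_double_sum:
  fixes c :: "'i \<Rightarrow> 'i \<Rightarrow> real" and f :: "'i \<Rightarrow> 'i \<Rightarrow> 'b \<Rightarrow> real"
  assumes "\<And>i j. i \<in> I \<Longrightarrow> j \<in> I \<Longrightarrow> integrable M (f i j)"
  shows "(\<integral>x. (\<Sum>i\<in>I. \<Sum>j\<in>I. c i j * f i j x) \<partial>M) = (\<Sum>i\<in>I. \<Sum>j\<in>I. c i j * (\<integral>x. f i j x \<partial>M))"
proof -
  have "(\<integral>x. (\<Sum>i\<in>I. \<Sum>j\<in>I. c i j * f i j x) \<partial>M) = (\<Sum>i\<in>I. \<integral>x. (\<Sum>j\<in>I. c i j * f i j x) \<partial>M)"
    by (rule Bochner_Integration.integral_sum) (intro Bochner_Integration.integrable_sum integrable_mult_right assms)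
  also have "\<dots> = (\<Sum>i\<in>I. \<Sum>j\<in>I. \<integral>x. c i j * f i j x \<partial>M)"
    by (rule sum.cong[OF refl], rule Bochner_Integration.integral_sum) (intro integrable_mult_right assms)
  finally show ?thesis by simp
qed

section \<open>Second-moment bounds for two independent samples\<close>

locale two_samples =
  fixes PX PY :: "'a::euclidean_space measure" and m n :: nat
  assumes PX: "distribution_on PX" and PY: "distribution_on PY" and mn: "2 \<le> m" "2 \<le> n"
begin

definition law :: "nat \<Rightarrow> 'a measure" where "law q = (if q < m then PX else PY)"

abbreviation Z :: "(nat \<Rightarrow> 'a) measure" where "Z \<equiv> \<Pi>\<^sub>M q\<in>{..<m + n}. law q"

lemma pooled_law_eq: "pooled_law PX PY m n = Z"
  by (simp add: pooled_law_def law_def[abs_def])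

lemma distribution_on_law: "distribution_on (law q)" using PX PY by (simp add: law_def)

lemma sets_law [simp, measurable_cong]: "sets (law q) = sets borel"
  using distribution_on_law by (simp add: distribution_on_def)

lemma space_law [simp]: "space (law q) = UNIV"
  using sets_eq_imp_space_eq[OF sets_law] by simp

sublocale product_sigma_finite law
  using distribution_on_law
  by (simp add: product_sigma_finite_def distribution_on_def prob_space_imp_sigma_finite)

sublocale Z: prob_space Z by (rule prob_space_PiM) (use distribution_on_law in \<open>simp add: distribution_on_def\<close>)

sublocale S: prob_space "uniform_sphere :: 'a measure" by (rule prob_space_uniform_sphere)

sublocale ZS: pair_prob_space Z "uniform_sphere :: 'a measure" ..

abbreviation "s \<equiv> 1 / real m + 1 / real n"

lemma component_borel: "q < m + n \<Longrightarrow> (\<lambda>z. z q) \<in> borel_measurable Z"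
  using measurable_component_singleton[of q "{..<m + n}" P] measurable_cong_sets[OF refl sets_law] by auto

lemma sum_contrast_weight_square: "(\<Sum>q<m + n. (contrast_weight m n q)\<^sup>2) = s"
  using mn by (simp add: sum_pooled contrast_weight_def power2_eq_square)

lemma sum_balanced_weight: "(\<Sum>q<m + n. balanced_weight m n q) = 1"
  using mn by (simp add: sum_pooled balanced_weight_def)

lemma balanced_weight_bounds: "0 \<le> balanced_weight m n q" "balanced_weight m n q \<le> s / 2"
  by (simp_all add: balanced_weight_def field_simps)

definition D :: "'a \<Rightarrow> real \<Rightarrow> real" where "D b t = proj_cdf PX b t - proj_cdf PY b t"

lemma D_eq_sum: "D b t = (\<Sum>q<m + n. contrast_weight m n q * proj_cdf (law q) b t)"
  using mn by (simp add: D_def sum_pooled contrast_weight_def law_def)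

definition err :: "nat \<Rightarrow> (nat \<Rightarrow> 'a) \<Rightarrow> 'a \<Rightarrow> real" where
  "err p z b = ecdf_contrast m n (\<lambda>q. b \<bullet> z q) (b \<bullet> z p) - D b (b \<bullet> z p)"

definition \<xi> :: "nat \<Rightarrow> nat \<Rightarrow> (nat \<Rightarrow> 'a) \<Rightarrow> 'a \<Rightarrow> real" where
  "\<xi> p q z b = of_bool (b \<bullet> z q \<le> b \<bullet> z p) - proj_cdf (law q) b (b \<bullet> z p)"

lemma err_eq: "err p z b = (\<Sum>q<m + n. contrast_weight m n q * \<xi> p q z b)"
  by (simp add: err_def D_eq_sum ecdf_contrast_def \<xi>_def sum_subtractf right_diff_distrib)

lemma \<xi>_le: "\<bar>\<xi> p q z b\<bar> \<le> 1"
  using proj_cdf_bounds[OF distribution_on_law, of q b "b \<bullet> z p"] by (auto simp: \<xi>_def)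

lemma measurable_\<xi>:
  assumes "p < m + n" "q < m + n" "g \<in> borel_measurable M" "f \<in> measurable M Z"
  shows "(\<lambda>x. \<xi> p q (f x) (g x)) \<in> borel_measurable M"
proof -
  have [measurable]: "(\<lambda>x. f x p) \<in> borel_measurable M" "(\<lambda>x. f x q) \<in> borel_measurable M"
    using measurable_compose[OF assms(4) component_borel] assms(1,2) by auto
  note [measurable] = assms(3)
  show ?thesis unfolding \<xi>_def by (intro borel_measurable_diff measurable_proj_cdf distribution_on_law) simp_all
qed

lemma integrable_\<xi>_prod:
  assumes "p < m + n" "q < m + n" "q' < m + n"
  shows "integrable Z (\<lambda>z. \<xi> p q z b * \<xi> p q' z b)"
proof (rule Z.integrable_bounded[where B = 1])
  show "(\<lambda>z. \<xi> p q z b * \<xi> p q' z b) \<in> borel_measurable Z"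
    by (intro borel_measurable_times measurable_\<xi> assms) simp_all
  show "\<bar>\<xi> p q z b * \<xi> p q' z b\<bar> \<le> 1" for z
    unfolding abs_mult by (intro mult_le_one \<xi>_le) simp
qed

text \<open>One of two distinct indices differs from \<open>p\<close>, and integrating out that
  coordinate first annihilates the product. The other index may be \<open>p\<close> itself, whose
  term is not centred.\<close>

lemma \<xi>_orthogonal:
  assumes "p < m + n" "q < m + n" "q' < m + n" "q \<noteq> q'"
  shows "(\<integral>z. \<xi> p q z b * \<xi> p q' z b \<partial>Z) = 0"
proof -
  have *: "(\<integral>z. \<xi> p q z b * \<xi> p q' z b \<partial>Z) = 0"
    if "p < m + n" "q < m + n" "q' < m + n" "q \<noteq> q'" "q \<noteq> p" for q q'
  proof (rule integral_PiM_eq_0_if_coordinate[where k = q])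
    fix z
    interpret Pq: prob_space "law q" using distribution_on_law by (simp add: distribution_on_def)
    have "(\<integral>y. of_bool (b \<bullet> y \<le> b \<bullet> z p) - proj_cdf (law q) b (b \<bullet> z p) \<partial>law q) = 0"
    proof -
      have "(\<integral>y. of_bool (b \<bullet> y \<le> b \<bullet> z p) \<partial>law q) = (\<integral>y. indicator {y. b \<bullet> y \<le> b \<bullet> z p} y \<partial>law q :: real)"
        by (intro Bochner_Integration.integral_cong) (auto simp: indicator_def)
      moreover have "integrable (law q) (\<lambda>y. of_bool (b \<bullet> y \<le> b \<bullet> z p) :: real)"
        by (rule Pq.integrable_bounded[where B = 1]) auto
      ultimately show ?thesis using Pq.prob_space by (simp add: proj_cdf_def)
    qed
    then show "(\<integral>y. \<xi> p q (z(q := y)) b * \<xi> p q' (z(q := y)) b \<partial>law q) = 0"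
      using that by (simp add: \<xi>_def)
  qed (use that integrable_\<xi>_prod in auto)
  show ?thesis
  proof (cases "q = p")
    case True
    then show ?thesis using *[of q' q] assms by (simp add: mult.commute)
  qed (use * assms in auto)
qed

text \<open>Only the diagonal terms survive, and each is bounded by 1, so the bound holds for all
  pairs of distributions and thereby uniformly over contaminations.\<close>

lemma expectation_err_square_le:
  assumes "p < m + n"
  shows "(\<integral>z. (err p z b)\<^sup>2 \<partial>Z) \<le> s"
proof -
  have "(\<integral>z. (err p z b)\<^sup>2 \<partial>Z) =
      (\<integral>z. (\<Sum>q<m + n. \<Sum>q'<m + n. contrast_weight m n q * contrast_weight m n q' * (\<xi> p q z b * \<xi> p q' z b)) \<partial>Z)"
    by (simp add: err_eq power2_eq_square sum_product mult_ac)
  also have "\<dots> = (\<Sum>q<m + n. \<Sum>q'<m + n. contrast_weight m n q * contrast_weight m n q' * (\<integral>z. \<xi> p q z b * \<xi> p q' z b \<partial>Z))"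
    using assms by (intro integral_double_sum integrable_\<xi>_prod) auto
  also have "\<dots> = (\<Sum>q<m + n. \<Sum>q'<m + n. if q = q' then contrast_weight m n q * contrast_weight m n q * (\<integral>z. \<xi> p q z b * \<xi> p q z b \<partial>Z) else 0)"
    using assms by (intro sum.cong refl) (auto simp: \<xi>_orthogonal)
  also have "\<dots> = (\<Sum>q<m + n. (contrast_weight m n q)\<^sup>2 * (\<integral>z. \<xi> p q z b * \<xi> p q z b \<partial>Z))"
    by (simp add: power2_eq_square)
  also have "\<dots> \<le> (\<Sum>q<m + n. (contrast_weight m n q)\<^sup>2 * 1)"
  proof (intro sum_mono mult_left_mono)
    fix q assume "q \<in> {..<m + n}"
    have "\<xi> p q z b * \<xi> p q z b \<le> 1" for z
      using \<xi>_le[of p q z b] by (metis abs_le_square_iff abs_one one_power2 power2_eq_square)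
    then have "(\<integral>z. \<xi> p q z b * \<xi> p q z b \<partial>Z) \<le> (\<integral>z. 1 \<partial>Z)"
      using assms \<open>q \<in> {..<m + n}\<close> by (intro integral_mono integrable_\<xi>_prod) auto
    then show "(\<integral>z. \<xi> p q z b * \<xi> p q z b \<partial>Z) \<le> 1" using Z.prob_space by simp
  qed simp
  finally show ?thesis by (simp add: sum_contrast_weight_square)
qed

text \<open>A law of large numbers in mean square: cross terms vanish by independence, and the
  squared weights sum to at most the largest weight, since the weights sum to 1.\<close>

lemma expectation_weighted_mean_square_le:
  fixes \<omega> :: "'a \<Rightarrow> real"
  assumes [measurable]: "\<omega> \<in> borel_measurable borel" and \<omega>: "\<And>x. 0 \<le> \<omega> x" "\<And>x. \<omega> x \<le> 1"
  shows "(\<integral>z. (\<Sum>p<m + n. balanced_weight m n p * (\<omega> (z p) - (\<integral>x. \<omega> x \<partial>law p)))\<^sup>2 \<partial>Z) \<le> s"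
proof -
  define g where "g p x = \<omega> x - (\<integral>x. \<omega> x \<partial>law p)" for p x
  have int: "integrable (law p) \<omega>" for p
  proof -
    interpret Pp: prob_space "law p" using distribution_on_law by (simp add: distribution_on_def)
    show ?thesis by (rule Pp.integrable_bounded[where B = 1]) (use \<omega> in \<open>auto simp: abs_le_iff intro: order_trans[OF _ \<omega>(1)]\<close>)
  qed
  have E: "0 \<le> (\<integral>x. \<omega> x \<partial>law p)" "(\<integral>x. \<omega> x \<partial>law p) \<le> 1" for p
  proof -
    interpret Pp: prob_space "law p" using distribution_on_law by (simp add: distribution_on_def)
    show "0 \<le> (\<integral>x. \<omega> x \<partial>law p)" by (simp add: \<omega>)
    have "(\<integral>x. \<omega> x \<partial>law p) \<le> (\<integral>x. 1 \<partial>law p)" by (intro integral_mono int) (use \<omega> in auto)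
    then show "(\<integral>x. \<omega> x \<partial>law p) \<le> 1" using Pp.prob_space by simp
  qed
  have g_le: "\<bar>g p x\<bar> \<le> 1" for p x using \<omega>(1,2)[of x] E[of p] by (auto simp: g_def)
  have g0: "(\<integral>x. g p x \<partial>law p) = 0" for p
  proof -
    interpret Pp: prob_space "law p" using distribution_on_law by (simp add: distribution_on_def)
    show ?thesis using Pp.prob_space by (simp add: g_def int)
  qed
  have gm: "(\<lambda>z. g p (z p)) \<in> borel_measurable Z" if "p < m + n" for p
    unfolding g_def using component_borel[OF that] by simp
  have gint: "integrable Z (\<lambda>z. g p (z p) * g q (z q))" if "p < m + n" "q < m + n" for p q
    by (rule Z.integrable_bounded[where B = 1])
      (auto intro!: borel_measurable_times gm that simp: abs_mult mult_le_one g_le)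
  have orth: "(\<integral>z. g p (z p) * g q (z q) \<partial>Z) = 0" if "p < m + n" "q < m + n" "p \<noteq> q" for p q
    by (rule integral_PiM_eq_0_if_coordinate[where k = p]) (use that gint g0 in auto)
  let ?v = "balanced_weight m n"
  have "(\<integral>z. (\<Sum>p<m + n. ?v p * g p (z p))\<^sup>2 \<partial>Z) =
      (\<integral>z. (\<Sum>q<m + n. \<Sum>q'<m + n. ?v q * ?v q' * (g q (z q) * g q' (z q'))) \<partial>Z)"
    by (simp add: power2_eq_square sum_product mult_ac)
  also have "\<dots> = (\<Sum>q<m + n. \<Sum>q'<m + n. ?v q * ?v q' * (\<integral>z. g q (z q) * g q' (z q') \<partial>Z))"
    by (intro integral_double_sum gint) auto
  also have "\<dots> = (\<Sum>q<m + n. \<Sum>q'<m + n. if q = q' then ?v q * ?v q * (\<integral>z. g q (z q) * g q (z q) \<partial>Z) else 0)"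
    by (intro sum.cong refl) (auto simp: orth)
  also have "\<dots> = (\<Sum>q<m + n. ?v q * (?v q * (\<integral>z. g q (z q) * g q (z q) \<partial>Z)))"
    by (simp add: mult.assoc)
  also have "\<dots> \<le> (\<Sum>q<m + n. ?v q * s)"
  proof (intro sum_mono mult_left_mono)
    fix q assume q: "q \<in> {..<m + n}"
    have "g q x * g q x \<le> 1" for x
      using g_le[of q x] by (metis abs_le_square_iff abs_one one_power2 power2_eq_square)
    then have "(\<integral>z. g q (z q) * g q (z q) \<partial>Z) \<le> (\<integral>z. 1 \<partial>Z)"
      using q by (intro integral_mono gint) auto
    then have "(\<integral>z. g q (z q) * g q (z q) \<partial>Z) \<le> 1" using Z.prob_space by simp
    then have "?v q * (\<integral>z. g q (z q) * g q (z q) \<partial>Z) \<le> ?v q * 1"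
      by (intro mult_left_mono balanced_weight_bounds)
    also have "\<dots> \<le> s" using balanced_weight_bounds[of q] by simp
    finally show "?v q * (\<integral>z. g q (z q) * g q (z q) \<partial>Z) \<le> s" .
  qed (rule balanced_weight_bounds)
  also have "\<dots> = s" by (simp only: sum_distrib_right[symmetric] sum_balanced_weight mult_1)
  finally show ?thesis by (simp add: g_def)
qed

end

text \<open>Clamping the cosine to \<open>{-1..1}\<close>, which changes nothing by the
  Cauchy-Schwarz inequality, makes \<open>arccos\<close> continuous on the whole line.\<close>

lemma measurable_Ang [measurable]:
  assumes [measurable]: "f \<in> borel_measurable M" "g \<in> borel_measurable M"
  shows "(\<lambda>x. Ang (f x) (g x :: 'a::euclidean_space)) \<in> borel_measurable M"
proof -
  have "continuous_on UNIV (\<lambda>x::real. arccos (max (- 1) (min 1 x)))"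
    by (intro continuous_intros) auto
  then have [measurable]: "(\<lambda>x::real. arccos (max (- 1) (min 1 x))) \<in> borel_measurable borel"
    by (rule borel_measurable_continuous_onI)
  have "Ang u v = arccos (max (- 1) (min 1 ((u \<bullet> v) / (norm u * norm v))))" for u v :: 'a
  proof -
    define q where "q = (u \<bullet> v) / (norm u * norm v)"
    have "\<bar>q\<bar> \<le> 1"
    proof (cases "norm u * norm v = 0")
      case False
      then have "0 < norm u * norm v" by simp
      then show ?thesis using Cauchy_Schwarz_ineq2[of u v] by (simp add: q_def abs_divide abs_mult pos_divide_le_eq)
    qed (auto simp: q_def)
    then have "max (- 1) (min 1 q) = q" by (simp add: abs_le_iff)
    then show ?thesis by (simp add: Ang_def q_def)
  qed
  then show ?thesis by simp
qed

lemma measurable_pooled_U_CvM: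
  fixes f :: "'b \<Rightarrow> nat \<Rightarrow> 'a::euclidean_space"
  assumes "\<And>q. q < m + n \<Longrightarrow> (\<lambda>x. f x q) \<in> borel_measurable M"
  shows "(\<lambda>x. pooled U_CvM m n (f x)) \<in> borel_measurable M"
  unfolding pooled_def U_CvM_def h_CvM_def
  by (intro borel_measurable_times borel_measurable_sum borel_measurable_diff borel_measurable_const
      measurable_Ang assms) auto

lemma measurable_pooled_U_Energy:
  fixes f :: "'b \<Rightarrow> nat \<Rightarrow> 'a::euclidean_space"
  assumes "\<And>q. q < m + n \<Longrightarrow> (\<lambda>x. f x q) \<in> borel_measurable M"
  shows "(\<lambda>x. pooled U_Energy m n (f x)) \<in> borel_measurable M"
  unfolding pooled_def U_Energy_def
  by (intro borel_measurable_times borel_measurable_sum borel_measurable_diff borel_measurable_const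
      borel_measurable_norm[THEN measurable_compose[rotated]] assms) auto

lemma measurable_perm_test:
  assumes \<alpha>: "0 < \<alpha>" "\<alpha> < 1"
    and meas: "\<And>\<pi>. \<pi> permutes {..<m + n} \<Longrightarrow> (\<lambda>x. pooled T m n (f x \<circ> \<pi>)) \<in> borel_measurable M"
  shows "(\<lambda>x. perm_test T \<alpha> m n (f x)) \<in> borel_measurable M"
proof -
  have m0: "(\<lambda>x. pooled T m n (f x)) \<in> borel_measurable M" using meas[OF permutes_id] by simp
  have "real (card {\<pi>. \<pi> permutes {..<m + n} \<and> pooled T m n (f x \<circ> \<pi>) < pooled T m n (f x)}) =
      (\<Sum>\<pi> | \<pi> permutes {..<m + n}. of_bool (pooled T m n (f x \<circ> \<pi>) < pooled T m n (f x)))" for x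
    by (simp add: finite_permutations Int_def)
  moreover have "(\<lambda>x. (\<Sum>\<pi> | \<pi> permutes {..<m + n}. of_bool (pooled T m n (f x \<circ> \<pi>) < pooled T m n (f x))) :: real)
      \<in> borel_measurable M"
  proof (rule borel_measurable_sum)
    fix \<pi> assume "\<pi> \<in> {\<pi>. \<pi> permutes {..<m + n}}"
    then have [measurable]: "(\<lambda>x. pooled T m n (f x \<circ> \<pi>)) \<in> borel_measurable M" "(\<lambda>x. pooled T m n (f x)) \<in> borel_measurable M"
      using meas m0 by auto
    show "(\<lambda>x. of_bool (pooled T m n (f x \<circ> \<pi>) < pooled T m n (f x)) :: real) \<in> borel_measurable M" by measurable
  qed
  ultimately have [measurable]: "(\<lambda>x. real (card {\<pi>. \<pi> permutes {..<m + n} \<and> pooled T m n (f x \<circ> \<pi>) < pooled T m n (f x)}))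
      \<in> borel_measurable M" by simp
  show ?thesis unfolding perm_test_eq[OF \<alpha>] by measurable
qed

section \<open>The Cramer-von Mises distance of relabelled samples\<close>

lemma ecdf_contrast_le: "\<bar>ecdf_contrast m n t u\<bar> \<le> 1"
proof -
  have mean: "0 \<le> (\<Sum>i<k. 1 / real k * of_bool (Q i)) \<and> (\<Sum>i<k. 1 / real k * of_bool (Q i)) \<le> 1" for k Q
  proof -
    have "(\<Sum>i<k. 1 / real k * of_bool (Q i)) \<le> (\<Sum>i<k. 1 / real k)" by (intro sum_mono) auto
    also have "\<dots> \<le> 1" by simp
    finally show ?thesis by (auto intro!: sum_nonneg)
  qed
  have "ecdf_contrast m n t u = (\<Sum>i<m. 1 / real m * of_bool (t i \<le> u)) - (\<Sum>j<n. 1 / real n * of_bool (t (m + j) \<le> u))"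
    by (simp add: ecdf_contrast_def sum_pooled contrast_weight_def sum_negf del: sum_of_bool_eq sum_of_bool_mult_eq sum_mult_of_bool_eq)
  then show ?thesis using mean[of m "\<lambda>i. t i \<le> u"] mean[of n "\<lambda>j. t (m + j) \<le> u"] by linarith
qed

lemma CvM_distance_bounds:
  assumes "2 \<le> m" "2 \<le> n"
  shows "0 \<le> CvM_distance m n t" "CvM_distance m n t \<le> 1"
proof -
  show "0 \<le> CvM_distance m n t" by (auto simp: CvM_distance_def balanced_weight_def intro!: sum_nonneg)
  have "CvM_distance m n t \<le> (\<Sum>p<m + n. balanced_weight m n p * 1)"
    unfolding CvM_distance_def
    by (intro sum_mono mult_left_mono) (use ecdf_contrast_le in \<open>auto simp: abs_square_le_1 balanced_weight_def\<close>)
  also have "\<dots> = 1" using assms by (simp add: sum_pooled balanced_weight_def)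
  finally show "CvM_distance m n t \<le> 1" .
qed

lemma measurable_CvM_distance:
  fixes z :: "'b \<Rightarrow> nat \<Rightarrow> real"
  assumes "\<And>q. q < m + n \<Longrightarrow> (\<lambda>x. z x q) \<in> borel_measurable M"
  shows "(\<lambda>x. CvM_distance m n (z x)) \<in> borel_measurable M"
  unfolding CvM_distance_def ecdf_contrast_def
proof (intro borel_measurable_times borel_measurable_sum borel_measurable_power borel_measurable_const)
  fix p q assume "p \<in> {..<m + n}" "q \<in> {..<m + n}"
  then have [measurable]: "(\<lambda>x. z x p) \<in> borel_measurable M" "(\<lambda>x. z x q) \<in> borel_measurable M" using assms by auto
  show "(\<lambda>x. of_bool (z x q \<le> z x p) :: real) \<in> borel_measurable M" by measurable
qed

text \<open>The relabelled contrast is evaluated at the pooled values in another order. Bounding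
  every balanced weight by \<open>s / 2\<close> frees these points from the relabelling, and at each
  fixed level the contrast is a linear permutation statistic with weights of sum zero.\<close>

lemma sum_permutes_CvM_distance_le:
  assumes mn: "2 \<le> m" "2 \<le> n"
  defines "s \<equiv> 1 / real m + 1 / real n"
  shows "(\<Sum>\<pi> | \<pi> permutes {..<m + n}. CvM_distance m n (t \<circ> \<pi>)) \<le> fact (m + n) * (real (m + n) * s\<^sup>2 / 2)"
proof -
  let ?PP = "{\<pi>. \<pi> permutes {..<m + n}}"
  have s: "0 \<le> s" by (simp add: s_def)
  have v: "0 \<le> balanced_weight m n p" "balanced_weight m n p \<le> s / 2" for p
    by (simp_all add: balanced_weight_def s_def field_simps)
  have 1: "CvM_distance m n (t \<circ> \<pi>) \<le> s / 2 * (\<Sum>k<m + n. (ecdf_contrast m n (t \<circ> \<pi>) (t k))\<^sup>2)"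
    if "\<pi> permutes {..<m + n}" for \<pi>
  proof -
    have "CvM_distance m n (t \<circ> \<pi>) \<le> (\<Sum>p<m + n. s / 2 * (ecdf_contrast m n (t \<circ> \<pi>) ((t \<circ> \<pi>) p))\<^sup>2)"
      unfolding CvM_distance_def by (intro sum_mono mult_right_mono v) simp
    also have "\<dots> = s / 2 * (\<Sum>k<m + n. (ecdf_contrast m n (t \<circ> \<pi>) (t k))\<^sup>2)"
      using sum.permute[OF that, of "\<lambda>k. (ecdf_contrast m n (t \<circ> \<pi>) (t k))\<^sup>2"] by (simp add: sum_distrib_left o_def)
    finally show ?thesis .
  qed
  have "(\<Sum>\<pi>\<in>?PP. CvM_distance m n (t \<circ> \<pi>)) \<le> (\<Sum>\<pi>\<in>?PP. s / 2 * (\<Sum>k<m + n. (ecdf_contrast m n (t \<circ> \<pi>) (t k))\<^sup>2))"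
    by (intro sum_mono 1) simp
  also have "\<dots> = s / 2 * (\<Sum>k<m + n. \<Sum>\<pi>\<in>?PP. (ecdf_contrast m n (t \<circ> \<pi>) (t k))\<^sup>2)"
    by (subst sum.swap) (simp add: sum_distrib_left)
  also have "\<dots> \<le> s / 2 * (\<Sum>k<m + n. fact (m + n) * s)"
  proof (intro mult_left_mono sum_mono)
    fix k
    have "(\<Sum>p<m + n. (contrast_weight m n p)\<^sup>2) = s" "(\<Sum>p<m + n. contrast_weight m n p) = 0"
      using mn by (simp_all add: sum_pooled contrast_weight_def power2_eq_square s_def)
    then show "(\<Sum>\<pi>\<in>?PP. (ecdf_contrast m n (t \<circ> \<pi>) (t k))\<^sup>2) \<le> fact (m + n) * s"
      using permutation_second_moment_le[of "{..<m + n}" "\<lambda>j. of_bool (t j \<le> t k)" "contrast_weight m n"]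
      by (simp add: ecdf_contrast_def)
  qed (use s in simp)
  also have "\<dots> = fact (m + n) * (real (m + n) * s\<^sup>2 / 2)" by (simp add: power2_eq_square)
  finally show ?thesis .
qed

text \<open>Distinct points have distinct projections in almost every direction, so the
  deterministic comparison of rank statistics holds there and may be integrated.\<close>

lemma pooled_U_CvM_approx:
  fixes z :: "nat \<Rightarrow> 'a::euclidean_space"
  assumes mn: "2 \<le> m" "2 \<le> n" and inj: "inj_on z {..<m + n}"
  shows "\<bar>pooled U_CvM m n z - (\<integral>b. CvM_distance m n (\<lambda>p. b \<bullet> z p) \<partial>uniform_sphere)\<bar> \<le> 2 * (1 / real m + 1 / real n)"
proof -
  interpret S: prob_space "uniform_sphere :: 'a measure" by (rule prob_space_uniform_sphere)
  let ?R = "\<lambda>b. rank_statistic m n (\<lambda>i. b \<bullet> z i) (\<lambda>j. b \<bullet> z (m + j))"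
  let ?V = "\<lambda>b. CvM_distance m n (\<lambda>p. b \<bullet> z p)"
  have U: "pooled U_CvM m n z = (\<integral>b. ?R b \<partial>uniform_sphere)"
    unfolding pooled_def
  proof (rule U_CvM_eq_integral_rank_statistic)
    fix i j assume "i < m" "j < n"
    then show "z i \<noteq> z (m + j)" using inj_onD[OF inj, of i "m + j"] by auto
  qed
  have iK: "integrable uniform_sphere (\<lambda>b. rank_kernel (b \<bullet> x1) (b \<bullet> x2) (b \<bullet> y1) (b \<bullet> y2))" for x1 x2 y1 y2 :: 'a
    by (rule S.integrable_bounded[where B = 2]) (auto simp: rank_kernel_def)
  have iR: "integrable uniform_sphere ?R"
    unfolding rank_statistic_def by (intro integrable_mult_right Bochner_Integration.integrable_sum iK)
  have iV: "integrable uniform_sphere ?V"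
  proof (rule S.integrable_bounded[where B = 1])
    show "?V \<in> borel_measurable uniform_sphere" by (rule measurable_CvM_distance) simp
    show "\<bar>?V b\<bar> \<le> 1" for b using CvM_distance_bounds[OF mn, of "\<lambda>p. b \<bullet> z p"] by simp
  qed
  have "AE b in uniform_sphere. \<forall>p\<in>{..<m + n}. \<forall>q\<in>{..<m + n}. p \<noteq> q \<longrightarrow> b \<bullet> (z p - z q) \<noteq> 0"
  proof (intro AE_finite_allI finite_lessThan)
    fix p q assume "p \<in> {..<m + n}" "q \<in> {..<m + n}"
    then show "AE b in uniform_sphere. p \<noteq> q \<longrightarrow> b \<bullet> (z p - z q) \<noteq> 0"
      using AE_uniform_sphere_inner_nonzero[of "z p - z q"] inj_onD[OF inj, of p q]
      by (cases "p = q") auto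
  qed
  then have ae: "AE b in uniform_sphere. \<bar>?R b - ?V b\<bar> \<le> 2 * (1 / real m + 1 / real n)"
  proof eventually_elim
    case (elim b)
    then have "inj_on (\<lambda>p. b \<bullet> z p) {..<m + n}" by (auto simp: inj_on_def inner_diff_right)
    then show ?case using rank_statistic_approx[OF mn] by simp
  qed
  have "\<bar>(\<integral>b. ?R b \<partial>uniform_sphere) - (\<integral>b. ?V b \<partial>uniform_sphere)\<bar> = \<bar>\<integral>b. ?R b - ?V b \<partial>uniform_sphere\<bar>"
    using iR iV by simp
  also have "\<dots> \<le> (\<integral>b. \<bar>?R b - ?V b\<bar> \<partial>uniform_sphere)" by (rule integral_abs_bound)
  also have "\<dots> \<le> (\<integral>b. 2 * (1 / real m + 1 / real n) \<partial>(uniform_sphere :: 'a measure))"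
    using iR iV ae by (intro integral_mono_AE) auto
  also have "\<dots> = 2 * (1 / real m + 1 / real n)" using S.prob_space by simp
  finally show ?thesis unfolding U .
qed

text \<open>Markov's inequality for the permutation distribution. It needs a nonnegative variable
  and is therefore applied to the averaged distance, at the price of lowering the threshold by the
  approximation error \<open>2 * s\<close>.\<close>

lemma card_permutations_U_CvM_ge:
  fixes z :: "nat \<Rightarrow> 'a::euclidean_space"
  assumes mn: "2 \<le> m" "2 \<le> n" and inj: "inj_on z {..<m + n}"
  defines "s \<equiv> 1 / real m + 1 / real n"
  assumes c: "2 * s \<le> c"
  shows "real (card {\<pi>. \<pi> permutes {..<m + n} \<and> c \<le> pooled U_CvM m n (z \<circ> \<pi>)}) * (c - 2 * s)
    \<le> fact (m + n) * (real (m + n) * s\<^sup>2 / 2)"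
proof -
  interpret S: prob_space "uniform_sphere :: 'a measure" by (rule prob_space_uniform_sphere)
  let ?PP = "{\<pi>. \<pi> permutes {..<m + n}}"
  let ?V = "\<lambda>\<pi>. \<integral>b. CvM_distance m n (\<lambda>p. b \<bullet> z (\<pi> p)) \<partial>uniform_sphere"
  let ?A = "{\<pi>. \<pi> permutes {..<m + n} \<and> c \<le> pooled U_CvM m n (z \<circ> \<pi>)}"
  have fin: "finite ?PP" by (rule finite_permutations) simp
  have iV: "integrable uniform_sphere (\<lambda>b. CvM_distance m n (\<lambda>p. b \<bullet> z (\<pi> p)))" for \<pi>
  proof (rule S.integrable_bounded[where B = 1])
    show "(\<lambda>b. CvM_distance m n (\<lambda>p. b \<bullet> z (\<pi> p))) \<in> borel_measurable uniform_sphere"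
      by (rule measurable_CvM_distance) simp
    show "\<bar>CvM_distance m n (\<lambda>p. b \<bullet> z (\<pi> p))\<bar> \<le> 1" for b
      using CvM_distance_bounds[OF mn, of "\<lambda>p. b \<bullet> z (\<pi> p)"] by simp
  qed
  have Vnn: "0 \<le> ?V \<pi>" for \<pi> by (rule integral_nonneg_AE) (simp add: CvM_distance_bounds mn)
  have le: "c - 2 * s \<le> ?V \<pi>" if "\<pi> \<in> ?A" for \<pi>
  proof -
    have \<pi>: "\<pi> permutes {..<m + n}" using that by simp
    have "inj_on (z \<circ> \<pi>) {..<m + n}"
      using inj permutes_inj_on[OF \<pi>] permutes_image[OF \<pi>] by (intro comp_inj_on) auto
    from pooled_U_CvM_approx[OF mn this]
    have "\<bar>pooled U_CvM m n (z \<circ> \<pi>) - ?V \<pi>\<bar> \<le> 2 * s" by (simp add: s_def)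
    moreover have "c \<le> pooled U_CvM m n (z \<circ> \<pi>)" using that by simp
    ultimately show ?thesis by linarith
  qed
  have "real (card ?A) * (c - 2 * s) = (\<Sum>\<pi>\<in>?A. c - 2 * s)" by simp
  also have "\<dots> \<le> (\<Sum>\<pi>\<in>?A. ?V \<pi>)" by (intro sum_mono le)
  also have "\<dots> \<le> (\<Sum>\<pi>\<in>?PP. ?V \<pi>)" using fin by (intro sum_mono2) (auto simp: Vnn)
  also have "\<dots> = (\<integral>b. (\<Sum>\<pi>\<in>?PP. CvM_distance m n (\<lambda>p. b \<bullet> z (\<pi> p))) \<partial>uniform_sphere)"
    by (rule Bochner_Integration.integral_sum[symmetric]) (rule iV)
  also have "\<dots> \<le> (\<integral>b. fact (m + n) * (real (m + n) * s\<^sup>2 / 2) \<partial>(uniform_sphere :: 'a measure))"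
  proof (intro integral_mono Bochner_Integration.integrable_sum iV)
    fix b :: 'a
    show "(\<Sum>\<pi>\<in>?PP. CvM_distance m n (\<lambda>p. b \<bullet> z (\<pi> p))) \<le> fact (m + n) * (real (m + n) * s\<^sup>2 / 2)"
      using sum_permutes_CvM_distance_le[OF mn, of "\<lambda>p. b \<bullet> z p"] by (simp add: s_def o_def)
  qed simp
  also have "\<dots> = fact (m + n) * (real (m + n) * s\<^sup>2 / 2)" using S.prob_space by simp
  finally show ?thesis .
qed

section \<open>A lower bound for the power of the Cramer-von Mises test\<close>

context two_samples
begin

text \<open>A single direction with continuous projections is enough: equal observations would have
  equal projections, and given one observation the other hits a prescribed projection with
  probability 0.\<close>

lemma AE_distinct:
  assumes "continuous_projections PX" "continuous_projections PY"
  shows "AE z in Z. inj_on z {..<m + n}"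
proof -
  have "AE b in (uniform_sphere :: 'a measure). continuous_on UNIV (cdf (distr PX borel (\<lambda>x. b \<bullet> x))) \<and>
      continuous_on UNIV (cdf (distr PY borel (\<lambda>x. b \<bullet> x)))"
    using assms unfolding continuous_projections_def by eventually_elim simp
  from eventually_happens'[OF S.ae_filter_bot this]
  obtain b :: 'a where "continuous_on UNIV (cdf (distr PX borel (\<lambda>x. b \<bullet> x)))"
    "continuous_on UNIV (cdf (distr PY borel (\<lambda>x. b \<bullet> x)))" by auto
  then have cont: "continuous_on UNIV (cdf (distr (law q) borel (\<lambda>x. b \<bullet> x)))" for q by (simp add: law_def)
  have null: "measure (law q) {x. b \<bullet> x = c} = 0" for q c
  proof -
    interpret R: real_distribution "distr (law q) borel (\<lambda>x. b \<bullet> x)"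
      by (rule real_distribution_distr_inner[OF distribution_on_law])
    have "measure (distr (law q) borel (\<lambda>x. b \<bullet> x)) {c} = 0"
      using cont R.isCont_cdf by (simp add: continuous_on_eq_continuous_at)
    then show ?thesis by (subst (asm) measure_distr) (simp_all add: vimage_def)
  qed
  have "AE z in Z. \<forall>p\<in>{..<m + n}. \<forall>q\<in>{..<m + n}. p \<noteq> q \<longrightarrow> z p \<noteq> z q"
  proof (intro AE_finite_allI finite_lessThan)
    fix p q assume pq: "p \<in> {..<m + n}" "q \<in> {..<m + n}"
    show "AE z in Z. p \<noteq> q \<longrightarrow> z p \<noteq> z q"
    proof (cases "p = q")
      case False
      have "(\<lambda>z. b \<bullet> z p) \<in> borel_measurable Z" "(\<lambda>z. b \<bullet> z q) \<in> borel_measurable Z"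
        using pq by (auto intro!: borel_measurable_inner component_borel)
      then have "Measurable.pred Z (\<lambda>z. b \<bullet> z p = b \<bullet> z q)" unfolding pred_def by (rule borel_measurable_eq)
      then have int: "integrable Z (\<lambda>z. of_bool (b \<bullet> z p = b \<bullet> z q) :: real)"
        by (intro Z.integrable_bounded[where B = 1]) auto
      have "(\<integral>z. of_bool (b \<bullet> z p = b \<bullet> z q) \<partial>Z) = (0::real)"
      proof (rule integral_PiM_eq_0_if_coordinate[where k = p])
        fix z
        have "(\<integral>y. of_bool (b \<bullet> y = b \<bullet> z q) \<partial>law p) = (\<integral>y. indicator {y. b \<bullet> y = b \<bullet> z q} y \<partial>law p :: real)"
          by (intro Bochner_Integration.integral_cong) (auto simp: indicator_def)
        then show "(\<integral>y. of_bool (b \<bullet> (z(p := y)) p = b \<bullet> (z(p := y)) q) \<partial>law p) = (0::real)"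
          using False null[of p "b \<bullet> z q"] by simp
      qed (use pq int in auto)
      then have "AE z in Z. of_bool (b \<bullet> z p = b \<bullet> z q) = (0::real)"
        by (subst (asm) integral_nonneg_eq_0_iff_AE[OF int]) auto
      then show ?thesis by eventually_elim auto
    qed simp
  qed
  then show ?thesis by eventually_elim (auto simp: inj_on_def)
qed

text \<open>\<open>W\<close> averages the population discrepancy over the observed points and
  \<open>V\<close> is the empirical distance. The population contrast \<open>D\<close> differs from
  the empirical one by \<open>err\<close>, hence \<open>W\<close> is at most
  \<open>2 * V + 2 * Err\<close>. Outside two unlikely events \<open>W\<close> is near its mean and
  \<open>Err\<close> is small, which keeps \<open>V\<close>, and then the statistic, above a fixed
  level.\<close>

lemma CvM_power_ge:
  assumes cont: "continuous_projections PX" "continuous_projections PY"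
    and \<alpha>: "0 < \<alpha>" "\<alpha> < 1" and \<delta>: "0 < \<delta>"
    and disc: "\<delta> \<le> ((\<integral>x. proj_discrepancy PX PY x \<partial>PX) + (\<integral>x. proj_discrepancy PX PY x \<partial>PY)) / 2"
    and s1: "2 * s \<le> \<delta> / 16" and s2: "real (m + n) * s\<^sup>2 / 2 \<le> \<alpha> * (\<delta> / 16)"
  shows "1 - 8 * s / \<delta> - 16 * s / \<delta>\<^sup>2 \<le> (\<integral>z. perm_test U_CvM \<alpha> m n z \<partial>Z)"
proof -
  let ?v = "balanced_weight m n"
  define \<omega> where "\<omega> = proj_discrepancy PX PY"
  have [measurable]: "\<omega> \<in> borel_measurable borel" unfolding \<omega>_def using PX PY by simp
  have \<omega>: "0 \<le> \<omega> x" "\<omega> x \<le> 1" for x unfolding \<omega>_def using proj_discrepancy_bounds PX PY by auto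
  define W where "W z = (\<Sum>p<m + n. ?v p * \<omega> (z p))" for z
  define EW where "EW = (\<Sum>p<m + n. ?v p * (\<integral>x. \<omega> x \<partial>law p))"
  define Err where "Err z = (\<integral>b. (\<Sum>p<m + n. ?v p * (err p z b)\<^sup>2) \<partial>uniform_sphere)" for z
  define V where "V z = (\<integral>b. CvM_distance m n (\<lambda>p. b \<bullet> z p) \<partial>uniform_sphere)" for z :: "nat \<Rightarrow> 'a"
  have EW: "\<delta> \<le> EW"
    using disc mn by (simp add: EW_def \<omega>_def sum_pooled balanced_weight_def law_def)
  have err_le: "(err p z b)\<^sup>2 \<le> 4" for p z b
  proof -
    have "\<bar>D b (b \<bullet> z p)\<bar> \<le> 1"
      using proj_cdf_bounds[OF PX, of b "b \<bullet> z p"] proj_cdf_bounds[OF PY, of b "b \<bullet> z p"] by (simp add: D_def)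
    then have "\<bar>err p z b\<bar> \<le> 2" using ecdf_contrast_le[of m n "\<lambda>q. b \<bullet> z q" "b \<bullet> z p"] unfolding err_def by linarith
    then show ?thesis using abs_le_square_iff[of "err p z b" 2] by simp
  qed
  have err_meas: "(\<lambda>x. err p (f x) (g x)) \<in> borel_measurable M"
    if "p < m + n" "f \<in> measurable M Z" "g \<in> borel_measurable M" for p f g and M :: "'c measure"
    unfolding err_eq using that by (intro borel_measurable_sum borel_measurable_times measurable_\<xi>) auto
  define e where "e z b = (\<Sum>p<m + n. ?v p * (err p z b)\<^sup>2)" for z b
  have e_bounds: "0 \<le> e z b" "e z b \<le> 4" for z b
  proof -
    show "0 \<le> e z b" unfolding e_def by (intro sum_nonneg mult_nonneg_nonneg balanced_weight_bounds) simp
    have "e z b \<le> (\<Sum>p<m + n. ?v p * 4)" unfolding e_def by (intro sum_mono mult_left_mono err_le balanced_weight_bounds)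
    also have "\<dots> = 4" by (simp only: sum_distrib_right[symmetric] sum_balanced_weight mult_1)
    finally show "e z b \<le> 4" .
  qed
  have int_e: "integrable (Z \<Otimes>\<^sub>M uniform_sphere) (\<lambda>(z, b). e z b)"
  proof (rule ZS.integrable_bounded[where B = 4])
    show "(\<lambda>(z, b). e z b) \<in> borel_measurable (Z \<Otimes>\<^sub>M uniform_sphere)"
      unfolding e_def split_beta' by (intro borel_measurable_sum borel_measurable_times borel_measurable_power err_meas) auto
    show "\<bar>case x of (z, b) \<Rightarrow> e z b\<bar> \<le> 4" for x using e_bounds by (auto simp: split_beta')
  qed
  have Err_int: "integrable Z Err" unfolding Err_def e_def[symmetric] by (rule ZS.integrable_fst[OF int_e])
  have Err_nn: "0 \<le> Err z" for z unfolding Err_def e_def[symmetric] using e_bounds by simp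
  have Err_E: "(\<integral>z. Err z \<partial>Z) \<le> s"
  proof -
    have "(\<integral>z. Err z \<partial>Z) = (\<integral>b. (\<integral>z. e z b \<partial>Z) \<partial>uniform_sphere)"
      unfolding Err_def e_def[symmetric] by (rule ZS.Fubini_integral[symmetric, OF int_e])
    also have "\<dots> \<le> (\<integral>b. s \<partial>(uniform_sphere :: 'a measure))"
    proof (rule integral_mono)
      show "integrable uniform_sphere (\<lambda>b. \<integral>z. e z b \<partial>Z)" by (rule ZS.integrable_snd[OF int_e])
      fix b :: 'a
      have ip: "integrable Z (\<lambda>z. (err p z b)\<^sup>2)" if "p < m + n" for p
        by (rule Z.integrable_bounded[where B = 4])
          (use that err_le in \<open>auto intro!: borel_measurable_power err_meas\<close>)
      have "(\<integral>z. e z b \<partial>Z) = (\<Sum>p<m + n. \<integral>z. ?v p * (err p z b)\<^sup>2 \<partial>Z)"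
        unfolding e_def by (rule Bochner_Integration.integral_sum) (use ip in auto)
      also have "\<dots> \<le> (\<Sum>p<m + n. ?v p * s)"
        by (simp del: times_divide_eq_right, intro sum_mono mult_left_mono expectation_err_square_le balanced_weight_bounds) simp
      also have "\<dots> = s" by (simp only: sum_distrib_right[symmetric] sum_balanced_weight mult_1)
      finally show "(\<integral>z. e z b \<partial>Z) \<le> s" .
    qed simp
    also have "\<dots> = s" using S.prob_space by simp
    finally show ?thesis .
  qed
  have W_meas [measurable]: "W \<in> borel_measurable Z"
    unfolding W_def by (intro borel_measurable_sum borel_measurable_times measurable_compose[OF component_borel]) auto
  have W_le: "W z \<le> 2 * V z + 2 * Err z" if z: "z \<in> space Z" for z
  proof -
    have iD: "integrable uniform_sphere (\<lambda>b. (D b (b \<bullet> z p))\<^sup>2)" for p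
      by (rule S.integrable_bounded[where B = 1])
        (use PX PY proj_cdf_diff_square_le[OF PX PY] in \<open>simp_all add: D_def\<close>)
    have ie: "integrable uniform_sphere (e z)"
    proof (rule S.integrable_bounded[where B = 4])
      show "e z \<in> borel_measurable uniform_sphere"
        unfolding e_def[abs_def] by (intro borel_measurable_sum borel_measurable_times borel_measurable_power err_meas) (use z in auto)
      show "\<bar>e z b\<bar> \<le> 4" for b using e_bounds[of z b] by simp
    qed
    have iV: "integrable uniform_sphere (\<lambda>b. CvM_distance m n (\<lambda>p. b \<bullet> z p))"
    proof (rule S.integrable_bounded[where B = 1])
      show "(\<lambda>b. CvM_distance m n (\<lambda>p. b \<bullet> z p)) \<in> borel_measurable uniform_sphere"
        by (rule measurable_CvM_distance) simp
      show "\<bar>CvM_distance m n (\<lambda>p. b \<bullet> z p)\<bar> \<le> 1" for b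
        using CvM_distance_bounds[OF mn, of "\<lambda>p. b \<bullet> z p"] by simp
    qed
    have "W z = (\<integral>b. (\<Sum>p<m + n. ?v p * (D b (b \<bullet> z p))\<^sup>2) \<partial>uniform_sphere)"
      unfolding W_def \<omega>_def proj_discrepancy_def D_def[symmetric] using iD by simp
    also have "\<dots> \<le> (\<integral>b. 2 * CvM_distance m n (\<lambda>p. b \<bullet> z p) + 2 * e z b \<partial>uniform_sphere)"
    proof (rule integral_mono)
      fix b
      have "?v p * (D b (b \<bullet> z p))\<^sup>2 \<le> 2 * (?v p * (ecdf_contrast m n (\<lambda>q. b \<bullet> z q) (b \<bullet> z p))\<^sup>2) + 2 * (?v p * (err p z b)\<^sup>2)" for p
      proof -
        have "(x - y)\<^sup>2 \<le> 2 * x\<^sup>2 + 2 * y\<^sup>2" for x y :: real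
          using zero_le_power2[of "x + y"] by (simp add: power2_eq_square algebra_simps)
        from this[of "ecdf_contrast m n (\<lambda>q. b \<bullet> z q) (b \<bullet> z p)" "err p z b"]
        have "(D b (b \<bullet> z p))\<^sup>2 \<le> 2 * (ecdf_contrast m n (\<lambda>q. b \<bullet> z q) (b \<bullet> z p))\<^sup>2 + 2 * (err p z b)\<^sup>2"
          by (simp add: err_def)
        from mult_left_mono[OF this balanced_weight_bounds(1)[of p]] show ?thesis by (simp add: algebra_simps)
      qed
      then show "(\<Sum>p<m + n. ?v p * (D b (b \<bullet> z p))\<^sup>2) \<le> 2 * CvM_distance m n (\<lambda>p. b \<bullet> z p) + 2 * e z b"
        unfolding CvM_distance_def e_def sum_distrib_left sum.distrib[symmetric] by (rule sum_mono)
    qed (use iD ie iV in simp_all)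
    also have "\<dots> = 2 * V z + 2 * Err z" using ie iV by (simp add: V_def Err_def e_def[abs_def])
    finally show ?thesis .
  qed
  \<comment> \<open>Outside \<open>A\<close> and \<open>B\<close> one has
    \<open>W > 3 * \<delta> / 4\<close> and \<open>Err < \<delta> / 8\<close>, hence
    \<open>V > \<delta> / 4\<close>; subtracting \<open>2 * s\<close>, which is at most
    \<open>\<delta> / 16\<close>, keeps the statistic above \<open>\<delta> / 8\<close>.\<close>
  define A where "A = {z \<in> space Z. Err z \<ge> \<delta> / 8}"
  define B where "B = {z \<in> space Z. (W z - EW)\<^sup>2 \<ge> (\<delta> / 4)\<^sup>2}"
  have sA: "A \<in> sets Z" unfolding A_def using Err_int by measurable
  have sB: "B \<in> sets Z" unfolding B_def by measurable
  have A: "measure Z A \<le> 8 * s / \<delta>"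
  proof -
    have "measure Z A \<le> (\<integral>z. Err z \<partial>Z) / (\<delta> / 8)"
      unfolding A_def by (rule integral_Markov_inequality_measure[OF Err_int, of "{}"]) (use \<delta> Err_nn in auto)
    also have "\<dots> \<le> s / (\<delta> / 8)" using Err_E \<delta> by (intro divide_right_mono) auto
    finally show ?thesis by (simp add: mult.commute)
  qed
  have B: "measure Z B \<le> 16 * s / \<delta>\<^sup>2"
  proof -
    have W_bd: "\<bar>(W z - EW)\<^sup>2\<bar> \<le> (1 + \<bar>EW\<bar>)\<^sup>2" for z
    proof -
      have "0 \<le> W z" unfolding W_def by (intro sum_nonneg mult_nonneg_nonneg balanced_weight_bounds \<omega>)
      moreover have "W z \<le> (\<Sum>p<m + n. ?v p * 1)" unfolding W_def by (intro sum_mono mult_left_mono balanced_weight_bounds \<omega>)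
      ultimately have "\<bar>W z - EW\<bar> \<le> \<bar>1 + \<bar>EW\<bar>\<bar>" by (simp add: sum_balanced_weight)
      then show ?thesis using abs_le_square_iff[of "W z - EW" "1 + \<bar>EW\<bar>"] by simp
    qed
    have Wint: "integrable Z (\<lambda>z. (W z - EW)\<^sup>2)"
      by (rule Z.integrable_bounded[where B = "(1 + \<bar>EW\<bar>)\<^sup>2"]) (use W_bd in auto)
    have "measure Z B \<le> (\<integral>z. (W z - EW)\<^sup>2 \<partial>Z) / (\<delta> / 4)\<^sup>2"
      unfolding B_def by (rule integral_Markov_inequality_measure[OF Wint, of "{}"]) (use \<delta> in auto)
    also have "(\<integral>z. (W z - EW)\<^sup>2 \<partial>Z) \<le> s"
      using expectation_weighted_mean_square_le[of \<omega>] \<omega>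
      by (simp add: W_def EW_def sum_subtractf right_diff_distrib)
    finally show ?thesis using \<delta> by (simp add: power_divide divide_right_mono mult.commute)
  qed
  have reject: "perm_test U_CvM \<alpha> m n z = 1" if z: "z \<in> space Z" "z \<notin> A" "z \<notin> B" and inj: "inj_on z {..<m + n}" for z
  proof -
    let ?U = "pooled U_CvM m n"
    have "Err z < \<delta> / 8" using z by (simp add: A_def)
    moreover have "\<bar>W z - EW\<bar> < \<delta> / 4"
      using z \<delta> abs_le_square_iff[of "\<delta> / 4" "W z - EW"] by (simp add: B_def)
    moreover have "V z - 2 * s \<le> ?U z" using pooled_U_CvM_approx[OF mn inj] by (simp add: V_def)
    ultimately have U: "\<delta> / 8 < ?U z" using W_le[OF z(1)] EW s1 \<delta> by linarith
    define PP where "PP = {\<pi>. \<pi> permutes {..<m + n}}"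
    have fin: "finite PP" unfolding PP_def by (rule finite_permutations) simp
    have cardPP: "card PP = fact (m + n)" unfolding PP_def by (rule card_permutations) auto
    \<comment> \<open>The threshold \<open>\<delta> / 8\<close> exceeds the approximation error by
      at least \<open>\<delta> / 16\<close>. So at most a fraction \<open>\<alpha>\<close> of the
      relabellings reach it, and all others fall strictly below the observed value.\<close>
    have "real (card {\<pi>\<in>PP. \<delta> / 8 \<le> ?U (z \<circ> \<pi>)}) * (\<delta> / 16) \<le> real (card {\<pi>\<in>PP. \<delta> / 8 \<le> ?U (z \<circ> \<pi>)}) * (\<delta> / 8 - 2 * s)"
      using s1 by (intro mult_left_mono) auto
    also have "\<dots> \<le> fact (m + n) * (real (m + n) * s\<^sup>2 / 2)"
      using card_permutations_U_CvM_ge[OF mn inj, of "\<delta> / 8"] s1 \<delta> by (simp add: PP_def)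
    also have "\<dots> \<le> fact (m + n) * (\<alpha> * (\<delta> / 16))" by (intro mult_left_mono s2) simp
    finally have "real (card {\<pi>\<in>PP. \<delta> / 8 \<le> ?U (z \<circ> \<pi>)}) \<le> fact (m + n) * \<alpha>" using \<delta> by (simp add: field_simps)
    moreover have "card PP \<le> card {\<pi>\<in>PP. \<delta> / 8 \<le> ?U (z \<circ> \<pi>)} + card {\<pi>\<in>PP. ?U (z \<circ> \<pi>) < ?U z}"
    proof -
      have "PP \<subseteq> {\<pi>\<in>PP. \<delta> / 8 \<le> ?U (z \<circ> \<pi>)} \<union> {\<pi>\<in>PP. ?U (z \<circ> \<pi>) < ?U z}" using U by auto
      then have "card PP \<le> card ({\<pi>\<in>PP. \<delta> / 8 \<le> ?U (z \<circ> \<pi>)} \<union> {\<pi>\<in>PP. ?U (z \<circ> \<pi>) < ?U z})"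
        using fin by (intro card_mono) auto
      also have "\<dots> \<le> card {\<pi>\<in>PP. \<delta> / 8 \<le> ?U (z \<circ> \<pi>)} + card {\<pi>\<in>PP. ?U (z \<circ> \<pi>) < ?U z}" by (rule card_Un_le)
      finally show ?thesis .
    qed
    then have "fact (m + n) \<le> real (card {\<pi>\<in>PP. \<delta> / 8 \<le> ?U (z \<circ> \<pi>)}) + real (card {\<pi>\<in>PP. ?U (z \<circ> \<pi>) < ?U z})"
      using of_nat_mono[of "card PP" "card {\<pi>\<in>PP. \<delta> / 8 \<le> ?U (z \<circ> \<pi>)} + card {\<pi>\<in>PP. ?U (z \<circ> \<pi>) < ?U z}", where 'a = real]
      by (simp add: cardPP)
    ultimately have "(1 - \<alpha>) * fact (m + n) \<le> real (card {\<pi>\<in>PP. ?U (z \<circ> \<pi>) < ?U z})"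
      by (simp add: algebra_simps)
    then show ?thesis by (simp add: perm_test_eq[OF \<alpha>] PP_def)
  qed
  have "1 - 8 * s / \<delta> - 16 * s / \<delta>\<^sup>2 \<le> 1 - measure Z (A \<union> B)"
    using A B measure_Un_le[OF sA sB] by linarith
  also have "\<dots> = measure Z (space Z - (A \<union> B))" using sA sB by (subst Z.prob_compl) auto
  also have "\<dots> = (\<integral>z. indicator (space Z - (A \<union> B)) z \<partial>Z)" using sA sB by simp
  also have "\<dots> \<le> (\<integral>z. perm_test U_CvM \<alpha> m n z \<partial>Z)"
  proof (rule integral_mono_AE)
    show "integrable Z (indicator (space Z - (A \<union> B)) :: _ \<Rightarrow> real)" using sA sB by (intro Z.integrable_const_bound[of _ 1]) auto
    have "(\<lambda>z. perm_test U_CvM \<alpha> m n z) \<in> borel_measurable Z"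
    proof (rule measurable_perm_test[OF \<alpha>], rule measurable_pooled_U_CvM)
      fix \<pi> q assume "\<pi> permutes {..<m + n}" "q < m + n"
      then have "\<pi> q < m + n" using permutes_in_image by fastforce
      then show "(\<lambda>z. (z \<circ> \<pi>) q) \<in> borel_measurable Z" by (simp add: component_borel)
    qed
    then show "integrable Z (\<lambda>z. perm_test U_CvM \<alpha> m n z)"
      by (rule Z.integrable_bounded[where B = 1]) (simp add: perm_test_def)
    show "AE z in Z. indicator (space Z - (A \<union> B)) z \<le> perm_test U_CvM \<alpha> m n z"
      using AE_distinct[OF cont] AE_space
      by eventually_elim (auto simp: indicator_def reject, auto simp: perm_test_def)
  qed
  finally show ?thesis .
qed

end

section \<open>The energy statistic of contamination flags\<close>

lemma abs_sum_le_card: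
  fixes f :: "'b \<Rightarrow> real"
  assumes "\<And>i. i \<in> A \<Longrightarrow> \<bar>f i\<bar> \<le> c"
  shows "\<bar>sum f A\<bar> \<le> real (card A) * c"
  using order_trans[OF sum_abs sum_bounded_above[of A "\<lambda>i. \<bar>f i\<bar>" c]] assms by simp

text \<open>The statistic is linear in the matrix of distances, with averaging weights of total size
  2 + 1 + 1. The comparison sample may live in another space because it will consist of real-valued
  flags.\<close>

lemma U_Energy_perturbation:
  fixes x y :: "nat \<Rightarrow> 'a::euclidean_space" and x' y' :: "nat \<Rightarrow> 'b::euclidean_space"
  assumes mn: "2 \<le> m" "2 \<le> n"
    and xy: "\<And>i j. i < m \<Longrightarrow> j < n \<Longrightarrow> \<bar>norm (x i - y j) - R * norm (x' i - y' j)\<bar> \<le> \<eta>"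
    and xx: "\<And>i j. i < m \<Longrightarrow> j < m \<Longrightarrow> \<bar>norm (x i - x j) - R * norm (x' i - x' j)\<bar> \<le> \<eta>"
    and yy: "\<And>i j. i < n \<Longrightarrow> j < n \<Longrightarrow> \<bar>norm (y i - y j) - R * norm (y' i - y' j)\<bar> \<le> \<eta>"
  shows "\<bar>U_Energy m n x y - R * U_Energy m n x' y'\<bar> \<le> 4 * \<eta>"
proof -
  define dxy where "dxy i j = norm (x i - y j) - R * norm (x' i - y' j)" for i j
  define dxx where "dxx i j = norm (x i - x j) - R * norm (x' i - x' j)" for i j
  define dyy where "dyy i j = norm (y i - y j) - R * norm (y' i - y' j)" for i j
  define S1 where "S1 = (\<Sum>i<m. \<Sum>j<n. dxy i j)"
  define S2 where "S2 = (\<Sum>i<m. \<Sum>j\<in>{..<m} - {i}. dxx i j)"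
  define S3 where "S3 = (\<Sum>i<n. \<Sum>j\<in>{..<n} - {i}. dyy i j)"
  have "U_Energy m n x y - R * U_Energy m n x' y' =
      2 / (real m * real n) * S1 - 1 / (real m * (real m - 1)) * S2 - 1 / (real n * (real n - 1)) * S3"
    unfolding U_Energy_def S1_def S2_def S3_def dxy_def dxx_def dyy_def
    by (simp add: sum_subtractf sum_distrib_left[symmetric] right_diff_distrib diff_divide_distrib mult_ac)
  moreover have "\<bar>2 / (real m * real n) * S1\<bar> \<le> 2 * \<eta>"
  proof -
    have "\<bar>S1\<bar> \<le> real (card {..<m}) * (real (card {..<n}) * \<eta>)"
      unfolding S1_def by (intro abs_sum_le_card) (auto simp: dxy_def intro: xy)
    then show ?thesis using mn by (simp add: abs_mult field_simps)
  qed
  moreover have aux: "\<bar>1 / (real k * (real k - 1)) * (\<Sum>i<k. \<Sum>j\<in>{..<k} - {i}. d i j)\<bar> \<le> \<eta>"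
    if "2 \<le> k" "\<And>i j. i < k \<Longrightarrow> j < k \<Longrightarrow> \<bar>d i j\<bar> \<le> \<eta>" for k and d :: "nat \<Rightarrow> nat \<Rightarrow> real"
  proof -
    have "\<bar>\<Sum>i<k. \<Sum>j\<in>{..<k} - {i}. d i j\<bar> \<le> real (card {..<k}) * ((real k - 1) * \<eta>)"
    proof (rule abs_sum_le_card)
      fix i assume i: "i \<in> {..<k}"
      have "\<bar>\<Sum>j\<in>{..<k} - {i}. d i j\<bar> \<le> real (card ({..<k} - {i})) * \<eta>"
        by (rule abs_sum_le_card) (use that i in auto)
      then show "\<bar>\<Sum>j\<in>{..<k} - {i}. d i j\<bar> \<le> (real k - 1) * \<eta>" using i that(1) by (simp add: of_nat_diff)
    qed
    then show ?thesis using that(1) by (simp add: abs_mult field_simps)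
  qed
  moreover have "\<bar>1 / (real m * (real m - 1)) * S2\<bar> \<le> \<eta>"
    unfolding S2_def by (rule aux) (use mn xx in \<open>auto simp: dxx_def\<close>)
  moreover have "\<bar>1 / (real n * (real n - 1)) * S3\<bar> \<le> \<eta>"
    unfolding S3_def by (rule aux) (use mn yy in \<open>auto simp: dyy_def\<close>)
  ultimately show ?thesis by linarith
qed

text \<open>The statistic in units of the distance of a very remote contamination: flagged entries
  sit at 1 and all others at 0 on the real line.\<close>

definition flag_energy :: "nat \<Rightarrow> nat \<Rightarrow> nat set \<Rightarrow> real" where
  "flag_energy m n B = pooled U_Energy m n (\<lambda>p. of_bool (p \<in> B) :: real)"

text \<open>For values 0 and 1 the distance is \<open>u + v - 2 * u * v\<close>, so the sums depend
  only on the numbers of flags in the two samples, whose total is fixed. All three groups of terms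
  contribute with the same sign to the quadratic coefficient.\<close>

lemma flag_energy_quadratic:
  assumes mn: "2 \<le> m" "2 \<le> n"
  shows "\<exists>a b c. 0 < a \<and> (\<forall>B. B \<subseteq> {..<m + n} \<longrightarrow> card B = K \<longrightarrow>
    flag_energy m n B = a * (real (card (B \<inter> {..<m})))\<^sup>2 + b * real (card (B \<inter> {..<m})) + c)"
proof -
  define M N where "M = real m" and "N = real n"
  have MN: "2 \<le> M" "2 \<le> N" using mn by (auto simp: M_def N_def)
  define KK where "KK = real K"
  define p q r where "p = 2 / (M * N)" and "q = 1 / (M * (M - 1))" and "r = 1 / (N * (N - 1))"
  have pqr: "0 < p" "0 < q" "0 < r" using MN by (simp_all add: p_def q_def r_def)
  define F where "F k = p * (N * k + M * (KK - k) - 2 * k * (KK - k))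
      - q * (2 * M * k - 2 * k\<^sup>2) - r * (2 * N * (KK - k) - 2 * (KK - k)\<^sup>2)" for k
  have F: "flag_energy m n B = F (real (card (B \<inter> {..<m})))" if B: "B \<subseteq> {..<m + n}" "card B = K" for B
  proof -
    define u where "u p = (of_bool (p \<in> B) :: real)" for p
    define k l where "k = (\<Sum>i<m. u i)" and "l = (\<Sum>j<n. u (m + j))"
    have kl: "k + l = KK"
    proof -
      have "k + l = (\<Sum>p<m + n. u p)" by (simp add: k_def l_def sum_pooled)
      also have "\<dots> = real (card B)" using B(1) by (simp add: u_def Int_absorb1)
      finally show ?thesis by (simp add: KK_def B)
    qed
    have k: "k = real (card (B \<inter> {..<m}))" by (simp add: k_def u_def Int_commute)
    have un: "norm (u p - u q) = u p + u q - 2 * (u p * u q)" for p q by (simp add: u_def)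
    have s1: "(\<Sum>i<m. \<Sum>j<n. norm (u i - u (m + j))) = N * k + M * l - 2 * k * l"
    proof -
      have "(\<Sum>i<m. \<Sum>j<n. norm (u i - u (m + j))) = (\<Sum>i<m. \<Sum>j<n. u i) + (\<Sum>i<m. \<Sum>j<n. u (m + j)) - 2 * (\<Sum>i<m. \<Sum>j<n. u i * u (m + j))"
        by (simp only: un sum.distrib sum_subtractf sum_distrib_left)
      moreover have "(\<Sum>i<m. \<Sum>j<n. u i * u (m + j)) = k * l" by (simp only: k_def l_def sum_product)
      moreover have "(\<Sum>i<m. \<Sum>j<n. u i) = N * k" by (simp add: N_def k_def sum_distrib_left)
      moreover have "(\<Sum>i<m. \<Sum>j<n. u (m + j)) = M * l" by (simp add: M_def l_def)
      ultimately show ?thesis by simp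
    qed
    have s2: "(\<Sum>i<c. \<Sum>j\<in>{..<c} - {i}. norm (v i - v j)) = 2 * real c * (\<Sum>i<c. v i) - 2 * (\<Sum>i<c. v i)\<^sup>2"
      if vn: "\<And>i j. norm (v i - v j) = v i + v j - 2 * (v i * v j)" for c and v :: "nat \<Rightarrow> real"
    proof -
      have "(\<Sum>i<c. \<Sum>j\<in>{..<c} - {i}. norm (v i - v j)) = (\<Sum>i<c. \<Sum>j<c. norm (v i - v j))"
        by (rule sum.cong[OF refl], rule sum.mono_neutral_left) auto
      also have "\<dots> = (\<Sum>i<c. \<Sum>j<c. v i) + (\<Sum>i<c. \<Sum>j<c. v j) - 2 * (\<Sum>i<c. \<Sum>j<c. v i * v j)"
        by (simp only: vn sum.distrib sum_subtractf sum_distrib_left)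
      also have "(\<Sum>i<c. \<Sum>j<c. v i * v j) = (\<Sum>i<c. v i)\<^sup>2" by (simp only: power2_eq_square sum_product)
      also have "(\<Sum>i<c. \<Sum>j<c. v i) = real c * (\<Sum>i<c. v i)" by (simp add: sum_distrib_left)
      also have "(\<Sum>i<c. \<Sum>j<c. v j) = real c * (\<Sum>i<c. v i)" by simp
      finally show ?thesis by simp
    qed
    have l: "l = KK - k" using kl by simp
    have "flag_energy m n B = 2 / (M * N) * (N * k + M * l - 2 * k * l)
      - 1 / (M * (M - 1)) * (2 * M * k - 2 * k\<^sup>2) - 1 / (N * (N - 1)) * (2 * N * l - 2 * l\<^sup>2)"
      unfolding flag_energy_def pooled_def U_Energy_def u_def[symmetric] s1
      using s2[of u m] s2[of "\<lambda>j. u (m + j)" n] un by (simp add: M_def N_def k_def l_def)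
    then show ?thesis unfolding F_def l k[symmetric] p_def q_def r_def .
  qed
  define a where "a = 2 * p + 2 * q + 2 * r"
  have "0 < a" using pqr by (simp add: a_def)
  moreover have "F k = a * k\<^sup>2 + (p * (N - M - 2 * KK) - 2 * q * M + r * (2 * N - 4 * KK)) * k
      + (p * M * KK - r * (2 * N * KK - 2 * KK\<^sup>2))" for k
    by (simp add: F_def a_def power2_eq_square algebra_simps)
  ultimately show ?thesis using F by metis
qed

text \<open>A genuine quadratic takes a value at no more than two points, so two level sets of the
  count cover a level set of the statistic.\<close>

lemma card_flag_energy_level_le:
  assumes mn: "2 \<le> m" "2 \<le> n" and fin: "finite X"
    and X: "\<And>\<pi>. \<pi> \<in> X \<Longrightarrow> g \<pi> \<subseteq> {..<m + n} \<and> card (g \<pi>) = K"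
    and le: "\<And>\<kappa>. real (card {\<pi>\<in>X. card (g \<pi> \<inter> {..<m}) = \<kappa>}) \<le> c"
  shows "real (card {\<pi>\<in>X. flag_energy m n (g \<pi>) = \<tau>}) \<le> 2 * c"
proof (cases "\<exists>\<pi>\<in>X. flag_energy m n (g \<pi>) = \<tau>")
  case False
  then have *: "{\<pi>\<in>X. flag_energy m n (g \<pi>) = \<tau>} = {}" by blast
  have "0 \<le> c" by (rule order_trans[OF of_nat_0_le_iff le[of 0]])
  then show ?thesis unfolding * by simp
next
  case True
  then obtain \<pi>0 where \<pi>0: "\<pi>0 \<in> X" "flag_energy m n (g \<pi>0) = \<tau>" by blast
  obtain a b d where a: "0 < a" and q: "\<And>B. B \<subseteq> {..<m + n} \<Longrightarrow> card B = K \<Longrightarrow>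
      flag_energy m n B = a * (real (card (B \<inter> {..<m})))\<^sup>2 + b * real (card (B \<inter> {..<m})) + d"
    using flag_energy_quadratic[OF mn, of K] by blast
  define k where "k \<pi> = card (g \<pi> \<inter> {..<m})" for \<pi>
  \<comment> \<open>The second root by Vieta's formula. If it is not a natural number, no
    permutation attains it, and rounding is harmless.\<close>
  define k' where "k' = nat \<lfloor>- b / a - real (k \<pi>0)\<rfloor>"
  have "{\<pi>\<in>X. flag_energy m n (g \<pi>) = \<tau>} \<subseteq> {\<pi>\<in>X. k \<pi> = k \<pi>0} \<union> {\<pi>\<in>X. k \<pi> = k'}"
  proof
    fix \<pi> assume "\<pi> \<in> {\<pi>\<in>X. flag_energy m n (g \<pi>) = \<tau>}"
    then have \<pi>: "\<pi> \<in> X" "flag_energy m n (g \<pi>) = \<tau>" by auto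
    have "a * (real (k \<pi>))\<^sup>2 + b * real (k \<pi>) + d = a * (real (k \<pi>0))\<^sup>2 + b * real (k \<pi>0) + d"
      using q[of "g \<pi>"] q[of "g \<pi>0"] X \<pi> \<pi>0 unfolding k_def by metis
    then have "(real (k \<pi>) - real (k \<pi>0)) * (a * (real (k \<pi>) + real (k \<pi>0)) + b) = 0"
      by (simp add: algebra_simps power2_eq_square)
    then consider "k \<pi> = k \<pi>0" | "a * (real (k \<pi>) + real (k \<pi>0)) + b = 0" by auto
    then show "\<pi> \<in> {\<pi>\<in>X. k \<pi> = k \<pi>0} \<union> {\<pi>\<in>X. k \<pi> = k'}"
    proof cases
      case 2
      then have "- b / a - real (k \<pi>0) = real (k \<pi>)" using a by (simp add: field_simps)
      then have "k \<pi> = k'" by (simp add: k'_def)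
      then show ?thesis using \<pi> by simp
    qed (use \<pi> in simp)
  qed
  then have "card {\<pi>\<in>X. flag_energy m n (g \<pi>) = \<tau>} \<le> card ({\<pi>\<in>X. k \<pi> = k \<pi>0} \<union> {\<pi>\<in>X. k \<pi> = k'})"
    using fin by (intro card_mono) auto
  also have "\<dots> \<le> card {\<pi>\<in>X. k \<pi> = k \<pi>0} + card {\<pi>\<in>X. k \<pi> = k'}" by (rule card_Un_le)
  finally have "real (card {\<pi>\<in>X. flag_energy m n (g \<pi>) = \<tau>}) \<le> real (card {\<pi>\<in>X. k \<pi> = k \<pi>0}) + real (card {\<pi>\<in>X. k \<pi> = k'})"
    by (simp only: of_nat_le_iff of_nat_add[symmetric])
  then show ?thesis using le[of "k \<pi>0"] le[of k'] unfolding k_def by linarith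
qed

section \<open>Atoms of symmetric binomial distributions, of which \<open>central_ratio\<close> is
  the largest\<close>

definition central_ratio :: "nat \<Rightarrow> real" where
  "central_ratio d = real (d choose (d div 2)) / 2 ^ d"

lemma central_ratio_nonneg: "0 \<le> central_ratio d"
  by (simp add: central_ratio_def)

text \<open>The left-hand side is nonincreasing: the step from \<open>k\<close> multiplies it by
  \<open>(2k + 1)(2k + 3) / (2k + 2)^2\<close>, which is less than 1. This yields the correct order
  of decay without Stirling's formula.\<close>

lemma central_binomial_square_le: "(real ((2 * k) choose k) / 4 ^ k)\<^sup>2 * (2 * real k + 1) \<le> 1"
proof (induction k)
  case (Suc k)
  let ?c = "real ((2 * k) choose k)"
  define A where "A = (2 * Suc k) choose Suc k"
  define C where "C = (2 * k) choose k"
  have "Suc k * A = 2 * ((2 * k + 1) * C)"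
  proof -
    have "Suc k * A = (2 * Suc k) * ((2 * k + 1) choose k)"
      unfolding A_def using Suc_times_binomial_eq[of "2 * k + 1" k] by (simp add: mult.commute)
    moreover have "Suc k * ((2 * k + 1) choose Suc k) = (2 * k + 1) * C"
      unfolding C_def using Suc_times_binomial_eq[of "2 * k" k] by (simp add: mult.commute)
    moreover have "(2 * k + 1) choose Suc k = (2 * k + 1) choose k"
      using binomial_symmetric[of k "2 * k + 1"] by simp
    ultimately show ?thesis by (simp only: mult.assoc)
  qed
  from arg_cong[OF this, of real] have "(real k + 1) * real A = 2 * (2 * real k + 1) * real C"
    by (simp add: algebra_simps)
  then have A: "real A = 2 * (2 * real k + 1) / (real k + 1) * real C" by (simp add: field_simps)
  have "2 * (2 * real k + 1) / (real k + 1) * c / (4 * p) = c / p * ((2 * real k + 1) / (2 * real k + 2))" for c p :: real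
    by (simp add: divide_simps) (simp add: algebra_simps)
  then have "real A / 4 ^ Suc k = real C / 4 ^ k * ((2 * real k + 1) / (2 * real k + 2))"
    unfolding A power_Suc .
  moreover have "(X * (t / u))\<^sup>2 * v = X\<^sup>2 * t * (t * v / u\<^sup>2)" for X t u v :: real
    by (simp add: power2_eq_square)
  moreover have "2 * real (Suc k) + 1 = 2 * real k + 3" by simp
  ultimately have "(real A / 4 ^ Suc k)\<^sup>2 * (2 * real (Suc k) + 1) =
      (real C / 4 ^ k)\<^sup>2 * (2 * real k + 1) * ((2 * real k + 1) * (2 * real k + 3) / (2 * real k + 2)\<^sup>2)"
    by (simp only:)
  also have "\<dots> \<le> 1 * 1"
  proof (rule mult_mono[OF Suc.IH[folded C_def]])
    show "(2 * real k + 1) * (2 * real k + 3) / (2 * real k + 2)\<^sup>2 \<le> 1"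
      by (simp add: divide_le_eq_1 power2_eq_square algebra_simps add_pos_nonneg)
  qed auto
  finally show ?case by (simp add: A_def)
qed simp

text \<open>For odd \<open>d\<close> Pascal's rule bounds the central coefficient by twice the one
  of the even number below. The case \<open>d = 0\<close> is excluded because
  \<open>1 / sqrt 0\<close> is 0 while \<open>central_ratio 0\<close> is 1.\<close>

lemma central_ratio_le:
  assumes "0 < d"
  shows "central_ratio d \<le> 1 / sqrt (real d)"
proof -
  define k where "k = d div 2"
  let ?c = "real ((2 * k) choose k) / 4 ^ k"
  have "central_ratio d \<le> ?c"
  proof (cases "even d")
    case True
    then have "d = 2 * k" by (simp add: k_def)
    then show ?thesis by (simp add: central_ratio_def power_mult)
  next
    case False
    then have d: "d = Suc (2 * k)" by (simp add: k_def)
    have "d choose k \<le> 2 * ((2 * k) choose k)"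
    proof (cases k)
      case (Suc j)
      have "d choose Suc j = (2 * k choose j) + (2 * k choose Suc j)" unfolding d by (rule binomial_Suc_Suc)
      then have "d choose k = (2 * k choose j) + (2 * k choose k)" by (simp only: Suc[symmetric])
      also have "2 * k choose j \<le> 2 * k choose k" using binomial_maximum[of "2 * k" j] by simp
      finally show ?thesis by simp
    qed (simp add: d)
    then have "real (d choose k) \<le> 2 * real ((2 * k) choose k)" by (metis of_nat_le_iff of_nat_mult of_nat_numeral)
    then have "real (d choose k) / 2 ^ d \<le> 2 * real ((2 * k) choose k) / 2 ^ d" by (rule divide_right_mono) simp
    also have "\<dots> = ?c" by (simp add: d power_mult)
    finally show ?thesis by (simp add: central_ratio_def k_def)
  qed
  also have "\<dots> \<le> 1 / sqrt (real d)"
  proof (rule power2_le_imp_le)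
    have dk: "real d \<le> 2 * real k + 1" by (simp add: k_def)
    have "?c\<^sup>2 * real d \<le> ?c\<^sup>2 * (2 * real k + 1)" by (intro mult_left_mono dk) simp
    also have "\<dots> \<le> 1" by (rule central_binomial_square_le)
    finally show "?c\<^sup>2 \<le> (1 / sqrt (real d))\<^sup>2" using assms by (simp add: power_divide pos_le_divide_eq)
  qed simp
  finally show ?thesis .
qed

section \<open>Swapping paired entries of the two samples\<close>

definition discordance :: "nat \<Rightarrow> nat \<Rightarrow> nat set \<Rightarrow> nat" where
  "discordance m n B = card {l. l < min m n \<and> (l \<in> B) \<noteq> (m + l \<in> B)}"

definition swap_pairs :: "nat \<Rightarrow> nat set \<Rightarrow> nat \<Rightarrow> nat" where
  "swap_pairs m C p = (if p < m \<and> p \<in> C then m + p else if m \<le> p \<and> p - m \<in> C then p - m else p)"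

lemma swap_pairs_permutes:
  assumes C: "C \<subseteq> {..<min m n}"
  shows "swap_pairs m C permutes {..<m + n}"
proof -
  have C': "x < m" "x < n" if "x \<in> C" for x using C that by auto
  have inv: "swap_pairs m C (swap_pairs m C p) = p" for p
  proof (cases "m \<le> p \<and> p - m \<in> C")
    case True
    then have "p - m < m" using C' by blast
    then show ?thesis using True by (simp add: swap_pairs_def)
  next
    case False
    then show ?thesis using C' by (auto simp: swap_pairs_def)
  qed
  have "swap_pairs m C p = p" if "p \<notin> {..<m + n}" for p
    using C'[of p] C'[of "p - m"] that by (auto simp: swap_pairs_def)
  then show ?thesis unfolding permutes_def using inv by metis
qed

text \<open>A swap set is free outside \<open>D\<close>. Inside, it is determined by where it
  disagrees with \<open>E\<close>, and the size of this set of disagreements is prescribed. The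
  count is thus at most a power of two times a binomial coefficient with upper index
  \<open>card D\<close>.\<close>

lemma card_flips_le:
  assumes D: "D \<subseteq> {..<L}"
  shows "real (card {C. C \<subseteq> {..<L} \<and> e + card {l\<in>D. (l \<in> E) \<noteq> (l \<in> C)} = \<kappa>}) \<le> 2 ^ L * central_ratio (card D)"
proof -
  have finD: "finite D" using D finite_subset by blast
  define T where "T = {C. C \<subseteq> {..<L} \<and> e + card {l\<in>D. (l \<in> E) \<noteq> (l \<in> C)} = \<kappa>}"
  define \<phi> where "\<phi> C = (C - D, {l\<in>D. (l \<in> E) \<noteq> (l \<in> C)})" for C
  have inj: "inj_on \<phi> T"
  proof (rule inj_onI)
    fix C C' assume "\<phi> C = \<phi> C'"
    then have "C - D = C' - D" "{l\<in>D. (l \<in> E) \<noteq> (l \<in> C)} = {l\<in>D. (l \<in> E) \<noteq> (l \<in> C')}" by (auto simp: \<phi>_def)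
    then show "C = C'" by blast
  qed
  have sub: "\<phi> ` T \<subseteq> Pow ({..<L} - D) \<times> {X. X \<subseteq> D \<and> card X = \<kappa> - e}"
    by (auto simp: \<phi>_def T_def)
  have finX: "finite (Pow ({..<L} - D) \<times> {X. X \<subseteq> D \<and> card X = \<kappa> - e})" using finD by simp
  have "card T \<le> card (Pow ({..<L} - D) \<times> {X. X \<subseteq> D \<and> card X = \<kappa> - e})"
    using card_mono[OF finX sub] card_image[OF inj] by simp
  also have "\<dots> = 2 ^ (L - card D) * (card D choose (\<kappa> - e))"
    using finD D by (simp add: card_cartesian_product card_Pow card_Diff_subset n_subsets)
  also have "\<dots> \<le> 2 ^ (L - card D) * (card D choose (card D div 2))"
    by (intro mult_left_mono binomial_maximum) simp
  finally have "real (card T) \<le> real (2 ^ (L - card D) * (card D choose (card D div 2)))"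
    by (simp only: of_nat_le_iff)
  also have "\<dots> = 2 ^ L * central_ratio (card D)"
  proof -
    have "card D \<le> L" using D card_mono[of "{..<L}" D] by simp
    then have "(2::real) ^ (L - card D) = 2 ^ L / 2 ^ card D" by (simp add: power_diff)
    then show ?thesis by (simp add: central_ratio_def)
  qed
  finally show ?thesis by (simp add: T_def)
qed

text \<open>The permutation distribution is invariant under swapping, for an arbitrary set of \<open>l\<close>, the
  entries \<open>l\<close> and \<open>m + l\<close>; given the rest, such random swaps make the number of flagged entries in
  the first sample a shifted binomial variable.\<close>

lemma card_permutations_first_sample_le:
  "real (card {\<pi>. \<pi> permutes {..<m + n} \<and> card (\<pi> -` B \<inter> {..<m}) = \<kappa>}) \<le>
    (\<Sum>\<pi> | \<pi> permutes {..<m + n}. central_ratio (discordance m n (\<pi> -` B)))"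
proof -
  define L where "L = min m n"
  define PP where "PP = {\<pi>. \<pi> permutes {..<m + n}}"
  have fin: "finite PP" unfolding PP_def by (rule finite_permutations) simp
  define k where "k E = card (E \<inter> {..<m})" for E
  \<comment> \<open>Only pairs with exactly one flag, those in \<open>D\<close>, change the count
    when swapped: such a pair counts exactly if its flag is in the first sample and stays, or is in
    the second and is brought over.\<close>
  have swap: "k (swap_pairs m C -` E) = card (E \<inter> ({..<m} - D)) + card {l\<in>D. (l \<in> E) \<noteq> (l \<in> C)}"
    if C: "C \<subseteq> {..<L}" and D: "D = {l. l < L \<and> (l \<in> E) \<noteq> (m + l \<in> E)}" for C D E
  proof -
    have "swap_pairs m C -` E \<inter> {..<m} = (E \<inter> ({..<m} - D)) \<union> {l\<in>D. (l \<in> E) \<noteq> (l \<in> C)}"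
      using C unfolding D L_def by (auto simp: swap_pairs_def split: if_splits)
    moreover have "finite D" unfolding D by simp
    ultimately show ?thesis unfolding k_def by (subst card_Un_disjoint[symmetric]) auto
  qed
  have inv: "(\<Sum>\<pi>\<in>PP. of_bool (k (\<pi> -` B) = \<kappa>) :: real) = (\<Sum>\<pi>\<in>PP. of_bool (k (swap_pairs m C -` (\<pi> -` B)) = \<kappa>))"
    if "C \<in> Pow {..<L}" for C
  proof -
    have "swap_pairs m C permutes {..<m + n}" using that by (intro swap_pairs_permutes) (simp add: L_def)
    from sum_permutations_compose_right[OF this, of "\<lambda>\<pi>. of_bool (k (\<pi> -` B) = \<kappa>) :: real"]
    show ?thesis by (simp add: PP_def vimage_comp)
  qed
  have "2 ^ L * (\<Sum>\<pi>\<in>PP. of_bool (k (\<pi> -` B) = \<kappa>) :: real) = (\<Sum>C\<in>Pow {..<L}. \<Sum>\<pi>\<in>PP. of_bool (k (\<pi> -` B) = \<kappa>))"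
    by (simp add: card_Pow)
  also have "\<dots> = (\<Sum>C\<in>Pow {..<L}. \<Sum>\<pi>\<in>PP. of_bool (k (swap_pairs m C -` (\<pi> -` B)) = \<kappa>))"
    by (rule sum.cong[OF refl inv])
  also have "\<dots> = (\<Sum>\<pi>\<in>PP. \<Sum>C\<in>Pow {..<L}. of_bool (k (swap_pairs m C -` (\<pi> -` B)) = \<kappa>))"
    by (rule sum.swap)
  also have "\<dots> \<le> (\<Sum>\<pi>\<in>PP. 2 ^ L * central_ratio (discordance m n (\<pi> -` B)))"
  proof (rule sum_mono)
    fix \<pi> :: "nat \<Rightarrow> nat"
    let ?E = "\<pi> -` B"
    define D where "D = {l. l < L \<and> (l \<in> ?E) \<noteq> (m + l \<in> ?E)}"
    have "(\<Sum>C\<in>Pow {..<L}. of_bool (k (swap_pairs m C -` ?E) = \<kappa>) :: real) =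
        real (card {C. C \<subseteq> {..<L} \<and> k (swap_pairs m C -` ?E) = \<kappa>})"
      by (simp add: Int_def)
    also have "{C. C \<subseteq> {..<L} \<and> k (swap_pairs m C -` ?E) = \<kappa>} =
        {C. C \<subseteq> {..<L} \<and> card (?E \<inter> ({..<m} - D)) + card {l\<in>D. (l \<in> ?E) \<noteq> (l \<in> C)} = \<kappa>}"
      using swap[OF _ D_def] by auto
    also have "real (card {C. C \<subseteq> {..<L} \<and> card (?E \<inter> ({..<m} - D)) + card {l\<in>D. (l \<in> ?E) \<noteq> (l \<in> C)} = \<kappa>})
        \<le> 2 ^ L * central_ratio (card D)"
      by (rule card_flips_le) (auto simp: D_def)
    also have "card D = discordance m n ?E" by (simp add: D_def discordance_def L_def)
    finally show "(\<Sum>C\<in>Pow {..<L}. of_bool (k (swap_pairs m C -` ?E) = \<kappa>) :: real) \<le>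
        2 ^ L * central_ratio (discordance m n ?E)" .
  qed
  also have "\<dots> = 2 ^ L * (\<Sum>\<pi>\<in>PP. central_ratio (discordance m n (\<pi> -` B)))" by (simp add: sum_distrib_left)
  finally have "(\<Sum>\<pi>\<in>PP. of_bool (k (\<pi> -` B) = \<kappa>) :: real) \<le> (\<Sum>\<pi>\<in>PP. central_ratio (discordance m n (\<pi> -` B)))"
    by simp
  then show ?thesis using fin by (simp add: PP_def k_def Int_def)
qed

section \<open>Independent contamination flags\<close>

definition flag_weight :: "real \<Rightarrow> nat set \<Rightarrow> nat set \<Rightarrow> real" where
  "flag_weight \<epsilon> I B = (\<Prod>i\<in>I. if i \<in> B then \<epsilon> else 1 - \<epsilon>)"

lemma flag_weight_nonneg: "0 \<le> \<epsilon> \<Longrightarrow> \<epsilon> \<le> 1 \<Longrightarrow> 0 \<le> flag_weight \<epsilon> I B"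
  by (auto simp: flag_weight_def intro!: prod_nonneg)

lemma flag_weight_insert:
  assumes "finite I" "i \<notin> I" "B \<subseteq> I"
  shows "flag_weight \<epsilon> (insert i I) B = (1 - \<epsilon>) * flag_weight \<epsilon> I B"
    "flag_weight \<epsilon> (insert i I) (insert i B) = \<epsilon> * flag_weight \<epsilon> I B"
proof -
  show "flag_weight \<epsilon> (insert i I) B = (1 - \<epsilon>) * flag_weight \<epsilon> I B" using assms by (auto simp: flag_weight_def)
  have "(\<Prod>j\<in>I. if j \<in> insert i B then \<epsilon> else 1 - \<epsilon>) = (\<Prod>j\<in>I. if j \<in> B then \<epsilon> else 1 - \<epsilon>)"
    using assms by (intro prod.cong) auto
  then show "flag_weight \<epsilon> (insert i I) (insert i B) = \<epsilon> * flag_weight \<epsilon> I B" using assms by (simp add: flag_weight_def)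
qed

lemma sum_Pow_insert:
  fixes g :: "'b set \<Rightarrow> 'c::comm_monoid_add"
  assumes "finite I" "i \<notin> I"
  shows "(\<Sum>B\<in>Pow (insert i I). g B) = (\<Sum>B\<in>Pow I. g B + g (insert i B))"
proof -
  have "inj_on (insert i) (Pow I)" using assms by (auto simp: inj_on_def)
  moreover have "Pow I \<inter> insert i ` Pow I = {}" using assms by auto
  ultimately show ?thesis using assms
    by (simp add: Pow_insert sum.union_disjoint sum.reindex sum.distrib)
qed

lemma sum_flag_weight:
  assumes "finite I"
  shows "(\<Sum>B\<in>Pow I. flag_weight \<epsilon> I B) = 1"
  using assms
proof (induction I)
  case (insert i I)
  have "(\<Sum>B\<in>Pow I. flag_weight \<epsilon> (insert i I) B + flag_weight \<epsilon> (insert i I) (insert i B)) = (\<Sum>B\<in>Pow I. flag_weight \<epsilon> I B)"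
    using insert by (intro sum.cong refl) (simp add: flag_weight_insert algebra_simps)
  then show ?case using insert by (simp add: sum_Pow_insert)
qed (simp add: flag_weight_def)

lemma sum_Pow_permute:
  assumes "\<rho> permutes S"
  shows "(\<Sum>B\<in>Pow S. g (\<rho> -` B)) = (\<Sum>B\<in>Pow S. g B)"
proof (rule sum.reindex_bij_betw)
  have mem: "\<rho> x \<in> S \<longleftrightarrow> x \<in> S" for x using assms by (rule permutes_in_image)
  have mem': "inv \<rho> x \<in> S \<longleftrightarrow> x \<in> S" for x using permutes_inv[OF assms] by (rule permutes_in_image)
  show "bij_betw (\<lambda>B. \<rho> -` B) (Pow S) (Pow S)"
  proof (rule bij_betwI[where g = "\<lambda>B. inv \<rho> -` B"])
    show "(\<lambda>B. \<rho> -` B) \<in> Pow S \<rightarrow> Pow S" using mem by auto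
    show "(\<lambda>B. inv \<rho> -` B) \<in> Pow S \<rightarrow> Pow S" using mem' by auto
  qed (auto simp: vimage_def permutes_inverses[OF assms])
qed

lemma flag_weight_permute:
  assumes "\<rho> permutes S"
  shows "flag_weight \<epsilon> S (\<rho> -` B) = flag_weight \<epsilon> S B"
  using prod.permute[OF assms, of "\<lambda>i. if i \<in> B then \<epsilon> else 1 - \<epsilon>"] by (simp add: flag_weight_def o_def)

text \<open>The flags are independent with equal probabilities, so a random pattern may be replaced
  by a uniformly random rearrangement of itself.\<close>

lemma sum_permutes_weighted_average:
  fixes g :: "nat set \<Rightarrow> real"
  shows "(\<Sum>B\<in>Pow {..<N}. flag_weight \<epsilon> {..<N} B * g B) =
    (\<Sum>B\<in>Pow {..<N}. flag_weight \<epsilon> {..<N} B * ((\<Sum>\<rho> | \<rho> permutes {..<N}. g (\<rho> -` B)) / fact N))"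
proof -
  let ?PP = "{\<rho>. \<rho> permutes {..<N}}" and ?w = "flag_weight \<epsilon> {..<N}"
  have card: "card ?PP = fact N" by (rule card_permutations) auto
  have inv: "(\<Sum>B\<in>Pow {..<N}. ?w B * g B) = (\<Sum>B\<in>Pow {..<N}. ?w B * g (\<rho> -` B))" if "\<rho> \<in> ?PP" for \<rho>
    using sum_Pow_permute[of \<rho> "{..<N}" "\<lambda>B. ?w B * g B"] flag_weight_permute[of \<rho> "{..<N}"] that by simp
  have "fact N * (\<Sum>B\<in>Pow {..<N}. ?w B * g B) = (\<Sum>\<rho>\<in>?PP. \<Sum>B\<in>Pow {..<N}. ?w B * g B)"
    by (simp add: card)
  also have "\<dots> = (\<Sum>\<rho>\<in>?PP. \<Sum>B\<in>Pow {..<N}. ?w B * g (\<rho> -` B))" by (rule sum.cong[OF refl inv])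
  also have "\<dots> = (\<Sum>B\<in>Pow {..<N}. ?w B * (\<Sum>\<rho>\<in>?PP. g (\<rho> -` B)))"
    by (subst sum.swap) (simp add: sum_distrib_left)
  finally have "(\<Sum>B\<in>Pow {..<N}. ?w B * g B) = (\<Sum>B\<in>Pow {..<N}. ?w B * (\<Sum>\<rho>\<in>?PP. g (\<rho> -` B))) / fact N"
    by (simp add: field_simps)
  then show ?thesis by (simp only: sum_divide_distrib[where A = "Pow {..<N}"] times_divide_eq_right)
qed

text \<open>The inequality between energies is not strict, unlike in \<open>perm_test_eq\<close>:
  for equal flag energies the actual statistics are ordered by a remainder of unknown sign, so every
  tie is counted in favour of rejection.\<close>

definition flag_reject :: "real \<Rightarrow> nat \<Rightarrow> nat \<Rightarrow> nat set \<Rightarrow> bool" where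
  "flag_reject \<alpha> m n B \<longleftrightarrow> (1 - \<alpha>) * fact (m + n) \<le>
     real (card {\<pi>. \<pi> permutes {..<m + n} \<and> flag_energy m n (\<pi> -` B) \<le> flag_energy m n B})"

text \<open>If \<open>\<tau>\<close> is the smallest rejecting value, at most a fraction
  \<open>\<alpha>\<close> of the relabellings lie strictly above it. Those exactly at
  \<open>\<tau>\<close> come on top, and they form a level set of the quadratic in the
  count.\<close>

lemma card_permutations_flag_reject_le:
  assumes mn: "2 \<le> m" "2 \<le> n" and \<alpha>: "0 < \<alpha>" and B: "B \<subseteq> {..<m + n}"
  shows "real (card {\<rho>. \<rho> permutes {..<m + n} \<and> flag_reject \<alpha> m n (\<rho> -` B)}) \<le>
    \<alpha> * fact (m + n) + 2 * (\<Sum>\<pi> | \<pi> permutes {..<m + n}. central_ratio (discordance m n (\<pi> -` B)))"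
proof -
  define PP where "PP = {\<pi>. \<pi> permutes {..<m + n}}"
  define c where "c = (\<Sum>\<pi>\<in>PP. central_ratio (discordance m n (\<pi> -` B)))"
  define g where "g \<pi> = flag_energy m n (\<pi> -` B)" for \<pi>
  have fin: "finite PP" unfolding PP_def by (rule finite_permutations) simp
  have cardPP: "card PP = fact (m + n)" unfolding PP_def by (rule card_permutations) auto
  have c0: "0 \<le> c" unfolding c_def by (intro sum_nonneg central_ratio_nonneg)
  have atom: "real (card {\<pi>\<in>PP. g \<pi> = \<tau>}) \<le> 2 * c" for \<tau>
    unfolding g_def
  proof (rule card_flag_energy_level_le[OF mn fin, where K = "card B"])
    fix \<pi> assume "\<pi> \<in> PP"
    then have \<pi>: "\<pi> permutes {..<m + n}" by (simp add: PP_def)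
    have "\<pi> -` B \<subseteq> {..<m + n}" using B permutes_in_image[OF \<pi>] by blast
    moreover have "card (\<pi> -` B) = card B"
      using permutes_inj[OF \<pi>] permutes_surj[OF \<pi>] by (simp add: card_vimage_inj)
    ultimately show "\<pi> -` B \<subseteq> {..<m + n} \<and> card (\<pi> -` B) = card B" by simp
  next
    fix \<kappa>
    show "real (card {\<pi>\<in>PP. card (\<pi> -` B \<inter> {..<m}) = \<kappa>}) \<le> c"
      using card_permutations_first_sample_le[of m n B \<kappa>] by (simp add: c_def PP_def)
  qed
  define A where "A = {\<rho>\<in>PP. flag_reject \<alpha> m n (\<rho> -` B)}"
  \<comment> \<open>Relabelling an already relabelled pattern runs again through all relabellings,
    so every \<open>\<rho>\<close> is compared with the same permutation distribution.\<close>
  have A_iff: "\<rho> \<in> A \<longleftrightarrow> \<rho> \<in> PP \<and> (1 - \<alpha>) * fact (m + n) \<le> real (card {\<pi>\<in>PP. g \<pi> \<le> g \<rho>})" for \<rho>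
  proof (cases "\<rho> \<in> PP")
    case True
    then have \<rho>: "\<rho> permutes {..<m + n}" by (simp add: PP_def)
    have "(\<Sum>\<pi>\<in>PP. of_bool (g \<pi> \<le> g \<rho>)) = (\<Sum>\<pi>\<in>PP. of_bool (g (\<rho> \<circ> \<pi>) \<le> g \<rho>) :: real)"
      using setum_permutations_compose_left[OF \<rho>, of "\<lambda>\<pi>. of_bool (g \<pi> \<le> g \<rho>) :: real"] by (simp add: PP_def)
    then have "card {\<pi>\<in>PP. g \<pi> \<le> g \<rho>} = card {\<pi>\<in>PP. g (\<rho> \<circ> \<pi>) \<le> g \<rho>}"
      using fin by (simp add: Int_def)
    then show ?thesis using True by (simp add: A_def flag_reject_def g_def PP_def vimage_comp)
  qed (simp add: A_def)
  have "real (card A) \<le> \<alpha> * fact (m + n) + 2 * c"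
  proof (cases "A = {}")
    case True
    then show ?thesis using \<alpha> c0 by simp
  next
    case False
    have finA: "finite A" unfolding A_def using fin by simp
    define \<tau> where "\<tau> = Min (g ` A)"
    have "\<tau> \<in> g ` A" unfolding \<tau>_def using False finA by (intro Min_in) auto
    then obtain \<rho>0 where \<rho>0: "\<rho>0 \<in> A" "g \<rho>0 = \<tau>" by auto
    have "A \<subseteq> {\<rho>\<in>PP. \<tau> \<le> g \<rho>}" using finA by (auto simp: \<tau>_def A_def)
    also have "\<dots> = (PP - {\<pi>\<in>PP. g \<pi> \<le> \<tau>}) \<union> {\<pi>\<in>PP. g \<pi> = \<tau>}" by auto
    finally have "card A \<le> card ((PP - {\<pi>\<in>PP. g \<pi> \<le> \<tau>}) \<union> {\<pi>\<in>PP. g \<pi> = \<tau>})"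
      using fin by (intro card_mono) auto
    also have "\<dots> \<le> card (PP - {\<pi>\<in>PP. g \<pi> \<le> \<tau>}) + card {\<pi>\<in>PP. g \<pi> = \<tau>}" by (rule card_Un_le)
    also have "card (PP - {\<pi>\<in>PP. g \<pi> \<le> \<tau>}) = card PP - card {\<pi>\<in>PP. g \<pi> \<le> \<tau>}"
      using fin by (intro card_Diff_subset) auto
    finally have "card A \<le> (card PP - card {\<pi>\<in>PP. g \<pi> \<le> \<tau>}) + card {\<pi>\<in>PP. g \<pi> = \<tau>}" .
    moreover have "card {\<pi>\<in>PP. g \<pi> \<le> \<tau>} \<le> card PP" using fin by (intro card_mono) auto
    ultimately have "real (card A) \<le> real (card PP) - real (card {\<pi>\<in>PP. g \<pi> \<le> \<tau>}) + real (card {\<pi>\<in>PP. g \<pi> = \<tau>})"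
      by linarith
    moreover have "(1 - \<alpha>) * fact (m + n) \<le> real (card {\<pi>\<in>PP. g \<pi> \<le> \<tau>})" using \<rho>0 A_iff by auto
    ultimately show ?thesis using atom[of \<tau>] by (simp add: cardPP algebra_simps)
  qed
  then show ?thesis by (simp add: A_def PP_def c_def)
qed

lemma sum_flag_reject_le:
  assumes mn: "2 \<le> m" "2 \<le> n" and \<alpha>: "0 < \<alpha>" and \<epsilon>: "0 \<le> \<epsilon>" "\<epsilon> \<le> 1"
  defines "w \<equiv> flag_weight \<epsilon> {..<m + n}"
  shows "(\<Sum>B\<in>Pow {..<m + n}. w B * of_bool (flag_reject \<alpha> m n B)) \<le>
    \<alpha> + 2 * (\<Sum>B\<in>Pow {..<m + n}. w B * central_ratio (discordance m n B))"
proof -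
  let ?PP = "{\<rho>. \<rho> permutes {..<m + n}}"
  have fin: "finite ?PP" by (rule finite_permutations) simp
  define r where "r B = (\<Sum>\<rho>\<in>?PP. central_ratio (discordance m n (\<rho> -` B))) / fact (m + n)" for B
  have "(\<Sum>B\<in>Pow {..<m + n}. w B * of_bool (flag_reject \<alpha> m n B)) =
      (\<Sum>B\<in>Pow {..<m + n}. w B * ((\<Sum>\<rho>\<in>?PP. of_bool (flag_reject \<alpha> m n (\<rho> -` B))) / fact (m + n)))"
    unfolding w_def by (rule sum_permutes_weighted_average)
  also have "\<dots> \<le> (\<Sum>B\<in>Pow {..<m + n}. w B * (\<alpha> + 2 * r B))"
  proof (intro sum_mono mult_left_mono)
    fix B assume "B \<in> Pow {..<m + n}"
    then have B: "B \<subseteq> {..<m + n}" by simp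
    have "(\<Sum>\<rho>\<in>?PP. of_bool (flag_reject \<alpha> m n (\<rho> -` B))) =
        real (card {\<rho>. \<rho> permutes {..<m + n} \<and> flag_reject \<alpha> m n (\<rho> -` B)})"
      using fin by (simp add: Int_def)
    also have "\<dots> \<le> \<alpha> * fact (m + n) + 2 * (\<Sum>\<rho>\<in>?PP. central_ratio (discordance m n (\<rho> -` B)))"
      by (rule card_permutations_flag_reject_le[OF mn \<alpha> B])
    also have "\<dots> = (\<alpha> + 2 * r B) * fact (m + n)" by (simp add: r_def distrib_right)
    finally show "(\<Sum>\<rho>\<in>?PP. of_bool (flag_reject \<alpha> m n (\<rho> -` B))) / fact (m + n) \<le> \<alpha> + 2 * r B"
      by (simp add: pos_divide_le_eq)
    show "0 \<le> w B" unfolding w_def using \<epsilon> by (rule flag_weight_nonneg)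
  qed
  also have "\<dots> = \<alpha> * (\<Sum>B\<in>Pow {..<m + n}. w B) + 2 * (\<Sum>B\<in>Pow {..<m + n}. w B * r B)"
    by (simp add: distrib_left sum.distrib sum_distrib_left mult_ac)
  also have "(\<Sum>B\<in>Pow {..<m + n}. w B) = 1" unfolding w_def by (rule sum_flag_weight) simp
  also have "(\<Sum>B\<in>Pow {..<m + n}. w B * r B) = (\<Sum>B\<in>Pow {..<m + n}. w B * central_ratio (discordance m n B))"
    unfolding w_def r_def by (rule sum_permutes_weighted_average[symmetric])
  finally show ?thesis by simp
qed

text \<open>The pairs are independent and each is discordant with probability
  \<open>2 * \<epsilon> * (1 - \<epsilon>)\<close>; the sum is the generating function of a binomial
  variable at 1/2.\<close>

lemma sum_flag_weight_discordance:
  "(\<Sum>B\<in>Pow {..<m + n}. flag_weight \<epsilon> {..<m + n} B * (1 / 2) ^ discordance m n B) = (1 - \<epsilon> * (1 - \<epsilon>)) ^ min m n"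
proof -
  define L where "L = min m n"
  \<comment> \<open>\<open>R\<close> holds the entries without a partner. The induction adds one
    pair at a time to them, with four possible flaggings each.\<close>
  define R where "R = {..<m + n} - ({..<L} \<union> {m..<m + L})"
  define U where "U l = R \<union> {..<l} \<union> {m..<m + l}" for l
  define d where "d l B = card {i. i < l \<and> (i \<in> B) \<noteq> (m + i \<in> B)}" for l B
  have "(\<Sum>B\<in>Pow (U l). flag_weight \<epsilon> (U l) B * (1 / 2) ^ d l B) = (1 - \<epsilon> * (1 - \<epsilon>)) ^ l" if "l \<le> L" for l
    using that
  proof (induction l)
    case 0
    have "finite R" by (simp add: R_def)
    then show ?case by (simp add: U_def d_def sum_flag_weight)
  next
    case (Suc l)
    have fin: "finite (U l)" by (simp add: U_def R_def)
    have lm: "l < m" "l < n" using Suc.prems by (auto simp: L_def)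
    have U: "U (Suc l) = insert l (insert (m + l) (U l))" by (auto simp: U_def)
    have nin: "m + l \<notin> U l" "l \<notin> insert (m + l) (U l)"
      using lm Suc.prems by (auto simp: U_def R_def L_def)
    let ?w = "flag_weight \<epsilon>"
    have d: "d (Suc l) B = d l B" "d (Suc l) (insert l (insert (m + l) B)) = d l B"
      "d (Suc l) (insert l B) = Suc (d l B)" "d (Suc l) (insert (m + l) B) = Suc (d l B)"
      if B: "B \<subseteq> U l" for B
    proof -
      have lB: "l \<notin> B" "m + l \<notin> B" using B nin by auto
      have eq: "{i. i < Suc l \<and> (i \<in> C) \<noteq> (m + i \<in> C)} =
          (if (l \<in> C) \<noteq> (m + l \<in> C) then insert l {i. i < l \<and> (i \<in> B) \<noteq> (m + i \<in> B)} else {i. i < l \<and> (i \<in> B) \<noteq> (m + i \<in> B)})"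
        if "C - {l, m + l} = B" for C
      proof -
        have "i \<in> C \<longleftrightarrow> i \<in> B" "m + i \<in> C \<longleftrightarrow> m + i \<in> B" if "i < l" for i
          using \<open>C - {l, m + l} = B\<close> that lm by auto
        then show ?thesis by (auto simp: less_Suc_eq)
      qed
      show "d (Suc l) B = d l B" "d (Suc l) (insert l (insert (m + l) B)) = d l B"
        "d (Suc l) (insert l B) = Suc (d l B)" "d (Suc l) (insert (m + l) B) = Suc (d l B)"
        unfolding d_def using lB lm
        by (subst eq; auto)+
    qed
    have w: "?w (U (Suc l)) B = (1 - \<epsilon>) * ((1 - \<epsilon>) * ?w (U l) B)"
      "?w (U (Suc l)) (insert l B) = \<epsilon> * ((1 - \<epsilon>) * ?w (U l) B)"
      "?w (U (Suc l)) (insert (m + l) B) = (1 - \<epsilon>) * (\<epsilon> * ?w (U l) B)"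
      "?w (U (Suc l)) (insert l (insert (m + l) B)) = \<epsilon> * (\<epsilon> * ?w (U l) B)" if B: "B \<subseteq> U l" for B
      unfolding U using fin nin B by (auto simp: flag_weight_insert subset_insertI2)
    have "(\<Sum>B\<in>Pow (U (Suc l)). ?w (U (Suc l)) B * (1 / 2) ^ d (Suc l) B) =
      (\<Sum>B\<in>Pow (U l). ?w (U (Suc l)) B * (1 / 2) ^ d (Suc l) B + ?w (U (Suc l)) (insert l B) * (1 / 2) ^ d (Suc l) (insert l B) +
         (?w (U (Suc l)) (insert (m + l) B) * (1 / 2) ^ d (Suc l) (insert (m + l) B) +
          ?w (U (Suc l)) (insert l (insert (m + l) B)) * (1 / 2) ^ d (Suc l) (insert l (insert (m + l) B))))"
      unfolding U using fin nin by (subst sum_Pow_insert, simp, simp, subst sum_Pow_insert, simp_all)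
    also have "\<dots> = (\<Sum>B\<in>Pow (U l). (1 - \<epsilon> * (1 - \<epsilon>)) * (?w (U l) B * (1 / 2) ^ d l B))"
      by (intro sum.cong refl) (simp add: w d, simp add: algebra_simps)
    also have "\<dots> = (1 - \<epsilon> * (1 - \<epsilon>)) ^ Suc l" using Suc by (simp add: sum_distrib_left[symmetric])
    finally show ?case .
  qed
  from this[of L] have "(\<Sum>B\<in>Pow (U L). flag_weight \<epsilon> (U L) B * (1 / 2) ^ d L B) = (1 - \<epsilon> * (1 - \<epsilon>)) ^ L" by simp
  moreover have "U L = {..<m + n}" by (auto simp: U_def R_def L_def)
  ultimately show ?thesis by (simp add: d_def discordance_def[abs_def] L_def)
qed

text \<open>Discordances of at least \<open>c\<close> contribute the first term; for smaller ones
  the ratio is at most 1, which the exponential weight dominates. The parameter \<open>c\<close>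
  makes the first term small before the sample sizes grow.\<close>

lemma sum_central_ratio_discordance_le:
  assumes \<epsilon>: "0 \<le> \<epsilon>" "\<epsilon> \<le> 1" and "0 < c"
  shows "(\<Sum>B\<in>Pow {..<m + n}. flag_weight \<epsilon> {..<m + n} B * central_ratio (discordance m n B)) \<le>
    1 / sqrt (real c) + 2 ^ c * (1 - \<epsilon> * (1 - \<epsilon>)) ^ min m n"
proof -
  let ?w = "flag_weight \<epsilon> {..<m + n}"
  have pt: "central_ratio d \<le> 1 / sqrt (real c) + 2 ^ c * (1 / 2) ^ d" for d
  proof (cases "c \<le> d")
    case True
    then have "central_ratio d \<le> 1 / sqrt (real d)" using assms by (intro central_ratio_le) simp
    also have "\<dots> \<le> 1 / sqrt (real c)" using True assms by (intro divide_left_mono) auto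
    finally show ?thesis by (rule order_trans) simp
  next
    case False
    have "central_ratio d \<le> 1"
    proof (cases "d = 0")
      case False
      then have "central_ratio d \<le> 1 / sqrt (real d)" by (intro central_ratio_le) simp
      also have "\<dots> \<le> 1" using False by simp
      finally show ?thesis .
    qed (simp add: central_ratio_def)
    also have "1 \<le> 2 ^ c * (1 / 2 :: real) ^ d"
    proof -
      have "(2::real) ^ d \<le> 2 ^ c" using False by (intro power_increasing) auto
      then show ?thesis by (simp add: power_divide)
    qed
    finally show ?thesis by (rule order_trans) simp
  qed
  have "(\<Sum>B\<in>Pow {..<m + n}. ?w B * central_ratio (discordance m n B)) \<le>
      (\<Sum>B\<in>Pow {..<m + n}. ?w B * (1 / sqrt (real c) + 2 ^ c * (1 / 2) ^ discordance m n B))"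
    by (intro sum_mono mult_left_mono pt flag_weight_nonneg \<epsilon>)
  also have "\<dots> = (\<Sum>B\<in>Pow {..<m + n}. ?w B) * (1 / sqrt (real c)) +
      2 ^ c * (\<Sum>B\<in>Pow {..<m + n}. ?w B * (1 / 2) ^ discordance m n B)"
    by (simp only: distrib_left sum.distrib sum_distrib_left sum_distrib_right mult.left_commute)
  also have "\<dots> = 1 / sqrt (real c) + 2 ^ c * (1 - \<epsilon> * (1 - \<epsilon>)) ^ min m n"
    by (simp only: sum_flag_weight_discordance sum_flag_weight finite_lessThan mult_1)
  finally show ?thesis .
qed

section \<open>Powerlessness of the energy test\<close>

lemma nn_integral_contaminate:
  assumes Q: "distribution_on Q" and G: "distribution_on G" and f: "f \<in> borel_measurable borel"
  shows "(\<integral>\<^sup>+x. f x \<partial>contaminate \<epsilon> Q G) =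
    ennreal (1 - \<epsilon>) * (\<integral>\<^sup>+x. f x \<partial>Q) + ennreal \<epsilon> * (\<integral>\<^sup>+x. f x \<partial>G)"
proof -
  have sets [simp]: "sets Q = sets borel" "sets G = sets borel" using Q G by (simp_all add: distribution_on_def)
  note [measurable_cong] = sets sets_contaminate
  have [simp]: "space Q = UNIV" "space G = UNIV" using sets[THEN sets_eq_imp_space_eq] by auto
  show ?thesis using f
  proof (induction f rule: borel_measurable_induct)
    case (cong f g)
    then have "f = g" by auto
    then show ?case using cong by simp
  next
    case (set A)
    then show ?case by (simp add: emeasure_contaminate)
  next
    case (mult f c)
    then show ?case by (simp add: nn_integral_cmult distrib_left mult_ac)
  next
    case (add f g)
    then show ?case by (simp add: nn_integral_add distrib_left add_ac)
  next
    case (seq U)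
    have inc: "incseq U" by fact
    have mono: "incseq (\<lambda>i. \<integral>\<^sup>+x. U i x \<partial>M)" for M
      using inc by (auto simp: incseq_def le_fun_def intro!: nn_integral_mono)
    have lim: "(\<integral>\<^sup>+x. (SUP i. U i x) \<partial>M) = (SUP i. \<integral>\<^sup>+x. U i x \<partial>M)" if "sets M = sets borel" for M
      using seq(1) measurable_cong_sets[OF that refl] by (intro nn_integral_monotone_convergence_SUP inc) auto
    have U: "(SUP i. U i) x = (SUP i. U i x)" for x by (simp add: image_comp)
    have IH: "(\<integral>\<^sup>+x. U i x \<partial>contaminate \<epsilon> Q G) =
        ennreal (1 - \<epsilon>) * (\<integral>\<^sup>+x. U i x \<partial>Q) + ennreal \<epsilon> * (\<integral>\<^sup>+x. U i x \<partial>G)" for i by fact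
    have "(SUP i. ennreal (1 - \<epsilon>) * (\<integral>\<^sup>+x. U i x \<partial>Q) + ennreal \<epsilon> * (\<integral>\<^sup>+x. U i x \<partial>G)) =
        (SUP i. ennreal (1 - \<epsilon>) * (\<integral>\<^sup>+x. U i x \<partial>Q)) + (SUP i. ennreal \<epsilon> * (\<integral>\<^sup>+x. U i x \<partial>G))"
      by (rule ennreal_SUP_add) (use mono in \<open>auto simp: incseq_def intro!: mult_left_mono\<close>)
    then show ?case
      unfolding U lim[OF sets(1)] lim[OF sets(2)] lim[OF sets_contaminate] IH SUP_mult_left_ennreal .
  qed
qed

text \<open>A product of mixtures is a mixture of products: draw the set of contaminated indices
  first, then each entry from its own component.\<close>

lemma nn_integral_PiM_contaminate:
  fixes Q :: "nat \<Rightarrow> 'a::euclidean_space measure"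
  assumes "finite I" and Q: "\<And>i. distribution_on (Q i)" and G: "distribution_on G" and \<epsilon>: "0 \<le> \<epsilon>" "\<epsilon> \<le> 1"
    and "f \<in> borel_measurable (\<Pi>\<^sub>M i\<in>I. borel)"
  shows "(\<integral>\<^sup>+x. f x \<partial>(\<Pi>\<^sub>M i\<in>I. contaminate \<epsilon> (Q i) G)) =
    (\<Sum>B\<in>Pow I. ennreal (flag_weight \<epsilon> I B) * (\<integral>\<^sup>+x. f x \<partial>(\<Pi>\<^sub>M i\<in>I. if i \<in> B then G else Q i)))"
  using assms(1,6)
proof (induction I arbitrary: f)
  case empty
  then show ?case by (simp add: flag_weight_def PiM_empty)
next
  case (insert k I)
  define C where "C i = contaminate \<epsilon> (Q i) G" for i
  define M where "M B i = (if i \<in> B then G else Q i)" for B i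
  have dM: "distribution_on (M B i)" for B i using Q G by (simp add: M_def)
  have dC: "distribution_on (C i)" for i unfolding C_def by (intro distribution_on_contaminate Q G \<epsilon>)
  have sM [simp, measurable_cong]: "sets (M B i) = sets borel" for B i using dM by (simp add: distribution_on_def)
  have sC [simp, measurable_cong]: "sets (C i) = sets borel" for i by (simp add: C_def)
  interpret C: product_sigma_finite C
    using dC by (simp add: product_sigma_finite_def distribution_on_def prob_space_imp_sigma_finite)
  interpret M: product_sigma_finite "M B" for B
    using dM by (simp add: product_sigma_finite_def distribution_on_def prob_space_imp_sigma_finite)
  have f [measurable]: "f \<in> borel_measurable (\<Pi>\<^sub>M i\<in>insert k I. borel)" by fact
  have cong: "sets (PiM J (M B)) = sets (\<Pi>\<^sub>M i\<in>J. borel)" "sets (PiM J C) = sets (\<Pi>\<^sub>M i\<in>J. borel)" for J B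
    by (auto intro!: sets_PiM_cong)
  have fM: "f \<in> borel_measurable (PiM (insert k I) (M B))" "f \<in> borel_measurable (PiM (insert k I) C)" for B
    using f measurable_cong_sets[OF cong(1) refl] measurable_cong_sets[OF cong(2) refl] by auto
  \<comment> \<open>Integrating out the new coordinate first lets it be split between
    \<open>Q k\<close> and \<open>G\<close>; the induction hypothesis then handles the remaining
    coordinates for the integrand so obtained.\<close>
  define h where "h P x = (\<integral>\<^sup>+y. f (x(k := y)) \<partial>P)" for P :: "'a measure" and x
  have hm: "h P \<in> borel_measurable (\<Pi>\<^sub>M i\<in>I. borel)" if P: "distribution_on P" for P
  proof -
    interpret P: prob_space P using P by (simp add: distribution_on_def)
    have [measurable_cong]: "sets P = sets borel" using P by (simp add: distribution_on_def)
    have "(\<lambda>(x, y). x(k := y)) \<in> measurable ((\<Pi>\<^sub>M i\<in>I. borel) \<Otimes>\<^sub>M P) (\<Pi>\<^sub>M i\<in>insert k I. borel)"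
      using measurable_add_dim[of k I "\<lambda>_. borel :: 'a measure"] by measurable
    from measurable_compose[OF this f]
    show ?thesis unfolding h_def by (intro P.borel_measurable_nn_integral) (simp add: split_beta')
  qed
  have hI: "h P \<in> borel_measurable (PiM I (M B))" if "distribution_on P" for P B
    using hm[OF that] measurable_cong_sets[OF cong(1) refl] by auto
  have "(\<integral>\<^sup>+x. f x \<partial>PiM (insert k I) C) = (\<integral>\<^sup>+x. h (C k) x \<partial>PiM I C)"
    unfolding h_def by (rule C.product_nn_integral_insert) (use insert fM in auto)
  also have "\<dots> = (\<integral>\<^sup>+x. ennreal (1 - \<epsilon>) * h (Q k) x + ennreal \<epsilon> * h G x \<partial>PiM I C)"
  proof (rule nn_integral_cong)
    fix x assume "x \<in> space (PiM I C)"
    then have "x \<in> space (\<Pi>\<^sub>M i\<in>I. borel)" using sets_eq_imp_space_eq[OF cong(2)] by simp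
    then have "(\<lambda>y. x(k := y)) \<in> measurable borel (\<Pi>\<^sub>M i\<in>insert k I. borel)"
      by (intro measurable_fun_upd[where J = I]) auto
    from measurable_compose[OF this f] show "h (C k) x = ennreal (1 - \<epsilon>) * h (Q k) x + ennreal \<epsilon> * h G x"
      unfolding h_def C_def by (intro nn_integral_contaminate Q G)
  qed
  also have "\<dots> = (\<Sum>B\<in>Pow I. ennreal (flag_weight \<epsilon> I B) *
      (\<integral>\<^sup>+x. ennreal (1 - \<epsilon>) * h (Q k) x + ennreal \<epsilon> * h G x \<partial>PiM I (M B)))"
    unfolding C_def[abs_def] M_def[abs_def]
    by (rule insert.IH) (use hm Q G in \<open>auto intro!: borel_measurable_add borel_measurable_times_ennreal\<close>)
  also have "\<dots> = (\<Sum>B\<in>Pow I. ennreal (flag_weight \<epsilon> (insert k I) B) * (\<integral>\<^sup>+x. f x \<partial>PiM (insert k I) (M B)) +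
      ennreal (flag_weight \<epsilon> (insert k I) (insert k B)) * (\<integral>\<^sup>+x. f x \<partial>PiM (insert k I) (M (insert k B))))"
  proof (rule sum.cong[OF refl])
    fix B assume "B \<in> Pow I"
    then have B: "B \<subseteq> I" "k \<notin> B" using insert by auto
    have e1: "(\<integral>\<^sup>+x. f x \<partial>PiM (insert k I) (M B)) = (\<integral>\<^sup>+x. h (Q k) x \<partial>PiM I (M B))"
      unfolding h_def using M.product_nn_integral_insert[of I k f B] insert fM B by (simp add: M_def)
    have "PiM I (M (insert k B)) = PiM I (M B)" using insert by (intro PiM_cong) (auto simp: M_def)
    then have e2: "(\<integral>\<^sup>+x. f x \<partial>PiM (insert k I) (M (insert k B))) = (\<integral>\<^sup>+x. h G x \<partial>PiM I (M B))"
      unfolding h_def using M.product_nn_integral_insert[of I k f "insert k B"] insert fM by (simp add: M_def)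
    have "(\<integral>\<^sup>+x. ennreal (1 - \<epsilon>) * h (Q k) x + ennreal \<epsilon> * h G x \<partial>PiM I (M B)) =
        ennreal (1 - \<epsilon>) * (\<integral>\<^sup>+x. h (Q k) x \<partial>PiM I (M B)) + ennreal \<epsilon> * (\<integral>\<^sup>+x. h G x \<partial>PiM I (M B))"
      using hI[OF Q, of k B] hI[OF G, of B] by (simp add: nn_integral_add nn_integral_cmult)
    then show "ennreal (flag_weight \<epsilon> I B) * (\<integral>\<^sup>+x. ennreal (1 - \<epsilon>) * h (Q k) x + ennreal \<epsilon> * h G x \<partial>PiM I (M B)) =
        ennreal (flag_weight \<epsilon> (insert k I) B) * (\<integral>\<^sup>+x. f x \<partial>PiM (insert k I) (M B)) +
        ennreal (flag_weight \<epsilon> (insert k I) (insert k B)) * (\<integral>\<^sup>+x. f x \<partial>PiM (insert k I) (M (insert k B)))"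
      unfolding e1 e2 flag_weight_insert[OF insert.hyps B(1)]
      using \<epsilon> flag_weight_nonneg[OF \<epsilon>, of I B] by (simp add: ennreal_mult distrib_left mult_ac)
  qed
  also have "\<dots> = (\<Sum>B\<in>Pow (insert k I). ennreal (flag_weight \<epsilon> (insert k I) B) * (\<integral>\<^sup>+x. f x \<partial>PiM (insert k I) (M B)))"
    by (rule sum_Pow_insert[symmetric]) (use insert in auto)
  finally show ?case unfolding C_def[abs_def] M_def[abs_def] .
qed

lemma distribution_tail_small:
  fixes Q :: "'a::euclidean_space measure"
  assumes Q: "distribution_on Q" and "0 < e"
  shows "\<exists>r0. \<forall>r\<ge>r0. measure Q {x. r < norm x} \<le> e"
proof -
  interpret Q: prob_space Q using Q by (simp add: distribution_on_def)
  have s [simp, measurable_cong]: "sets Q = sets borel" using Q by (simp add: distribution_on_def)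
  have "(\<lambda>k. measure Q {x. real k < norm x}) \<longlonglongrightarrow> measure Q (\<Inter>k. {x. real k < norm x})"
    by (rule Q.finite_Lim_measure_decseq) (auto simp: decseq_def)
  moreover have "(\<Inter>k. {x::'a. real k < norm x}) = {}"
  proof -
    have "x \<notin> (\<Inter>k. {x::'a. real k < norm x})" for x
    proof -
      obtain k where "norm x \<le> real k" using real_arch_simple by blast
      then show ?thesis by (auto simp: not_less intro!: exI[of _ k])
    qed
    then show ?thesis by blast
  qed
  ultimately have "(\<lambda>k. measure Q {x. real k < norm x}) \<longlonglongrightarrow> 0" by simp
  then have "\<forall>\<^sub>F k in sequentially. measure Q {x. real k < norm x} < e" using \<open>0 < e\<close> by (rule order_tendstoD(2))
  then obtain k where k: "measure Q {x. real k < norm x} < e" by (auto simp: eventually_sequentially)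
  have "measure Q {x. r < norm x} \<le> e" if "real k \<le> r" for r
  proof -
    have "measure Q {x. r < norm x} \<le> measure Q {x. real k < norm x}"
      by (rule Q.finite_measure_mono) (use that in auto)
    then show ?thesis using k by simp
  qed
  then show ?thesis by blast
qed

lemma finite_real_gap:
  fixes V :: "real set"
  assumes "finite V"
  shows "\<exists>\<gamma>>0. \<forall>v\<in>V. \<forall>v'\<in>V. v < v' \<longrightarrow> v + \<gamma> \<le> v'"
proof -
  \<comment> \<open>The 1 keeps the set nonempty when no two values differ.\<close>
  define W where "W = insert 1 {v' - v |v v'. v \<in> V \<and> v' \<in> V \<and> v < v'}"
  have "{v' - v |v v'. v \<in> V \<and> v' \<in> V \<and> v < v'} \<subseteq> (\<lambda>(v, v'). v' - v) ` (V \<times> V)" by auto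
  then have W: "finite W" unfolding W_def using assms finite_subset by blast
  have "0 < Min W" using W by (subst Min_gr_iff) (auto simp: W_def)
  moreover have "v + Min W \<le> v'" if "v \<in> V" "v' \<in> V" "v < v'" for v v'
  proof -
    have "Min W \<le> v' - v" using W that by (intro Min_le) (auto simp: W_def)
    then show ?thesis by simp
  qed
  ultimately show ?thesis by blast
qed

text \<open>The contamination must stay concentrated, as seen from afar, and yet admissible. A point
  mass would give the projections an atom; a uniform law on a ball has atomless projections in every
  nonzero direction.\<close>

lemma
  fixes a :: "'a::euclidean_space"
  defines "G \<equiv> uniform_measure lborel (ball a 1)"
  shows distribution_on_uniform_ball: "distribution_on G"
    and uniform_ball_outside: "emeasure G (- ball a 1) = 0"
    and uniform_ball_contamination: "\<And>Q \<epsilon>. distribution_on Q \<Longrightarrow> continuous_projections Q \<Longrightarrow> 0 \<le> \<epsilon> \<Longrightarrow> \<epsilon> \<le> 1 \<Longrightarrow>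
      continuous_projections (contaminate \<epsilon> Q G)"
proof -
  have ball: "emeasure lborel (ball a 1) \<noteq> 0" "emeasure lborel (ball a 1) \<noteq> \<infinity>"
  proof -
    have "emeasure lborel (ball a 1) = ennreal (measure lborel (ball a 1))"
      using emeasure_lborel_ball_finite[of a 1] by (simp add: emeasure_eq_ennreal_measure)
    moreover have "measure lborel (ball a 1) > 0" by (rule content_ball_pos) simp
    ultimately show "emeasure lborel (ball a 1) \<noteq> 0" "emeasure lborel (ball a 1) \<noteq> \<infinity>" by simp_all
  qed
  show G: "distribution_on G"
    unfolding distribution_on_def G_def using ball by (auto intro!: prob_space_uniform_measure)
  interpret G: prob_space G using G by (simp add: distribution_on_def)
  have s [simp, measurable_cong]: "sets G = sets borel" by (simp add: G_def)
  have "- ball a 1 \<inter> ball a 1 = {}" by auto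
  then show "emeasure G (- ball a 1) = 0" unfolding G_def by (subst emeasure_uniform_measure) (auto simp: Int_commute)
  fix Q :: "'a measure" and \<epsilon> :: real
  assume Q: "distribution_on Q" "continuous_projections Q" and \<epsilon>: "0 \<le> \<epsilon>" "\<epsilon> \<le> 1"
  obtain u :: 'a where u: "u \<in> Basis" using nonempty_Basis by blast
  then have "u \<noteq> 0" by auto
  show "continuous_projections (contaminate \<epsilon> Q G)"
    using Q(2)[unfolded continuous_projections_def] AE_uniform_sphere_inner_nonzero[OF \<open>u \<noteq> 0\<close>]
    unfolding continuous_projections_def
  proof eventually_elim
    case (elim b)
    then have b: "b \<noteq> 0" by auto
    interpret R: real_distribution "distr G borel (\<lambda>x. b \<bullet> x)" by (rule real_distribution_distr_inner[OF G])
    have "measure (distr G borel (\<lambda>x. b \<bullet> x)) {c} = 0" for c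
    proof -
      have "negligible {x. b \<bullet> x = c}" using b by (intro negligible_hyperplane) simp
      then have "emeasure lborel {x. b \<bullet> x = c} = 0" by (simp add: negligible_iff_null_sets null_sets_def)
      then have "emeasure lborel (ball a 1 \<inter> {x. b \<bullet> x = c}) = 0"
        by (rule emeasure_eq_0[where N = "{x. b \<bullet> x = c}", rotated]) auto
      then have "emeasure G {x. b \<bullet> x = c} = 0" unfolding G_def by (subst emeasure_uniform_measure) auto
      then have "measure G {x. b \<bullet> x = c} = 0" by (simp add: measure_def)
      then show ?thesis by (subst measure_distr) (simp_all add: vimage_def G_def)
    qed
    then have "continuous_on UNIV (cdf (distr G borel (\<lambda>x. b \<bullet> x)))"
      using R.isCont_cdf by (simp add: continuous_on_eq_continuous_at)
    then have "continuous_on UNIV (\<lambda>t. (1 - \<epsilon>) * cdf (distr Q borel (\<lambda>x. b \<bullet> x)) t + \<epsilon> * cdf (distr G borel (\<lambda>x. b \<bullet> x)) t)"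
      using elim(1) by (intro continuous_intros)
    moreover have "cdf (distr (contaminate \<epsilon> Q G) borel (\<lambda>x. b \<bullet> x)) =
        (\<lambda>t. (1 - \<epsilon>) * cdf (distr Q borel (\<lambda>x. b \<bullet> x)) t + \<epsilon> * cdf (distr G borel (\<lambda>x. b \<bullet> x)) t)"
      using distribution_on_contaminate[OF Q(1) G \<epsilon>]
      by (auto simp: cdf_distr_eq_proj_cdf Q(1) G proj_cdf_contaminate[OF Q(1) G \<epsilon>])
    ultimately show ?case by simp
  qed
qed

text \<open>When the contaminated points cluster around a single very distant point, the energy
  statistic of every permutation is determined, up to a smaller order, by which entries are
  contaminated.\<close>

lemma perm_test_energy_imp_flag_reject:
  fixes z :: "nat \<Rightarrow> 'a::euclidean_space"
  assumes mn: "2 \<le> m" "2 \<le> n" and \<alpha>: "0 < \<alpha>" "\<alpha> < 1" and "0 \<le> R" and a: "norm a = R"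
    and z: "\<And>i. i < m + n \<Longrightarrow> norm (z i - (if i \<in> B then a else 0)) \<le> r"
    and B: "B \<subseteq> {..<m + n}"
    and gap: "\<And>C C'. C \<subseteq> {..<m + n} \<Longrightarrow> C' \<subseteq> {..<m + n} \<Longrightarrow> flag_energy m n C < flag_energy m n C' \<Longrightarrow>
      R * flag_energy m n C + 16 * r < R * flag_energy m n C'"
    and reject: "perm_test U_Energy \<alpha> m n z = 1"
  shows "flag_reject \<alpha> m n B"
proof -
  define \<beta> where "\<beta> p = (of_bool (p \<in> B) :: real)" for p
  have zb: "\<bar>norm (z p - z q) - R * norm (\<beta> p - \<beta> q)\<bar> \<le> 2 * r" if pq: "p < m + n" "q < m + n" for p q
  proof -
    let ?a = "\<lambda>p. if p \<in> B then a else 0"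
    have "norm (?a p - ?a q) = R * norm (\<beta> p - \<beta> q)" using a by (simp add: \<beta>_def)
    moreover have "\<bar>norm (z p - z q) - norm (?a p - ?a q)\<bar> \<le> norm ((z p - z q) - (?a p - ?a q))"
      by (rule norm_triangle_ineq3)
    moreover have "(z p - z q) - (?a p - ?a q) = (z p - ?a p) - (z q - ?a q)" by simp
    moreover have "norm ((z p - ?a p) - (z q - ?a q)) \<le> 2 * r"
      using z[OF pq(1)] z[OF pq(2)] norm_triangle_ineq4[of "z p - ?a p" "z q - ?a q"] by linarith
    ultimately show ?thesis by (simp only:)
  qed
  \<comment> \<open>Each distance is off by at most \<open>2 * r\<close>, and the total weight 4
    turns this into \<open>8 * r\<close>. The two statistics compared below account for the
    \<open>16 * r\<close> in \<open>gap\<close>.\<close>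
  have approx: "\<bar>pooled U_Energy m n (z \<circ> \<pi>) - R * flag_energy m n (\<pi> -` B)\<bar> \<le> 8 * r"
    if \<pi>: "\<pi> permutes {..<m + n}" for \<pi>
  proof -
    have mem: "\<pi> p < m + n" if "p < m + n" for p using permutes_in_image[OF \<pi>, of p] that by simp
    have "\<bar>U_Energy m n (z \<circ> \<pi>) (\<lambda>j. (z \<circ> \<pi>) (m + j)) - R * U_Energy m n (\<beta> \<circ> \<pi>) (\<lambda>j. (\<beta> \<circ> \<pi>) (m + j))\<bar> \<le> 4 * (2 * r)"
      by (rule U_Energy_perturbation[OF mn]) (simp_all add: zb[unfolded real_norm_def] mem)
    moreover have "flag_energy m n (\<pi> -` B) = U_Energy m n (\<beta> \<circ> \<pi>) (\<lambda>j. (\<beta> \<circ> \<pi>) (m + j))"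
      by (simp add: flag_energy_def pooled_def \<beta>_def[abs_def] o_def)
    ultimately show ?thesis by (simp add: pooled_def)
  qed
  have sub: "{\<pi>. \<pi> permutes {..<m + n} \<and> pooled U_Energy m n (z \<circ> \<pi>) < pooled U_Energy m n z} \<subseteq>
      {\<pi>. \<pi> permutes {..<m + n} \<and> flag_energy m n (\<pi> -` B) \<le> flag_energy m n B}"
  proof (clarify, rule ccontr)
    fix \<pi> assume \<pi>: "\<pi> permutes {..<m + n}" and lt: "pooled U_Energy m n (z \<circ> \<pi>) < pooled U_Energy m n z"
      and nle: "\<not> flag_energy m n (\<pi> -` B) \<le> flag_energy m n B"
    have "\<pi> -` B \<subseteq> {..<m + n}" using B permutes_in_image[OF \<pi>] by blast
    from gap[OF B this] nle have "R * flag_energy m n B + 16 * r < R * flag_energy m n (\<pi> -` B)" by simp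
    moreover have "\<bar>pooled U_Energy m n z - R * flag_energy m n B\<bar> \<le> 8 * r"
      using approx[OF permutes_id] by simp
    ultimately show False using approx[OF \<pi>] lt by linarith
  qed
  have "card {\<pi>. \<pi> permutes {..<m + n} \<and> pooled U_Energy m n (z \<circ> \<pi>) < pooled U_Energy m n z} \<le>
      card {\<pi>. \<pi> permutes {..<m + n} \<and> flag_energy m n (\<pi> -` B) \<le> flag_energy m n B}"
    using sub by (rule card_mono[rotated]) (auto intro: finite_subset[OF _ finite_permutations[of "{..<m + n}"]])
  moreover have "(1 - \<alpha>) * fact (m + n) \<le>
      real (card {\<pi>. \<pi> permutes {..<m + n} \<and> pooled U_Energy m n (z \<circ> \<pi>) < pooled U_Energy m n z})"
    using reject by (simp add: perm_test_eq[OF \<alpha>] split: if_splits)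
  ultimately show ?thesis unfolding flag_reject_def by linarith
qed

text \<open>The choices are made in this order: a radius \<open>r\<close> that contains all clean
  points with probability at least \<open>1 - 1 / N\<close>, then the smallest gap
  \<open>\<gamma>\<close> between flag energies, then a distance \<open>R\<close> at which this gap
  outweighs the remainder.\<close>

lemma energy_power_le:
  fixes QX QY :: "'a::euclidean_space measure"
  assumes mn: "2 \<le> m" "2 \<le> n" and \<alpha>: "0 < \<alpha>" "\<alpha> < 1" and \<epsilon>: "0 \<le> \<epsilon>" "\<epsilon> \<le> 1"
    and Q: "distribution_on QX" "distribution_on QY" "continuous_projections QX" "continuous_projections QY"
  shows "\<exists>G\<in>contaminations \<epsilon> QX QY. test_power U_Energy \<alpha> \<epsilon> QX QY m n G \<le>
    \<alpha> + 2 * (\<Sum>B\<in>Pow {..<m + n}. flag_weight \<epsilon> {..<m + n} B * central_ratio (discordance m n B)) + 1 / real (m + n)"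
proof -
  define N where "N = m + n"
  have N: "0 < N" using mn by (simp add: N_def)
  \<comment> \<open>The square pays for the union bound over all \<open>N\<close> entries, which
    leaves \<open>1 / N\<close>.\<close>
  define e where "e = 1 / (real N * real N)"
  have e: "0 < e" using N by (simp add: e_def)
  obtain rX rY where rX: "\<And>r. r \<ge> rX \<Longrightarrow> measure QX {x. r < norm x} \<le> e"
    and rY: "\<And>r. r \<ge> rY \<Longrightarrow> measure QY {x. r < norm x} \<le> e"
    using distribution_tail_small[OF Q(1) e] distribution_tail_small[OF Q(2) e] by blast
  \<comment> \<open>The 1 covers the contaminated entries, which lie within the unit ball around
    \<open>a\<close>.\<close>
  define r where "r = max 1 (max rX rY)"
  have r: "1 \<le> r" "rX \<le> r" "rY \<le> r" by (auto simp: r_def)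
  have "finite (flag_energy m n ` Pow {..<m + n})" by simp
  then obtain \<gamma> where \<gamma>: "0 < \<gamma>" and gap0: "\<And>C C'. C \<subseteq> {..<m + n} \<Longrightarrow> C' \<subseteq> {..<m + n} \<Longrightarrow>
      flag_energy m n C < flag_energy m n C' \<Longrightarrow> flag_energy m n C + \<gamma> \<le> flag_energy m n C'"
    using finite_real_gap[of "flag_energy m n ` Pow {..<m + n}"] by auto
  \<comment> \<open>Anything above 16 works: the scaled gap \<open>R * \<gamma>\<close> has to
    exceed \<open>16 * r\<close> strictly.\<close>
  define R where "R = 17 * r / \<gamma>"
  have R: "0 < R" "R * \<gamma> = 17 * r" using \<gamma> r by (auto simp: R_def)
  have gap: "R * flag_energy m n C + 16 * r < R * flag_energy m n C'"
    if "C \<subseteq> {..<m + n}" "C' \<subseteq> {..<m + n}" "flag_energy m n C < flag_energy m n C'" for C C'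
  proof -
    have "R * (flag_energy m n C + \<gamma>) \<le> R * flag_energy m n C'" using gap0[OF that] R by (intro mult_left_mono) auto
    then show ?thesis using R r by (simp add: distrib_left)
  qed
  obtain u :: 'a where u: "u \<in> Basis" using nonempty_Basis by blast
  define a where "a = R *\<^sub>R u"
  have a: "norm a = R" using u R by (simp add: a_def)
  define G where "G = uniform_measure lborel (ball a 1)"
  have G: "distribution_on G" unfolding G_def by (rule distribution_on_uniform_ball)
  have GC: "G \<in> contaminations \<epsilon> QX QY"
    unfolding contaminations_def using G Q \<epsilon> uniform_ball_contamination[of _ \<epsilon> a] by (simp add: G_def)
  define QQ where "QQ i = (if i < m then QX else QY)" for i
  have QQ: "distribution_on (QQ i)" for i using Q by (simp add: QQ_def)
  define Z where "Z = (\<Pi>\<^sub>M i\<in>{..<m + n}. contaminate \<epsilon> (QQ i) G)"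
  have Z: "pooled_law (contaminate \<epsilon> QX G) (contaminate \<epsilon> QY G) m n = Z"
    unfolding pooled_law_def Z_def QQ_def by (intro PiM_cong) auto
  let ?T = "perm_test U_Energy \<alpha> m n :: (nat \<Rightarrow> 'a) \<Rightarrow> real"
  have T01: "?T z = 0 \<or> ?T z = 1" for z by (simp add: perm_test_def)
  have Tm: "?T \<in> borel_measurable (\<Pi>\<^sub>M i\<in>{..<m + n}. borel)"
  proof (rule measurable_perm_test[OF \<alpha>], rule measurable_pooled_U_Energy)
    fix \<pi> q assume "\<pi> permutes {..<m + n}" "q < m + n"
    then have "\<pi> q \<in> {..<m + n}" using permutes_in_image[of \<pi> "{..<m + n}" q] by simp
    then show "(\<lambda>z. (z \<circ> \<pi>) q) \<in> borel_measurable (\<Pi>\<^sub>M i\<in>{..<m + n}. borel)" by simp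
  qed
  define w where "w = flag_weight \<epsilon> {..<m + n}"
  have w: "0 \<le> w B" for B unfolding w_def using \<epsilon> by (rule flag_weight_nonneg)
  define M where "M B i = (if i \<in> B then G else QQ i)" for B i
  define Out where "Out B i = (if i \<in> B then - ball a 1 else {x. r < norm x})" for B :: "nat set" and i :: nat
  have inner: "(\<integral>\<^sup>+z. ennreal (?T z) \<partial>PiM {..<m + n} (M B)) \<le> ennreal (of_bool (flag_reject \<alpha> m n B) + 1 / real N)"
    if B: "B \<in> Pow {..<m + n}" for B
  proof -
    have dM: "distribution_on (M B i)" for i using QQ G by (simp add: M_def)
    have pM: "prob_space (M B i)" for i using dM by (simp add: distribution_on_def)
    interpret M: product_prob_space "M B" "{..<m + n}"
      using pM by (simp add: product_prob_space_def product_prob_space_axioms_def product_sigma_finite_def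
          prob_space_imp_sigma_finite)
    have sM [simp, measurable_cong]: "sets (M B i) = sets borel" for i using dM by (simp add: distribution_on_def)
    have outm: "Out B i \<in> sets (M B i)" for i by (auto simp: Out_def)
    have out: "emeasure (M B i) (Out B i) \<le> ennreal e" for i
    proof (cases "i \<in> B")
      case True
      then show ?thesis using uniform_ball_outside[of a] by (simp add: M_def Out_def G_def)
    next
      case False
      have "measure (M B i) (Out B i) \<le> e" using False rX[of r] rY[of r] r by (simp add: M_def Out_def QQ_def)
      then show ?thesis
        by (simp add: finite_measure.emeasure_eq_measure[OF prob_space.finite_measure[OF pM]] ennreal_leI)
    qed
    have S: "{z \<in> space (PiM {..<m + n} (M B)). z i \<in> Out B i} \<in> sets (PiM {..<m + n} (M B))" if "i < m + n" for i
      using measurable_sets[OF measurable_component_singleton[of i "{..<m + n}" "M B"] outm[of i]] that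
      by (simp add: vimage_def Int_def conj_commute)
    have pt: "ennreal (?T z) \<le> ennreal (of_bool (flag_reject \<alpha> m n B)) +
        (\<Sum>i<m + n. indicator {z \<in> space (PiM {..<m + n} (M B)). z i \<in> Out B i} z)"
      if z: "z \<in> space (PiM {..<m + n} (M B))" for z
    proof (cases "\<exists>i<m + n. z i \<in> Out B i")
      case True
      then obtain i where i: "i < m + n" "z i \<in> Out B i" by blast
      have "ennreal (?T z) \<le> 1" using T01[of z] by auto
      also have "1 = (\<Sum>j\<in>{i}. indicator {z \<in> space (PiM {..<m + n} (M B)). z j \<in> Out B j} z :: ennreal)"
        using i z by simp
      also have "\<dots> \<le> (\<Sum>i<m + n. indicator {z \<in> space (PiM {..<m + n} (M B)). z i \<in> Out B i} z)"
        using i by (intro sum_mono2) auto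
      finally show ?thesis by (rule order_trans) simp
    next
      case False
      have "flag_reject \<alpha> m n B" if "?T z = 1"
      proof (rule perm_test_energy_imp_flag_reject[OF mn \<alpha> less_imp_le[OF R(1)] a _ _ gap that])
        fix i assume "i < m + n"
        then have "z i \<notin> Out B i" using False by blast
        then show "norm (z i - (if i \<in> B then a else 0)) \<le> r"
          using r by (auto simp: Out_def dist_norm norm_minus_commute split: if_splits)
      qed (use B in auto)
      then have "?T z \<le> of_bool (flag_reject \<alpha> m n B)" using T01[of z] by auto
      then have "ennreal (?T z) \<le> ennreal (of_bool (flag_reject \<alpha> m n B))" by (rule ennreal_leI)
      then show ?thesis by (rule order_trans) simp
    qed
    have "(\<integral>\<^sup>+z. ennreal (?T z) \<partial>PiM {..<m + n} (M B)) \<le>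
        (\<integral>\<^sup>+z. ennreal (of_bool (flag_reject \<alpha> m n B)) +
          (\<Sum>i<m + n. indicator {z \<in> space (PiM {..<m + n} (M B)). z i \<in> Out B i} z) \<partial>PiM {..<m + n} (M B))"
      by (rule nn_integral_mono) (rule pt)
    also have "\<dots> = ennreal (of_bool (flag_reject \<alpha> m n B)) +
        (\<Sum>i<m + n. emeasure (PiM {..<m + n} (M B)) {z \<in> space (PiM {..<m + n} (M B)). z i \<in> Out B i})"
    proof -
      have "(\<integral>\<^sup>+z. (\<Sum>i<m + n. indicator {z \<in> space (PiM {..<m + n} (M B)). z i \<in> Out B i} z) \<partial>PiM {..<m + n} (M B)) =
          (\<Sum>i<m + n. \<integral>\<^sup>+z. indicator {z \<in> space (PiM {..<m + n} (M B)). z i \<in> Out B i} z \<partial>PiM {..<m + n} (M B))"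
        by (rule nn_integral_sum) (use S in auto)
      then show ?thesis using S by (subst nn_integral_add) (auto simp: M.P.emeasure_space_1)
    qed
    also have "\<dots> = ennreal (of_bool (flag_reject \<alpha> m n B)) + (\<Sum>i<m + n. emeasure (M B i) (Out B i))"
      using outm by (intro arg_cong2[where f = "(+)"] sum.cong refl M.emeasure_PiM_Collect_single) auto
    also have "\<dots> \<le> ennreal (of_bool (flag_reject \<alpha> m n B)) + (\<Sum>i<m + n. ennreal e)"
      by (intro add_left_mono sum_mono out)
    also have "(\<Sum>i<m + n. ennreal e) = ennreal (1 / real N)"
    proof -
      have "(\<Sum>i<m + n. ennreal e) = ennreal (\<Sum>i<m + n. e)" using e by (intro sum_ennreal) simp
      also have "(\<Sum>i<m + n. e) = 1 / real N" using N by (simp add: e_def N_def[symmetric])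
      finally show ?thesis .
    qed
    finally show ?thesis by (simp add: ennreal_plus[symmetric] del: ennreal_plus)
  qed
  have "(\<integral>\<^sup>+z. ennreal (?T z) \<partial>Z) = (\<Sum>B\<in>Pow {..<m + n}. ennreal (w B) * (\<integral>\<^sup>+z. ennreal (?T z) \<partial>PiM {..<m + n} (M B)))"
    unfolding Z_def w_def M_def[abs_def]
    by (rule nn_integral_PiM_contaminate[OF _ QQ G \<epsilon>]) (use Tm in auto)
  also have "\<dots> \<le> (\<Sum>B\<in>Pow {..<m + n}. ennreal (w B) * ennreal (of_bool (flag_reject \<alpha> m n B) + 1 / real N))"
    by (intro sum_mono mult_left_mono inner) auto
  also have "\<dots> = ennreal (\<Sum>B\<in>Pow {..<m + n}. w B * (of_bool (flag_reject \<alpha> m n B) + 1 / real N))"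
    using w by (subst sum_ennreal[symmetric]) (auto simp: ennreal_mult intro!: mult_nonneg_nonneg)
  finally have le: "(\<integral>\<^sup>+z. ennreal (?T z) \<partial>Z) \<le> ennreal (\<Sum>B\<in>Pow {..<m + n}. w B * (of_bool (flag_reject \<alpha> m n B) + 1 / real N))" .
  have "sets Z = sets (\<Pi>\<^sub>M i\<in>{..<m + n}. borel)" unfolding Z_def by (intro sets_PiM_cong) auto
  then have "?T \<in> borel_measurable Z" using Tm measurable_cong_sets[OF _ refl] by blast
  then have "(\<integral>z. ?T z \<partial>Z) = enn2real (\<integral>\<^sup>+z. ennreal (?T z) \<partial>Z)"
    by (rule integral_eq_nn_integral) (simp add: perm_test_def)
  also have "\<dots> \<le> (\<Sum>B\<in>Pow {..<m + n}. w B * (of_bool (flag_reject \<alpha> m n B) + 1 / real N))"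
    using w le by (intro enn2real_leI sum_nonneg mult_nonneg_nonneg) auto
  also have "\<dots> = (\<Sum>B\<in>Pow {..<m + n}. w B * of_bool (flag_reject \<alpha> m n B)) + (\<Sum>B\<in>Pow {..<m + n}. w B) * (1 / real N)"
    by (simp only: distrib_left sum.distrib sum_distrib_right)
  also have "(\<Sum>B\<in>Pow {..<m + n}. w B) = 1" unfolding w_def by (rule sum_flag_weight) simp
  also have "(\<Sum>B\<in>Pow {..<m + n}. w B * of_bool (flag_reject \<alpha> m n B)) \<le>
      \<alpha> + 2 * (\<Sum>B\<in>Pow {..<m + n}. w B * central_ratio (discordance m n B))"
    unfolding w_def by (rule sum_flag_reject_le[OF mn \<alpha>(1) \<epsilon>])
  finally have "(\<integral>z. ?T z \<partial>Z) \<le>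
      \<alpha> + 2 * (\<Sum>B\<in>Pow {..<m + n}. w B * central_ratio (discordance m n B)) + 1 / real N" by simp
  then show ?thesis using GC unfolding test_power_def Z[symmetric] w_def N_def by blast
qed

section \<open>Asymptotics\<close>

lemma test_power_bounds: "0 \<le> test_power T \<alpha> \<epsilon> QX QY m n G"
  and test_power_le_1:
    "distribution_on QX \<Longrightarrow> distribution_on QY \<Longrightarrow> distribution_on G \<Longrightarrow> 0 \<le> \<epsilon> \<Longrightarrow> \<epsilon> \<le> 1 \<Longrightarrow>
      test_power T \<alpha> \<epsilon> QX QY m n G \<le> 1"
proof -
  let ?Z = "pooled_law (contaminate \<epsilon> QX G) (contaminate \<epsilon> QY G) m n"
  show "0 \<le> test_power T \<alpha> \<epsilon> QX QY m n G"
    unfolding test_power_def by (rule integral_nonneg_AE) (simp add: perm_test_def)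
  assume "distribution_on QX" "distribution_on QY" "distribution_on G" "0 \<le> \<epsilon>" "\<epsilon> \<le> 1"
  then have "distribution_on (contaminate \<epsilon> QX G)" "distribution_on (contaminate \<epsilon> QY G)"
    by (auto intro: distribution_on_contaminate)
  then interpret Z: prob_space ?Z
    unfolding pooled_law_def by (intro prob_space_PiM) (auto simp: distribution_on_def)
  show "test_power T \<alpha> \<epsilon> QX QY m n G \<le> 1"
  proof (cases "integrable ?Z (perm_test T \<alpha> m n)")
    case True
    then show ?thesis unfolding test_power_def
      by (rule Z.integral_le_const) (simp add: perm_test_def)
  next
    \<comment> \<open>By convention the integral of a function that is not integrable is 0.\<close>
    case False
    then show ?thesis by (simp add: test_power_def not_integrable_integral_eq)
  qed
qed

text \<open>Both mixtures contain the same \<open>G\<close>, so it cancels in the difference of the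
  projected distribution functions.\<close>

lemma proj_discrepancy_contaminate:
  assumes "distribution_on QX" "distribution_on QY" "distribution_on G" "0 \<le> \<epsilon>" "\<epsilon> \<le> 1"
  shows "proj_discrepancy (contaminate \<epsilon> QX G) (contaminate \<epsilon> QY G) x = (1 - \<epsilon>)\<^sup>2 * proj_discrepancy QX QY x"
proof -
  have "(proj_cdf (contaminate \<epsilon> QX G) b t - proj_cdf (contaminate \<epsilon> QY G) b t)\<^sup>2 =
      (1 - \<epsilon>)\<^sup>2 * (proj_cdf QX b t - proj_cdf QY b t)\<^sup>2" for b t
    using assms by (simp add: proj_cdf_contaminate right_diff_distrib[symmetric] power_mult_distrib)
  then show ?thesis by (simp add: proj_discrepancy_def)
qed

text \<open>Two of the three factors \<open>1 - \<epsilon>\<close> come from the squared difference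
  of distribution functions, the third from the measures against which it is integrated.\<close>

lemma CvM_test_power_ge:
  fixes QX QY :: "'a::euclidean_space measure"
  assumes mn: "2 \<le> m" "2 \<le> n" and \<alpha>: "0 < \<alpha>" "\<alpha> < 1" and \<epsilon>: "0 \<le> \<epsilon>" "\<epsilon> < 1"
    and Q: "distribution_on QX" "distribution_on QY" and G: "G \<in> contaminations \<epsilon> QX QY"
    and \<delta>0: "0 < \<delta>0" "\<delta>0 = ((\<integral>x. proj_discrepancy QX QY x \<partial>QX) + (\<integral>x. proj_discrepancy QX QY x \<partial>QY)) / 2"
  defines "\<delta> \<equiv> (1 - \<epsilon>) ^ 3 * \<delta>0" and "s \<equiv> 1 / real m + 1 / real n"
  assumes s: "2 * s \<le> \<delta> / 16" "real (m + n) * s\<^sup>2 / 2 \<le> \<alpha> * (\<delta> / 16)"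
  shows "1 - 8 * s / \<delta> - 16 * s / \<delta>\<^sup>2 \<le> test_power U_CvM \<alpha> \<epsilon> QX QY m n G"
proof -
  have dG: "distribution_on G" and cont: "continuous_projections (contaminate \<epsilon> QX G)" "continuous_projections (contaminate \<epsilon> QY G)"
    using G by (auto simp: contaminations_def)
  have \<epsilon>': "0 \<le> \<epsilon>" "\<epsilon> \<le> 1" using \<epsilon> by auto
  let ?PX = "contaminate \<epsilon> QX G" and ?PY = "contaminate \<epsilon> QY G"
  interpret two_samples ?PX ?PY m n
    using mn distribution_on_contaminate[OF Q(1) dG \<epsilon>'] distribution_on_contaminate[OF Q(2) dG \<epsilon>']
    by unfold_locales auto
  let ?\<omega> = "proj_discrepancy QX QY"
  have \<omega>: "?\<omega> \<in> borel_measurable borel" "\<And>x. 0 \<le> ?\<omega> x" "\<And>x. ?\<omega> x \<le> 1"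
    using Q proj_discrepancy_bounds by auto
  have "\<delta> = (1 - \<epsilon>)\<^sup>2 * (((1 - \<epsilon>) * (\<integral>x. ?\<omega> x \<partial>QX) + (1 - \<epsilon>) * (\<integral>x. ?\<omega> x \<partial>QY)) / 2)"
    unfolding \<delta>_def \<delta>0(2) distrib_left[symmetric] power2_eq_square power3_eq_cube by simp
  also have "\<dots> \<le> (1 - \<epsilon>)\<^sup>2 * (((\<integral>x. ?\<omega> x \<partial>?PX) + (\<integral>x. ?\<omega> x \<partial>?PY)) / 2)"
    using integral_contaminate_ge[OF Q(1) dG \<epsilon>' \<omega>] integral_contaminate_ge[OF Q(2) dG \<epsilon>' \<omega>]
    by (intro mult_left_mono divide_right_mono add_mono) auto
  also have "\<dots> = ((\<integral>x. proj_discrepancy ?PX ?PY x \<partial>?PX) + (\<integral>x. proj_discrepancy ?PX ?PY x \<partial>?PY)) / 2"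
    by (simp add: proj_discrepancy_contaminate[OF Q dG \<epsilon>'] distrib_left)
  finally have disc: "\<delta> \<le> ((\<integral>x. proj_discrepancy ?PX ?PY x \<partial>?PX) + (\<integral>x. proj_discrepancy ?PX ?PY x \<partial>?PY)) / 2" .
  have "0 < \<delta>" using \<epsilon> \<delta>0(1) by (simp add: \<delta>_def)
  from CvM_power_ge[OF cont \<alpha> this disc] s show ?thesis
    by (simp add: test_power_def pooled_law_eq s_def)
qed

theorem theorem3p1:
  fixes Q\<^sub>X Q\<^sub>Y :: "'a::euclidean_space measure"
    and \<alpha> \<epsilon> \<theta>\<^sub>X \<theta>\<^sub>Y :: real
    and m n :: "nat \<Rightarrow> nat"
  assumes "0 < \<alpha>" "\<alpha> < 1" "0 < \<epsilon>" "\<epsilon> < 1"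
    and "distribution_on Q\<^sub>X" "distribution_on Q\<^sub>Y" "Q\<^sub>X \<noteq> Q\<^sub>Y"
    and "integrable Q\<^sub>X (\<lambda>x. (norm x)\<^sup>2)" "integrable Q\<^sub>Y (\<lambda>x. (norm x)\<^sup>2)"
    and "continuous_projections Q\<^sub>X" "continuous_projections Q\<^sub>Y"
    and "\<And>k. 2 \<le> m k" "\<And>k. 2 \<le> n k"
    and "filterlim (\<lambda>k. m k + n k) at_top sequentially"
    and "0 < \<theta>\<^sub>X" "\<theta>\<^sub>X < 1" "\<theta>\<^sub>Y = 1 - \<theta>\<^sub>X"
    and "(\<lambda>k. real (m k) / real (m k + n k)) \<longlonglongrightarrow> \<theta>\<^sub>X"
    and "(\<lambda>k. real (n k) / real (m k + n k)) \<longlonglongrightarrow> \<theta>\<^sub>Y"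
  shows "(\<exists>G. (\<forall>k. G k \<in> contaminations \<epsilon> Q\<^sub>X Q\<^sub>Y) \<and>
            limsup (\<lambda>k. ereal (test_power U_Energy \<alpha> \<epsilon> Q\<^sub>X Q\<^sub>Y (m k) (n k) (G k))) \<le> ereal \<alpha>)
       \<and> limsup (\<lambda>k. ereal (INF G\<in>contaminations \<epsilon> Q\<^sub>X Q\<^sub>Y.
            test_power U_Energy \<alpha> \<epsilon> Q\<^sub>X Q\<^sub>Y (m k) (n k) G)) \<le> ereal \<alpha>
       \<and> (\<lambda>k. INF G\<in>contaminations \<epsilon> Q\<^sub>X Q\<^sub>Y.
            test_power U_CvM \<alpha> \<epsilon> Q\<^sub>X Q\<^sub>Y (m k) (n k) G) \<longlonglongrightarrow> 1"
proof -
  note \<alpha> = assms(1,2) and \<epsilon> = assms(3,4) and QX = assms(5) and QY = assms(6) and mn = assms(12,13)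
  have \<epsilon>': "0 \<le> \<epsilon>" "\<epsilon> \<le> 1" using \<epsilon> by auto
  let ?E = "\<lambda>k. test_power U_Energy \<alpha> \<epsilon> Q\<^sub>X Q\<^sub>Y (m k) (n k)"
  let ?C = "\<lambda>k. test_power U_CvM \<alpha> \<epsilon> Q\<^sub>X Q\<^sub>Y (m k) (n k)"
  let ?CC = "contaminations \<epsilon> Q\<^sub>X Q\<^sub>Y"
  have N: "filterlim (\<lambda>k. real (m k + n k)) at_top sequentially"
    using assms(14) by (rule filterlim_compose[OF filterlim_real_sequentially])
  have mpos: "0 < real (m k)" "0 < real (n k)" for k using mn(1)[of k] mn(2)[of k] by auto
  have mtop: "filterlim (\<lambda>k. real (m k)) at_top sequentially" and ntop: "filterlim (\<lambda>k. real (n k)) at_top sequentially"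
  proof -
    have "filterlim (\<lambda>k. real (m k) / real (m k + n k) * real (m k + n k)) at_top sequentially"
      by (rule filterlim_tendsto_pos_mult_at_top[OF assms(18) assms(15) N])
    moreover have "real (m k) / real (m k + n k) * real (m k + n k) = real (m k)" for k using mpos[of k] by simp
    ultimately show "filterlim (\<lambda>k. real (m k)) at_top sequentially" by simp
    have "0 < \<theta>\<^sub>Y" using assms(16,17) by simp
    then have "filterlim (\<lambda>k. real (n k) / real (m k + n k) * real (m k + n k)) at_top sequentially"
      by (rule filterlim_tendsto_pos_mult_at_top[OF assms(19) _ N])
    moreover have "real (n k) / real (m k + n k) * real (m k + n k) = real (n k)" for k using mpos[of k] by simp
    ultimately show "filterlim (\<lambda>k. real (n k)) at_top sequentially" by simp
  qed
  define r where "r k = (\<Sum>B\<in>Pow {..<m k + n k}. flag_weight \<epsilon> {..<m k + n k} B * central_ratio (discordance (m k) (n k) B))" for k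
  have r_nonneg: "0 \<le> r k" for k
    unfolding r_def by (intro sum_nonneg mult_nonneg_nonneg flag_weight_nonneg \<epsilon>' central_ratio_nonneg)
  have r0: "r \<longlonglongrightarrow> 0"
  proof (rule tendstoI)
    fix e :: real assume "0 < e"
    \<comment> \<open>The truncation level is fixed by \<open>e\<close> alone; only then do the
      sample sizes make the exponential term small.\<close>
    obtain c :: nat where c: "(2 / e)\<^sup>2 < real c" using reals_Archimedean2 by blast
    then have "0 < real c" using le_less_trans zero_le_power2 by blast
    then have "0 < c" by simp
    have "2 / e < sqrt (real c)" using c \<open>0 < e\<close> by (intro real_less_rsqrt)
    then have c2: "1 / sqrt (real c) < e / 2" using \<open>0 < e\<close> \<open>0 < c\<close> by (simp add: field_simps)
    define q where "q = 1 - \<epsilon> * (1 - \<epsilon>)"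
    have q: "0 \<le> q" "q < 1" using \<epsilon> mult_le_one[of \<epsilon> "1 - \<epsilon>"] by (auto simp: q_def)
    have "filterlim (\<lambda>k. min (m k) (n k)) at_top sequentially"
    proof (rule filterlim_at_top[THEN iffD2], rule allI)
      fix M :: nat
      have "\<forall>\<^sub>F k in sequentially. real M \<le> real (m k)" "\<forall>\<^sub>F k in sequentially. real M \<le> real (n k)"
        using mtop ntop unfolding filterlim_at_top by blast+
      then show "\<forall>\<^sub>F k in sequentially. M \<le> min (m k) (n k)" by eventually_elim simp
    qed
    then have "(\<lambda>k. q ^ min (m k) (n k)) \<longlonglongrightarrow> 0"
      using LIMSEQ_realpow_zero[OF q] by (rule filterlim_compose[rotated])
    then have "(\<lambda>k. 2 ^ c * q ^ min (m k) (n k)) \<longlonglongrightarrow> 0" by (rule tendsto_mult_right_zero)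
    then have "\<forall>\<^sub>F k in sequentially. 2 ^ c * q ^ min (m k) (n k) < e / 2"
      by (rule order_tendstoD(2)) (use \<open>0 < e\<close> in simp)
    then show "\<forall>\<^sub>F k in sequentially. dist (r k) 0 < e"
    proof eventually_elim
      case (elim k)
      have "r k \<le> 1 / sqrt (real c) + 2 ^ c * q ^ min (m k) (n k)"
        unfolding r_def q_def by (rule sum_central_ratio_discordance_le[OF \<epsilon>' \<open>0 < c\<close>])
      then show ?case using elim c2 r_nonneg[of k] by simp
    qed
  qed
  have "\<forall>k. \<exists>G. G \<in> ?CC \<and> ?E k G \<le> \<alpha> + 2 * r k + 1 / real (m k + n k)"
    using energy_power_le[OF mn \<alpha> \<epsilon>' QX QY assms(10,11)] unfolding r_def by blast
  then obtain G where G: "\<And>k. G k \<in> ?CC" "\<And>k. ?E k (G k) \<le> \<alpha> + 2 * r k + 1 / real (m k + n k)" by metis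
  have "(\<lambda>k. \<alpha> + 2 * r k + 1 / real (m k + n k)) \<longlonglongrightarrow> \<alpha> + 2 * 0 + 0"
    by (intro tendsto_add tendsto_mult r0 tendsto_const
        tendsto_divide_0[OF tendsto_const filterlim_at_top_imp_at_infinity[OF N]])
  then have lim: "(\<lambda>k. ereal (\<alpha> + 2 * r k + 1 / real (m k + n k))) \<longlonglongrightarrow> ereal \<alpha>"
    by (simp add: tendsto_ereal)
  \<comment> \<open>Stated for every sequence below the power at \<open>G k\<close>, so that it
    serves the chosen contaminations as well as the infimum.\<close>
  have limsup: "limsup (\<lambda>k. ereal (f k)) \<le> ereal \<alpha>" if "\<And>k. f k \<le> ?E k (G k)" for f
  proof -
    have "f k \<le> \<alpha> + 2 * r k + 1 / real (m k + n k)" for k by (rule order_trans[OF that G(2)])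
    then have "limsup (\<lambda>k. ereal (f k)) \<le> limsup (\<lambda>k. ereal (\<alpha> + 2 * r k + 1 / real (m k + n k)))"
      by (intro Limsup_mono always_eventually allI) (simp only: ereal_less_eq)
    also have "\<dots> = ereal \<alpha>" by (rule lim_imp_Limsup[OF _ lim]) simp
    finally show ?thesis .
  qed
  have bdd: "bdd_below (test_power T \<alpha> \<epsilon> Q\<^sub>X Q\<^sub>Y (m k) (n k) ` ?CC)" for T k
    by (intro bdd_belowI2[of _ 0] test_power_bounds)
  have energy_inf: "(INF G\<in>?CC. ?E k G) \<le> ?E k (G k)" for k by (rule cINF_lower[OF bdd G(1)])

  define \<delta>0 where "\<delta>0 = ((\<integral>x. proj_discrepancy Q\<^sub>X Q\<^sub>Y x \<partial>Q\<^sub>X) + (\<integral>x. proj_discrepancy Q\<^sub>X Q\<^sub>Y x \<partial>Q\<^sub>Y)) / 2"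
  have \<delta>0: "0 < \<delta>0" unfolding \<delta>0_def using proj_discrepancy_pos[OF QX QY assms(7,10,11)] by simp
  define \<delta> where "\<delta> = (1 - \<epsilon>) ^ 3 * \<delta>0"
  have \<delta>: "0 < \<delta>" using \<epsilon> \<delta>0 by (simp add: \<delta>_def)
  define s where "s k = 1 / real (m k) + 1 / real (n k)" for k
  have s0: "s \<longlonglongrightarrow> 0"
    unfolding s_def using tendsto_add[OF tendsto_divide_0[OF tendsto_const filterlim_at_top_imp_at_infinity[OF mtop]]
      tendsto_divide_0[OF tendsto_const filterlim_at_top_imp_at_infinity[OF ntop]], of 1 1] by simp
  \<comment> \<open>Here the balance of the sample sizes enters: \<open>N\<close> times
    \<open>s\<close> is the sum of the reciprocals of the two proportions and so converges, while
    the second factor \<open>s\<close> tends to 0.\<close>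
  have Ns: "(\<lambda>k. real (m k + n k) * (s k)\<^sup>2 / 2) \<longlonglongrightarrow> 0"
  proof -
    have "(\<lambda>k. (inverse (real (m k) / real (m k + n k)) + inverse (real (n k) / real (m k + n k))) * s k / 2) \<longlonglongrightarrow>
        (inverse \<theta>\<^sub>X + inverse \<theta>\<^sub>Y) * 0 / 2"
      using assms(15-19) by (intro tendsto_intros s0) auto
    moreover have "(inverse (real (m k) / real (m k + n k)) + inverse (real (n k) / real (m k + n k))) * s k / 2 =
        real (m k + n k) * (s k)\<^sup>2 / 2" for k
      by (simp add: s_def power2_eq_square field_simps)
    ultimately show ?thesis by simp
  qed
  have "\<forall>\<^sub>F k in sequentially. s k < \<delta> / 32" using \<delta> by (intro order_tendstoD(2)[OF s0]) simp
  moreover have "\<forall>\<^sub>F k in sequentially. real (m k + n k) * (s k)\<^sup>2 / 2 < \<alpha> * (\<delta> / 16)"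
    using \<delta> \<alpha> by (intro order_tendstoD(2)[OF Ns]) simp
  ultimately have lower: "\<forall>\<^sub>F k in sequentially. 1 - 8 * s k / \<delta> - 16 * s k / \<delta>\<^sup>2 \<le> (INF G\<in>?CC. ?C k G)"
  proof eventually_elim
    case (elim k)
    show ?case
    proof (rule cINF_greatest)
      show "?CC \<noteq> {}" using G(1) by auto
      fix H assume H: "H \<in> ?CC"
      show "1 - 8 * s k / \<delta> - 16 * s k / \<delta>\<^sup>2 \<le> ?C k H"
        unfolding \<delta>_def s_def
        by (rule CvM_test_power_ge[OF mn \<alpha> \<epsilon>'(1) \<epsilon>(2) QX QY H \<delta>0 \<delta>0_def])
          (use elim in \<open>simp_all add: \<delta>_def s_def\<close>)
    qed
  qed
  have upper: "(INF G\<in>?CC. ?C k G) \<le> 1" for k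
  proof -
    have "distribution_on (G k)" using G(1)[of k] by (simp add: contaminations_def)
    then have "?C k (G k) \<le> 1" using QX QY \<epsilon>' by (intro test_power_le_1)
    then show ?thesis using cINF_lower[OF bdd G(1)] order_trans by blast
  qed
  have "(\<lambda>k. 1 - 8 * s k / \<delta> - 16 * s k / \<delta>\<^sup>2) \<longlonglongrightarrow> 1 - 8 * 0 / \<delta> - 16 * 0 / \<delta>\<^sup>2"
    using \<delta> by (intro tendsto_intros s0) auto
  then have low1: "(\<lambda>k. 1 - 8 * s k / \<delta> - 16 * s k / \<delta>\<^sup>2) \<longlonglongrightarrow> 1" by simp
  have "(\<lambda>k. INF G\<in>?CC. ?C k G) \<longlonglongrightarrow> 1"
    by (rule tendsto_sandwich[OF lower always_eventually low1 tendsto_const]) (simp add: upper)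
  then show ?thesis using G(1) limsup[of "\<lambda>k. ?E k (G k)"] limsup[OF energy_inf] by blast
qed

end
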